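(* Let $D$ be a centrally finite division ring with center $F$. Assume that $N$ is a non-central subnormal subgroup of $D^*$ (that is, $N\not\subseteq F$). Then there exist $a\in N$ and $b,c\in D^*$ such that $F(aba^{-1}b^{-1})$ and $F(ac-ca)$ are maximal subfields of $D$.
   Context: $D^*$ denotes the multiplicative group of $D$. A division ring $D$ with center $F$ is centrally finite if $[D:F]<\infty$. A subgroup $N$ of a group $G$ is subnormal if there is a finite chain $N=N_r\trianglelefteq N_{r-1}\trianglelefteq\dots\trianglelefteq N_0=G$ with each term normal in the next larger one. For $x\in D$, $F(x)$ is the subfield of $D$ generated by $F$ and $x$; a maximal subfield of $D$ is a commutative division subring that is maximal under inclusion among such. *)

theory Defs
  imports "HOL-Algebra.Algebra"
begin

text \<open>
  The name \<open>division_ring\<close> is already taken by the type class, hence \<open>skew_field\<close> for the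
  carrier-based notion. Commutativity is not assumed.
\<close>
locale skew_field = ring +
  assumes one_not_zero: "\<one> \<noteq> \<zero>"
    and skew_field_Units: "Units R = carrier R - {\<zero>}"

definition ring_center :: "('a, 'b) ring_scheme \<Rightarrow> 'a set"
  where "ring_center R =
    {z \<in> carrier R. \<forall>x \<in> carrier R. z \<otimes>\<^bsub>R\<^esub> x = x \<otimes>\<^bsub>R\<^esub> z}"

locale centrally_finite_skew_field = skew_field +
  assumes finite_over_center: "finite_dimension (ring_center R) (carrier R)"

text \<open>
  The chain descends: \<open>C 0\<close> is the whole group and \<open>C r\<close> is \<open>N\<close>. The predicate \<open>normal\<close> includes
  the subgroup property, so every member of the chain is a subgroup.
\<close>
definition subnormal :: "'a set \<Rightarrow> ('a, 'b) monoid_scheme \<Rightarrow> bool"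
  where "subnormal N G \<longleftrightarrow>
    (\<exists>(r::nat) C. C 0 = carrier G \<and> C r = N \<and>
      (\<forall>i<r. C (Suc i) \<lhd> G\<lparr>carrier := C i\<rparr>))"

text \<open>
  \<open>F(x)\<close> for the center \<open>F\<close>. The set \<open>generate_field\<close> is the closure under the ring operations and
  inverses of nonzero elements, so it makes sense in a noncommutative ring.
\<close>
definition center_adjoin :: "('a, 'b) ring_scheme \<Rightarrow> 'a \<Rightarrow> 'a set"
  where "center_adjoin R x = generate_field R (insert x (ring_center R))"

text \<open>The library's \<open>subfield\<close> requires commutativity of the subset only, not of the ring.\<close>
definition maximal_subfield :: "'a set \<Rightarrow> ('a, 'b) ring_scheme \<Rightarrow> bool"
  where "maximal_subfield K R \<longleftrightarrow>
    subfield K R \<and> (\<forall>L. subfield L R \<and> K \<subseteq> L \<longrightarrow> L = K)"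

end

theory Submission
  imports Defs
begin

text \<open>
  Let \<open>F\<close> be the center of \<open>D\<close>, fix \<open>a\<close>, and let \<open>x\<close> be a commutator with \<open>a\<close> of maximal degree over \<open>F\<close>,
  with minimal polynomial \<open>f\<close>. The degree cannot grow along the curve \<open>x + t y + \<dots>\<close> of commutators, so
  the derivative of \<open>f\<close> at \<open>x\<close> in the direction \<open>y\<close> lies in \<open>F(x)\<close>, because linear independence is
  preserved for all but finitely many \<open>t \<in> F\<close>. As \<open>y\<close> runs over the possible directions this forces
  every \<open>z\<close> in the centralizer of \<open>x\<close> outside of \<open>F(x)\<close> to commute with \<open>a\<close>. So either \<open>F(x)\<close> is its own
  centralizer, hence a maximal subfield, or \<open>a\<close> commutes with \<open>x\<close>. If the second alternative holds
  for all commutators of maximal degree, then it holds for all commutators, and then \<open>a\<close> is central,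
  except for additive commutators if \<open>D\<close> has characteristic 2 and \<open>a\<^sup>2 \<in> F\<close>. Iterated commutators
  show that a noncentral subnormal subgroup contains an \<open>a\<close> that avoids this exception. That \<open>F\<close> is
  infinite is Wedderburn's little theorem.
\<close>

section \<open>Finite sums and the telescoping identity\<close>

text \<open>The polynomial \<open>f\<close> may be inseparable, so \<open>f'(x)\<close> may vanish
  and cannot carry the argument. The derivative in all directions survives:
  \<open>twist f m x x d\<close> is nonzero as a function of \<open>d\<close>, because its last
  coefficient is 1 and the powers of \<open>x\<close> below the degree are independent. Used between
  two roots of \<open>f\<close>, the same operator intertwines them, which supplies the conjugating
  element inside the proof of Wedderburn's theorem.

  Additive commutators with \<open>a\<close> form a vector space over \<open>F\<close>, so straight
  lines are curves of commutators. In the multiplicative case the conjugate \<open>u^-1 a u\<close>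
  with \<open>u = 1 + t y\<close> is only rational in \<open>t\<close>. As \<open>y\<close> is
  algebraic, the denominator can be taken to be a central polynomial in \<open>t\<close>, and
  neither conjugation nor nonzero central scaling changes degrees. So a polynomial curve is
  available there as well, at the price of a central multiple of \<open>f'(x)\<close> that stays
  inside \<open>F(x)\<close>.

  Dimensions of maximal subfields are never computed: maximality is read off from a commutative
  centralizer.\<close>

context ring
begin

primrec psum :: "(nat \<Rightarrow> 'a) \<Rightarrow> nat \<Rightarrow> 'a"
  where
    "psum f 0 = \<zero>"
  | "psum f (Suc n) = psum f n \<oplus> f n"

lemma psum_closed [simp]: "(\<And>i. i < n \<Longrightarrow> f i \<in> carrier R) \<Longrightarrow> psum f n \<in> carrier R"
  by (induction n) auto

lemma psum_cong: "(\<And>i. i < n \<Longrightarrow> f i = g i) \<Longrightarrow> psum f n = psum g n"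
  by (induction n) auto

lemma psum_zero: "(\<And>i. i < n \<Longrightarrow> f i = \<zero>) \<Longrightarrow> psum f n = \<zero>"
  by (induction n) auto

lemma psum_add:
  assumes "\<And>i. i < n \<Longrightarrow> f i \<in> carrier R" "\<And>i. i < n \<Longrightarrow> g i \<in> carrier R"
  shows "psum (\<lambda>i. f i \<oplus> g i) n = psum f n \<oplus> psum g n"
  using assms
proof (induction n)
  case (Suc n)
  moreover have "psum f n \<in> carrier R" "psum g n \<in> carrier R" "f n \<in> carrier R" "g n \<in> carrier R"
    using Suc.prems by (auto intro!: psum_closed)
  ultimately show ?case
    by (simp add: a_ac)
qed auto

lemma psum_neg:
  assumes "\<And>i. i < n \<Longrightarrow> f i \<in> carrier R"
  shows "psum (\<lambda>i. \<ominus> f i) n = \<ominus> psum f n"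
  using assms
proof (induction n)
  case (Suc n)
  moreover have "psum f n \<in> carrier R" "f n \<in> carrier R"
    using Suc.prems by (auto intro!: psum_closed)
  ultimately show ?case
    by (simp add: minus_add)
qed auto

lemma psum_diff:
  assumes "\<And>i. i < n \<Longrightarrow> f i \<in> carrier R" "\<And>i. i < n \<Longrightarrow> g i \<in> carrier R"
  shows "psum (\<lambda>i. f i \<ominus> g i) n = psum f n \<ominus> psum g n"
  using assms psum_add[of n f "\<lambda>i. \<ominus> g i"] psum_neg[of n g] by (simp add: a_minus_def)

lemma psum_lmult:
  assumes "\<And>i. i < n \<Longrightarrow> f i \<in> carrier R" "d \<in> carrier R"
  shows "d \<otimes> psum f n = psum (\<lambda>i. d \<otimes> f i) n"
  using assms
proof (induction n)
  case (Suc n)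
  moreover have "psum f n \<in> carrier R" "f n \<in> carrier R"
    using Suc.prems by (auto intro!: psum_closed)
  ultimately show ?case
    by (simp add: r_distr)
qed auto

lemma psum_rmult:
  assumes "\<And>i. i < n \<Longrightarrow> f i \<in> carrier R" "d \<in> carrier R"
  shows "psum f n \<otimes> d = psum (\<lambda>i. f i \<otimes> d) n"
  using assms
proof (induction n)
  case (Suc n)
  moreover have "psum f n \<in> carrier R" "f n \<in> carrier R"
    using Suc.prems by (auto intro!: psum_closed)
  ultimately show ?case
    by (simp add: l_distr)
qed auto

lemma psum_shift:
  assumes "\<And>i. i < Suc n \<Longrightarrow> f i \<in> carrier R"
  shows "psum f (Suc n) = f 0 \<oplus> psum (\<lambda>i. f (Suc i)) n"
  using assms
proof (induction n)
  case (Suc n)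
  have "f 0 \<in> carrier R" "psum (\<lambda>i. f (Suc i)) n \<in> carrier R" "f (Suc n) \<in> carrier R"
    using Suc.prems by (auto intro!: psum_closed)
  moreover have "psum f (Suc (Suc n)) = (f 0 \<oplus> psum (\<lambda>i. f (Suc i)) n) \<oplus> f (Suc n)"
    using Suc by simp
  ultimately show ?case
    by (simp add: a_assoc)
qed auto

lemma psum_split:
  assumes "\<And>i. i < n + k \<Longrightarrow> f i \<in> carrier R"
  shows "psum f (n + k) = psum f n \<oplus> psum (\<lambda>i. f (n + i)) k"
  using assms
proof (induction k)
  case (Suc k)
  have "psum f n \<in> carrier R" "psum (\<lambda>i. f (n + i)) k \<in> carrier R" "f (n + k) \<in> carrier R"
    using Suc.prems by (auto intro!: psum_closed)
  then show ?case
    using Suc by (simp add: a_assoc)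
next
  case 0
  then have "psum f n \<in> carrier R"
    by (auto intro!: psum_closed)
  then show ?case by simp
qed

lemma psum_single:
  assumes "j < n" "f j \<in> carrier R" "\<And>i. i < n \<Longrightarrow> i \<noteq> j \<Longrightarrow> f i = \<zero>"
  shows "psum f n = f j"
  using assms
proof (induction n)
  case (Suc n)
  show ?case
  proof (cases "j = n")
    case True
    then have "psum f n = \<zero>"
      using Suc.prems by (intro psum_zero) auto
    then show ?thesis
      using True Suc.prems by simp
  next
    case False
    then show ?thesis
      using Suc by simp
  qed
qed auto

text \<open>One notion for three uses: the centralizer of an element is
  \<open>commutant {x}\<close>, the center is the commutant of the carrier, and a self-centralizing
  set satisfies \<open>commutant K = K\<close>. The closure rules are proved once for all of
  them.\<close>

definition commutant :: "'a set \<Rightarrow> 'a set"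
  where "commutant S = {d \<in> carrier R. \<forall>s \<in> S. d \<otimes> s = s \<otimes> d}"

lemma commutantI: "d \<in> carrier R \<Longrightarrow> (\<And>s. s \<in> S \<Longrightarrow> d \<otimes> s = s \<otimes> d) \<Longrightarrow> d \<in> commutant S"
  by (simp add: commutant_def)

lemma commutantD:
  assumes "d \<in> commutant S"
  shows commutant_closed: "d \<in> carrier R" and commutant_comm: "s \<in> S \<Longrightarrow> d \<otimes> s = s \<otimes> d"
  using assms unfolding commutant_def by blast+

lemma commutant_ring:
  assumes S: "S \<subseteq> carrier R"
  shows commutant_zero: "\<zero> \<in> commutant S"
    and commutant_one: "\<one> \<in> commutant S"
    and commutant_add: "d \<in> commutant S \<Longrightarrow> e \<in> commutant S \<Longrightarrow> d \<oplus> e \<in> commutant S"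
    and commutant_neg: "d \<in> commutant S \<Longrightarrow> \<ominus> d \<in> commutant S"
    and commutant_diff: "d \<in> commutant S \<Longrightarrow> e \<in> commutant S \<Longrightarrow> d \<ominus> e \<in> commutant S"
    and commutant_mult: "d \<in> commutant S \<Longrightarrow> e \<in> commutant S \<Longrightarrow> d \<otimes> e \<in> commutant S"
proof -
  have s: "s \<in> carrier R" if "s \<in> S" for s
    using that S by auto
  show "\<zero> \<in> commutant S" "\<one> \<in> commutant S"
    by (auto intro!: commutantI simp: s)
  show *: "d \<oplus> e \<in> commutant S" if "d \<in> commutant S" "e \<in> commutant S" for d e
    using that s by (auto simp: commutant_def l_distr r_distr)
  show neg: "\<ominus> d \<in> commutant S" if "d \<in> commutant S" for d
    using that s by (auto simp: commutant_def l_minus r_minus)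
  show "d \<ominus> e \<in> commutant S" if "d \<in> commutant S" "e \<in> commutant S" for d e
    unfolding a_minus_def using that neg * by blast
  show "d \<otimes> e \<in> commutant S" if "d \<in> commutant S" "e \<in> commutant S" for d e
  proof (rule commutantI)
    show "d \<otimes> e \<in> carrier R"
      using that by (simp add: commutant_closed)
    fix t assume t: "t \<in> S"
    have "d \<otimes> e \<otimes> t = d \<otimes> (t \<otimes> e)"
      using that t s by (simp add: m_assoc commutant_closed commutant_comm[of e S])
    also have "\<dots> = t \<otimes> (d \<otimes> e)"
      using that t s by (simp add: m_assoc[symmetric] commutant_closed commutant_comm[of d S])
    finally show "d \<otimes> e \<otimes> t = t \<otimes> (d \<otimes> e)" .
  qed
qed

lemma commutant_pow:
  assumes "S \<subseteq> carrier R" "d \<in> commutant S"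
  shows "d [^] (n::nat) \<in> commutant S"
proof (induction n)
  case 0
  show ?case
    using commutant_one[OF assms(1)] by simp
next
  case (Suc n)
  then show ?case
    using commutant_mult[OF assms(1) _ assms(2)] by simp
qed

lemma commutant_psum:
  assumes "S \<subseteq> carrier R" "\<And>i. i < n \<Longrightarrow> f i \<in> commutant S"
  shows "psum f n \<in> commutant S"
  using assms(2)
proof (induction n)
  case 0
  show ?case
    using commutant_zero[OF assms(1)] by simp
next
  case (Suc n)
  then show ?case
    using commutant_add[OF assms(1), of "psum f n" "f n"] by simp
qed

lemma ring_center_eq: "ring_center R = commutant (carrier R)"
  unfolding ring_center_def commutant_def ..

lemma ring_center_subset: "ring_center R \<subseteq> carrier R"
  unfolding ring_center_def by blast

lemma ring_center_closed [simp]: "z \<in> ring_center R \<Longrightarrow> z \<in> carrier R"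
  unfolding ring_center_def by blast

lemma ring_center_comm: "z \<in> ring_center R \<Longrightarrow> x \<in> carrier R \<Longrightarrow> z \<otimes> x = x \<otimes> z"
  unfolding ring_center_def by blast

lemma center_commutant: "z \<in> ring_center R \<Longrightarrow> S \<subseteq> carrier R \<Longrightarrow> z \<in> commutant S"
  by (rule commutantI) (simp_all add: ring_center_comm subset_iff)

lemma commutant_self: "x \<in> carrier R \<Longrightarrow> x \<in> commutant {x}"
  by (simp add: commutant_def)

lemmas center_ring [simp] =
  commutant_zero[OF subset_refl, folded ring_center_eq]
  commutant_one[OF subset_refl, folded ring_center_eq]
  commutant_add[OF subset_refl, folded ring_center_eq]
  commutant_neg[OF subset_refl, folded ring_center_eq]
  commutant_diff[OF subset_refl, folded ring_center_eq]
  commutant_mult[OF subset_refl, folded ring_center_eq]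
  commutant_pow[OF subset_refl, folded ring_center_eq]
  commutant_psum[OF subset_refl, folded ring_center_eq]

lemma center_lcomm:
  assumes "z \<in> ring_center R" "x \<in> carrier R" "y \<in> carrier R"
  shows "x \<otimes> (z \<otimes> y) = z \<otimes> (x \<otimes> y)"
  using assms by (metis m_assoc ring_center_closed ring_center_comm)


text \<open>For the monic polynomial \<open>f\<close> with lower coefficients \<open>f 0, \<dots>, f (m - 1)\<close>, the value at \<open>x\<close> is
  \<open>horner f m x 0\<close>, and the coefficients of \<open>(f(T) - f(x)) / (T - x)\<close> are the
  \<open>horner f m x (Suc j)\<close>.\<close>

definition horner :: "(nat \<Rightarrow> 'a) \<Rightarrow> nat \<Rightarrow> 'a \<Rightarrow> nat \<Rightarrow> 'a"
  where "horner f m x k = psum (\<lambda>i. f (k + i) \<otimes> x [^] i) (m - k) \<oplus> x [^] (m - k)"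

text \<open>A difference quotient with a slot \<open>d\<close> between its two arguments. For
  \<open>T^n\<close> it is the sum of \<open>x^(n-1-j) d w^j\<close>. On the diagonal
  \<open>w = x\<close> it is the derivative of \<open>f\<close> at \<open>x\<close> in the direction
  \<open>d\<close>, and \<open>d = \<one>\<close> then gives the usual \<open>f'(x)\<close>.\<close>

definition twist :: "(nat \<Rightarrow> 'a) \<Rightarrow> nat \<Rightarrow> 'a \<Rightarrow> 'a \<Rightarrow> 'a \<Rightarrow> 'a"
  where "twist f m x w d = psum (\<lambda>j. horner f m x (Suc j) \<otimes> d \<otimes> w [^] j) m"

context
  fixes f :: "nat \<Rightarrow> 'a" and m :: nat
  assumes f: "\<And>i. i < m \<Longrightarrow> f i \<in> ring_center R"
begin

lemma horner_closed [simp]: "x \<in> carrier R \<Longrightarrow> horner f m x k \<in> carrier R"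
  unfolding horner_def using f by (auto intro!: psum_closed)

lemma horner_top: "horner f m x m = \<one>"
  by (simp add: horner_def)

lemma horner_step:
  assumes "x \<in> carrier R" "k < m"
  shows "horner f m x k = f k \<oplus> x \<otimes> horner f m x (Suc k)"
proof -
  obtain n where n: "m = Suc (k + n)"
    using assms(2) less_imp_Suc_add by blast
  have c: "f (k + i) \<in> ring_center R" if "i < Suc n" for i
    using that n by (intro f) auto
  then have [simp]: "f (k + i) \<in> carrier R" if "i < Suc n" for i
    using that by auto
  have "psum (\<lambda>i. f (k + i) \<otimes> x [^] i) (Suc n)
      = f k \<oplus> psum (\<lambda>i. f (Suc k + i) \<otimes> x [^] Suc i) n"
    using assms n c[of 0] by (subst psum_shift) auto
  also have "psum (\<lambda>i. f (Suc k + i) \<otimes> x [^] Suc i) n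
      = psum (\<lambda>i. x \<otimes> (f (Suc k + i) \<otimes> x [^] i)) n"
  proof (rule psum_cong)
    fix i assume i: "i < n"
    have "f (Suc k + i) \<otimes> x [^] Suc i = f (Suc k + i) \<otimes> (x \<otimes> x [^] i)"
      using assms by (simp add: nat_pow_comm[of x 1 i, simplified])
    also have "\<dots> = x \<otimes> (f (Suc k + i) \<otimes> x [^] i)"
      using center_lcomm[of "f (Suc k + i)" x "x [^] i"] assms c[of "Suc i"] i by simp
    finally show "f (Suc k + i) \<otimes> x [^] Suc i = x \<otimes> (f (Suc k + i) \<otimes> x [^] i)" .
  qed
  also have "\<dots> = x \<otimes> psum (\<lambda>i. f (Suc k + i) \<otimes> x [^] i) n"
    using assms c[of "Suc _"] by (subst psum_lmult) auto
  finally have "psum (\<lambda>i. f (k + i) \<otimes> x [^] i) (Suc n)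
      = f k \<oplus> x \<otimes> psum (\<lambda>i. f (Suc k + i) \<otimes> x [^] i) n" .
  moreover have "psum (\<lambda>i. f (Suc k + i) \<otimes> x [^] i) n \<in> carrier R"
    using assms c[of "Suc _"] by (intro psum_closed) auto
  moreover have "x [^] Suc n = x \<otimes> x [^] n"
    using assms by (simp add: nat_pow_comm[of x 1 n, simplified])
  ultimately show ?thesis
    using assms n c[of 0] unfolding horner_def by (simp add: r_distr a_assoc)
qed

lemma twist_closed [simp]:
  "x \<in> carrier R \<Longrightarrow> w \<in> carrier R \<Longrightarrow> d \<in> carrier R \<Longrightarrow> twist f m x w d \<in> carrier R"
  unfolding twist_def by (auto intro!: psum_closed)

lemma twist_add:
  assumes "x \<in> carrier R" "w \<in> carrier R" "d \<in> carrier R" "e \<in> carrier R"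
  shows "twist f m x w (d \<oplus> e) = twist f m x w d \<oplus> twist f m x w e"
  using assms unfolding twist_def
  by (subst psum_add[symmetric]) (auto intro!: psum_cong simp: l_distr r_distr)

lemma twist_diff:
  assumes "x \<in> carrier R" "w \<in> carrier R" "d \<in> carrier R" "e \<in> carrier R"
  shows "twist f m x w (d \<ominus> e) = twist f m x w d \<ominus> twist f m x w e"
  using assms unfolding twist_def
  by (subst psum_diff[symmetric])
    (auto intro!: psum_cong simp: a_minus_def l_distr r_distr l_minus r_minus)

lemma twist_rmult:
  assumes "x \<in> carrier R" "w \<in> carrier R" "d \<in> carrier R" "z \<in> carrier R" "z \<otimes> w = w \<otimes> z"
  shows "twist f m x w (d \<otimes> z) = twist f m x w d \<otimes> z"
proof -
  have z: "z \<otimes> w [^] j = w [^] j \<otimes> z" for j :: nat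
    using commutant_pow[of "{z}" w j] assms by (auto simp: commutant_def)
  show ?thesis
    unfolding twist_def using assms
    by (subst psum_rmult) (auto intro!: psum_cong simp: m_assoc z)
qed

text \<open>For \<open>d = \<one>\<close> this expands \<open>f(w)\<close> around the root \<open>x\<close>, and for a root \<open>w\<close> of \<open>f\<close> it says that
  \<open>d \<mapsto> twist f m x w d\<close> takes values in the elements intertwining \<open>w\<close> and \<open>x\<close>.\<close>

lemma twist_telescope:
  assumes [simp]: "x \<in> carrier R" "w \<in> carrier R" "d \<in> carrier R"
  shows "twist f m x w (d \<otimes> w \<ominus> x \<otimes> d) = d \<otimes> horner f m w 0 \<ominus> horner f m x 0 \<otimes> d"
proof -
  let ?g = "horner f m x"
  \<comment> \<open>Induction over the prefixes of the sum: by
    \<open>?g k = f k + x ?g (Suc k)\<close> neighbouring terms cancel and only a boundary term with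
    \<open>w [^] k\<close> remains. At \<open>k = m\<close> its factor \<open>?g m\<close> is
    \<open>\<one>\<close>, and the collected terms complete \<open>d f(w)\<close>.\<close>
  have "psum (\<lambda>j. ?g (Suc j) \<otimes> (d \<otimes> w \<ominus> x \<otimes> d) \<otimes> w [^] j) k
      = (?g k \<otimes> d \<otimes> w [^] k \<ominus> ?g 0 \<otimes> d) \<oplus> psum (\<lambda>j. d \<otimes> (f j \<otimes> w [^] j)) k"
    if "k \<le> m" for k
    using that
  proof (induction k)
    case 0
    then show ?case
      by (simp add: minus_eq r_neg)
  next
    case (Suc k)
    then have fk: "f k \<in> ring_center R"
      by (intro f) auto
    have [simp]: "f k \<in> carrier R"
      using fk by simp
    define G where "G = ?g (Suc k)"
    define W where "W = w [^] k"
    define S where "S = psum (\<lambda>j. d \<otimes> (f j \<otimes> w [^] j)) k"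
    define g0 where "g0 = ?g 0"
    have cl [simp]: "G \<in> carrier R" "W \<in> carrier R" "S \<in> carrier R" "g0 \<in> carrier R"
      unfolding G_def W_def S_def g0_def using f Suc.prems by (auto intro!: psum_closed)
    have Wc: "w [^] Suc k = w \<otimes> W"
      by (simp add: W_def nat_pow_comm[of w 1 k, simplified])
    have xG: "x \<otimes> G = G \<otimes> x"
    proof -
      have "f j \<in> commutant {x}" if "j < m" for j
        using f that by (auto intro: center_commutant)
      then have "G \<in> commutant {x}"
        unfolding G_def horner_def
        by (intro commutant_add commutant_psum commutant_mult commutant_pow)
          (auto simp: commutant_self)
      then show ?thesis
        using commutant_comm[of G "{x}" x] by simp
    qed
    have gk: "?g k = f k \<oplus> G \<otimes> x"
      using Suc.prems by (simp add: horner_step[of x k] G_def[symmetric] xG)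
    have fd: "d \<otimes> (f k \<otimes> W) = f k \<otimes> (d \<otimes> W)"
      using fk center_lcomm[of "f k" d W] by simp
    define E where "E = psum (\<lambda>j. ?g (Suc j) \<otimes> (d \<otimes> w \<ominus> x \<otimes> d) \<otimes> w [^] j) k"
    have "E = (?g k \<otimes> d \<otimes> W \<ominus> g0 \<otimes> d) \<oplus> S"
      using Suc unfolding E_def W_def S_def g0_def by simp
    then have "E \<oplus> G \<otimes> (d \<otimes> w \<ominus> x \<otimes> d) \<otimes> W
        = ((f k \<oplus> G \<otimes> x) \<otimes> d \<otimes> W \<ominus> g0 \<otimes> d) \<oplus> S \<oplus> G \<otimes> (d \<otimes> w \<ominus> x \<otimes> d) \<otimes> W"
      by (simp only: gk)
    also have "\<dots> = (G \<otimes> d \<otimes> (w \<otimes> W) \<ominus> g0 \<otimes> d) \<oplus> (S \<oplus> f k \<otimes> (d \<otimes> W))"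
      using cl assms \<open>f k \<in> carrier R\<close> by algebra
    finally show ?case
      unfolding psum.simps Wc E_def[symmetric] G_def[symmetric] g0_def[symmetric]
        W_def[symmetric] S_def[symmetric] fd .
  qed
  note sum_eq = this[of m]
  define g0 where "g0 = ?g 0"
  define W where "W = w [^] m"
  define P where "P = psum (\<lambda>j. f j \<otimes> w [^] j) m"
  have cl: "P \<in> carrier R" "g0 \<in> carrier R" "W \<in> carrier R"
    unfolding P_def g0_def W_def using f by (auto intro!: psum_closed)
  have "twist f m x w (d \<otimes> w \<ominus> x \<otimes> d)
      = (d \<otimes> W \<ominus> g0 \<otimes> d) \<oplus> d \<otimes> P"
  proof -
    have "d \<otimes> P = psum (\<lambda>j. d \<otimes> (f j \<otimes> w [^] j)) m"
      unfolding P_def using f by (intro psum_lmult) auto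
    then show ?thesis
      using sum_eq unfolding twist_def g0_def W_def by (simp add: horner_top)
  qed
  also have "\<dots> = d \<otimes> (P \<oplus> W) \<ominus> g0 \<otimes> d"
    using cl assms by algebra
  finally show ?thesis
    unfolding P_def W_def g0_def horner_def[of f m w 0] by simp
qed

end

end

section \<open>Linear independence over the center\<close>

context skew_field
begin

lemma ring_centerI:
  "z \<in> carrier R \<Longrightarrow> (\<And>x. x \<in> carrier R \<Longrightarrow> z \<otimes> x = x \<otimes> z) \<Longrightarrow> z \<in> ring_center R"
  unfolding ring_center_def by blast

lemma nonzero_Units: "x \<in> carrier R \<Longrightarrow> x \<noteq> \<zero> \<Longrightarrow> x \<in> Units R"
  using skew_field_Units by blast

lemma nonzero_inv [simp]:
  assumes "x \<in> carrier R" "x \<noteq> \<zero>"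
  shows "inv x \<in> carrier R" "inv x \<otimes> x = \<one>" "x \<otimes> inv x = \<one>"
  using nonzero_Units[OF assms] by auto

lemma inv_cancel [simp]:
  assumes "x \<in> carrier R" "x \<noteq> \<zero>" "y \<in> carrier R"
  shows "inv x \<otimes> (x \<otimes> y) = y" "x \<otimes> (inv x \<otimes> y) = y"
  using assms by (simp_all add: m_assoc[symmetric])

lemma mult_eq_zero:
  assumes "x \<in> carrier R" "y \<in> carrier R"
  shows "x \<otimes> y = \<zero> \<longleftrightarrow> x = \<zero> \<or> y = \<zero>"
  using assms by (metis inv_cancel(1) l_null nonzero_inv(1) r_null)

lemma inv_nonzero:
  assumes "x \<in> carrier R" "x \<noteq> \<zero>"
  shows "inv x \<noteq> \<zero>"
  using assms one_not_zero nonzero_inv by (metis r_null)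

lemma pow_nonzero:
  assumes "x \<in> carrier R" "x \<noteq> \<zero>"
  shows "x [^] (n::nat) \<noteq> \<zero>"
  using assms one_not_zero by (induction n) (auto simp: mult_eq_zero)

lemma mult_left_cancel:
  assumes "x \<in> carrier R" "y \<in> carrier R" "z \<in> carrier R" "x \<noteq> \<zero>" "x \<otimes> y = x \<otimes> z"
  shows "y = z"
  using assms by (metis inv_cancel(1))

lemma mult_right_cancel:
  assumes "x \<in> carrier R" "y \<in> carrier R" "z \<in> carrier R" "x \<noteq> \<zero>" "y \<otimes> x = z \<otimes> x"
  shows "y = z"
  using assms by (metis m_assoc nonzero_inv(1,3) r_one)

lemma commutant_inv:
  assumes "S \<subseteq> carrier R" "d \<in> commutant S" "d \<noteq> \<zero>"
  shows "inv d \<in> commutant S"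
proof (rule commutantI)
  have d: "d \<in> carrier R"
    using assms(2) by (rule commutant_closed)
  then show "inv d \<in> carrier R"
    using assms(3) by simp
  fix s assume s: "s \<in> S"
  then have sc: "s \<in> carrier R"
    using assms(1) by blast
  show "inv d \<otimes> s = s \<otimes> inv d"
  proof (rule mult_left_cancel[of d])
    have "d \<otimes> (s \<otimes> inv d) = (d \<otimes> s) \<otimes> inv d"
      using d sc assms(3) by (simp add: m_assoc)
    also have "\<dots> = s \<otimes> d \<otimes> inv d"
      using commutant_comm[OF assms(2) s] by simp
    also have "\<dots> = d \<otimes> (inv d \<otimes> s)"
      using d sc assms(3) by (simp add: m_assoc)
    finally show "d \<otimes> (inv d \<otimes> s) = d \<otimes> (s \<otimes> inv d)" by simp
  qed (use d sc assms(3) in auto)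
qed

lemmas center_inv = commutant_inv[OF subset_refl, folded ring_center_eq]

lemma commutant_subfield:
  assumes S: "S \<subseteq> carrier R"
    and comm: "\<And>x y. x \<in> commutant S \<Longrightarrow> y \<in> commutant S \<Longrightarrow> x \<otimes> y = y \<otimes> x"
  shows "subfield (commutant S) R"
proof (rule subfieldI)
  have sub: "commutant S \<subseteq> carrier R"
    by (auto simp: commutant_closed)
  have "subring (commutant S) R"
    using S sub by (intro subringI) (auto intro: commutant_one commutant_neg commutant_add commutant_mult)
  then show "subcring (commutant S) R"
    using comm by (rule subcringI)
  have "k \<in> Units (R\<lparr>carrier := commutant S\<rparr>)" if "k \<in> commutant S" "k \<noteq> \<zero>" for k
    unfolding Units_def using that commutant_inv[OF S that] commutant_closed[OF that(1)]
    by (auto intro!: bexI[of _ "inv k"])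
  moreover have "\<zero> \<notin> Units (R\<lparr>carrier := commutant S\<rparr>)"
    using sub one_not_zero by (auto simp: Units_def)
  ultimately show "Units (R\<lparr>carrier := commutant S\<rparr>) = commutant S - {\<zero>}"
    by (auto simp: Units_def)
qed

lemma center_subfield: "subfield (ring_center R) R"
  unfolding ring_center_eq
  by (rule commutant_subfield) (auto intro: commutant_comm commutant_closed)

text \<open>A larger subfield contains \<open>x\<close> and is commutative, so it lies in the
  centralizer of \<open>x\<close> again.\<close>

lemma maximal_subfield_commutant:
  assumes x: "x \<in> carrier R"
    and comm: "\<And>y z. y \<in> commutant {x} \<Longrightarrow> z \<in> commutant {x} \<Longrightarrow> y \<otimes> z = z \<otimes> y"
  shows "maximal_subfield (commutant {x}) R"
  unfolding maximal_subfield_def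
proof (intro conjI allI impI)
  show "subfield (commutant {x}) R"
    using x comm by (intro commutant_subfield) auto
  fix L assume L: "subfield L R \<and> commutant {x} \<subseteq> L"
  have "y \<in> commutant {x}" if "y \<in> L" for y
  proof (rule commutantI)
    show "y \<in> carrier R"
      using that L subfieldE(3) by blast
    have "x \<in> L"
      using L commutant_self[OF x] by blast
    then show "y \<otimes> s = s \<otimes> y" if "s \<in> {x}" for s
      using that \<open>y \<in> L\<close> L subcringE(7)[of L R] subfieldE(1)[of L R] by (metis L singletonD subfieldE(4))
  qed
  then show "L = commutant {x}"
    using L by blast
qed

text \<open>Families rather than sets, so that repeated vectors count as dependent and the vectors
  may later vary with a parameter \<open>t\<close>.\<close>

definition indep :: "nat \<Rightarrow> (nat \<Rightarrow> 'a) \<Rightarrow> bool"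
  where "indep n v \<longleftrightarrow>
    (\<forall>c. (\<forall>i<n. c i \<in> ring_center R) \<and> psum (\<lambda>i. c i \<otimes> v i) n = \<zero> \<longrightarrow> (\<forall>i<n. c i = \<zero>))"

lemma indepI:
  assumes "\<And>c i. (\<And>i. i < n \<Longrightarrow> c i \<in> ring_center R) \<Longrightarrow> psum (\<lambda>i. c i \<otimes> v i) n = \<zero> \<Longrightarrow> i < n \<Longrightarrow> c i = \<zero>"
  shows "indep n v"
  using assms unfolding indep_def by blast

lemma indepD:
  assumes "indep n v" "\<And>i. i < n \<Longrightarrow> c i \<in> ring_center R" "psum (\<lambda>i. c i \<otimes> v i) n = \<zero>" "i < n"
  shows "c i = \<zero>"
  using assms unfolding indep_def by blast

lemma indep_mono:
  assumes "indep n v" "k \<le> n" "\<And>i. i < n \<Longrightarrow> v i \<in> carrier R"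
  shows "indep k v"
proof (rule indepI)
  fix c i
  assume c: "\<And>i. i < k \<Longrightarrow> c i \<in> ring_center R" "psum (\<lambda>i. c i \<otimes> v i) k = \<zero>" "i < k"
  define c' where "c' = (\<lambda>i. if i < k then c i else \<zero>)"
  obtain r where r: "n = k + r"
    using assms(2) le_Suc_ex by blast
  have "psum (\<lambda>i. c' i \<otimes> v i) n = psum (\<lambda>i. c' i \<otimes> v i) k \<oplus> psum (\<lambda>i. c' (k + i) \<otimes> v (k + i)) r"
    unfolding r using assms(3) c(1) r by (intro psum_split) (auto simp: c'_def)
  also have "psum (\<lambda>i. c' i \<otimes> v i) k = psum (\<lambda>i. c i \<otimes> v i) k"
    by (intro psum_cong) (auto simp: c'_def)
  also have "psum (\<lambda>i. c' (k + i) \<otimes> v (k + i)) r = \<zero>"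
    using assms(3) r by (intro psum_zero) (auto simp: c'_def)
  finally have "psum (\<lambda>i. c' i \<otimes> v i) n = \<zero>"
    using c(2) by simp
  then have "c' i = \<zero>"
    using indepD[OF assms(1), of c' i] c assms(2) by (auto simp: c'_def)
  then show "c i = \<zero>"
    using c(3) by (simp add: c'_def)
qed

lemma indep_nonzero:
  assumes "indep n v" "i < n" "\<And>i. i < n \<Longrightarrow> v i \<in> carrier R"
  shows "v i \<noteq> \<zero>"
proof
  assume "v i = \<zero>"
  then have "psum (\<lambda>j. (if j = i then \<one> else \<zero>) \<otimes> v j) n = \<zero>"
    using assms by (intro psum_zero) auto
  then have "(if i = i then \<one> else \<zero>) = \<zero>"
    by (intro indepD[OF assms(1), of "\<lambda>j. if j = i then \<one> else \<zero>" i]) (simp_all add: assms(2))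
  then show False
    using one_not_zero by simp
qed

text \<open>If some coefficient is nonzero, normalize the last one to \<open>\<one>\<close>. Commuting the relation past \<open>d\<close>
  shortens it, so all coefficients are central and \<open>c = \<one>\<close> contradicts independence.\<close>

lemma indep_coeffs_zero:
  assumes "indep n v" "\<And>i. i < n \<Longrightarrow> v i \<in> carrier R" "\<And>i. i < n \<Longrightarrow> A i \<in> carrier R"
    and "\<And>c. c \<in> carrier R \<Longrightarrow> psum (\<lambda>i. A i \<otimes> c \<otimes> v i) n = \<zero>"
    and "i < n"
  shows "A i = \<zero>"
  using assms
proof (induction n arbitrary: A i)
  case (Suc n)
  have indep: "indep n v"
    by (rule indep_mono[OF Suc.prems(1) _ Suc.prems(2)]) auto
  have last: "A n = \<zero>"
  proof (rule ccontr)
    assume nz: "A n \<noteq> \<zero>"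
    define B where "B = (\<lambda>i. inv (A n) \<otimes> A i)"
    have An: "A n \<in> carrier R" "inv (A n) \<in> carrier R"
      using Suc.prems(3) nz by auto
    then have B: "B i \<in> carrier R" if "i < Suc n" for i
      using that Suc.prems(3) by (auto simp: B_def)
    have Bn: "B n = \<one>"
      using An nz by (simp add: B_def)
    have relB: "psum (\<lambda>i. B i \<otimes> c \<otimes> v i) (Suc n) = \<zero>" if c: "c \<in> carrier R" for c
    proof -
      have "psum (\<lambda>i. B i \<otimes> c \<otimes> v i) (Suc n) = psum (\<lambda>i. inv (A n) \<otimes> (A i \<otimes> c \<otimes> v i)) (Suc n)"
        using Suc.prems(2,3) An c by (intro psum_cong) (simp add: B_def m_assoc)
      also have "\<dots> = inv (A n) \<otimes> psum (\<lambda>i. A i \<otimes> c \<otimes> v i) (Suc n)"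
        using Suc.prems(2,3) An c by (intro psum_lmult[symmetric]) auto
      also have "\<dots> = \<zero>"
        using Suc.prems(4)[OF c] An by simp
      finally show ?thesis .
    qed
    have "B i \<otimes> d = d \<otimes> B i" if i: "i < n" and d: "d \<in> carrier R" for i d
    proof -
      have "psum (\<lambda>i. (B i \<otimes> d \<ominus> d \<otimes> B i) \<otimes> c \<otimes> v i) n = \<zero>" if c: "c \<in> carrier R" for c
      proof -
        have "psum (\<lambda>i. B i \<otimes> (d \<otimes> c) \<otimes> v i) (Suc n) \<ominus> d \<otimes> psum (\<lambda>i. B i \<otimes> c \<otimes> v i) (Suc n) = \<zero>"
          using relB c d by (simp del: psum.simps add: a_minus_def)
        also have "d \<otimes> psum (\<lambda>i. B i \<otimes> c \<otimes> v i) (Suc n) = psum (\<lambda>i. d \<otimes> (B i \<otimes> c \<otimes> v i)) (Suc n)"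
          using Suc.prems(2) B c d by (intro psum_lmult) auto
        also have "psum (\<lambda>i. B i \<otimes> (d \<otimes> c) \<otimes> v i) (Suc n) \<ominus> \<dots>
          = psum (\<lambda>i. B i \<otimes> (d \<otimes> c) \<otimes> v i \<ominus> d \<otimes> (B i \<otimes> c \<otimes> v i)) (Suc n)"
          using Suc.prems(2) B c d by (intro psum_diff[symmetric]) auto
        also have "\<dots> = psum (\<lambda>i. (B i \<otimes> d \<ominus> d \<otimes> B i) \<otimes> c \<otimes> v i) (Suc n)"
          using Suc.prems(2) B c d
          by (intro psum_cong) (simp add: a_minus_def l_distr l_minus m_assoc)
        also have "\<dots> = psum (\<lambda>i. (B i \<otimes> d \<ominus> d \<otimes> B i) \<otimes> c \<otimes> v i) n"
          using Suc.prems(2) B c d by (simp add: Bn a_minus_def r_neg)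
        finally show ?thesis .
      qed
      then have "B i \<otimes> d \<ominus> d \<otimes> B i = \<zero>"
        using Suc.IH[OF indep, of "\<lambda>i. B i \<otimes> d \<ominus> d \<otimes> B i" i] Suc.prems(2) B d i by auto
      then show ?thesis
        using B d i by simp
    qed
    then have "B i \<in> ring_center R" if "i < Suc n" for i
      using that B Bn by (cases "i = n") (auto intro: ring_centerI)
    moreover have "psum (\<lambda>i. B i \<otimes> v i) (Suc n) = \<zero>"
    proof -
      have "psum (\<lambda>i. B i \<otimes> v i) (Suc n) = psum (\<lambda>i. B i \<otimes> \<one> \<otimes> v i) (Suc n)"
        using B by (intro psum_cong) simp
      then show ?thesis
        using relB by simp
    qed
    ultimately have "B n = \<zero>"
      using indepD[OF Suc.prems(1), of B n] by auto
    then show False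
      using Bn one_not_zero by simp
  qed
  show ?case
  proof (cases "i = n")
    case False
    have "psum (\<lambda>i. A i \<otimes> c \<otimes> v i) n = \<zero>" if "c \<in> carrier R" for c
      using Suc.prems(2,3) Suc.prems(4)[OF that] last that by simp
    then show ?thesis
      using Suc.IH[OF indep, of A i] Suc.prems False by auto
  qed (use last in simp)
qed auto

end

section \<open>The span of the powers of an element\<close>

context skew_field
begin

text \<open>When \<open>m\<close> is the degree of \<open>x\<close> over the center, this is
  \<open>F(x)\<close> written in the basis of the powers of \<open>x\<close> below
  \<open>m\<close>.\<close>

definition center_span :: "'a \<Rightarrow> nat \<Rightarrow> 'a set"
  where "center_span x m = {psum (\<lambda>i. c i \<otimes> x [^] i) m | c. \<forall>i<m. c i \<in> ring_center R}"

lemma center_spanI: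
  "(\<And>i. i < m \<Longrightarrow> c i \<in> ring_center R) \<Longrightarrow> psum (\<lambda>i. c i \<otimes> x [^] i) m \<in> center_span x m"
  unfolding center_span_def by blast

lemma center_spanE:
  assumes "y \<in> center_span x m"
  obtains c where "\<And>i. i < m \<Longrightarrow> c i \<in> ring_center R" "y = psum (\<lambda>i. c i \<otimes> x [^] i) m"
  using assms unfolding center_span_def by blast

text \<open>Stated for any \<open>A\<close> closed under sums and products, so that it serves for
  the carrier, for commutants, for generated subfields and for the field \<open>K\<close> in
  Wedderburn's theorem.\<close>

lemma center_span_subset:
  assumes "x \<in> A" "ring_center R \<subseteq> A" "\<And>a b. a \<in> A \<Longrightarrow> b \<in> A \<Longrightarrow> a \<oplus> b \<in> A"
    "\<And>a b. a \<in> A \<Longrightarrow> b \<in> A \<Longrightarrow> a \<otimes> b \<in> A"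
  shows "center_span x m \<subseteq> A"
proof
  have pow: "x [^] i \<in> A" for i :: nat
    using assms by (induction i) auto
  have "psum g n \<in> A" if "\<And>i. i < n \<Longrightarrow> g i \<in> A" for g and n :: nat
    using that
  proof (induction n)
    case 0
    then show ?case
      using assms(2) center_ring(1) by auto
  qed (use assms(3) in auto)
  then show "y \<in> A" if "y \<in> center_span x m" for y
    using that assms(2,4) pow by (elim center_spanE) (auto simp: subset_iff)
qed

lemma center_span_closed:
  assumes "x \<in> carrier R"
  shows "center_span x m \<subseteq> carrier R"
  by (intro center_span_subset ring_center_subset) (use assms in auto)

lemma center_span_commutant:
  assumes "x \<in> carrier R" "z \<in> carrier R" "z \<otimes> x = x \<otimes> z" "k \<in> center_span x m"
  shows "z \<otimes> k = k \<otimes> z"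
proof -
  have "center_span x m \<subseteq> commutant {z}"
    using assms(2,3) center_commutant[of _ "{z}"] commutant_add[of "{z}"] commutant_mult[of "{z}"]
    by (intro center_span_subset) (auto intro: commutantI assms(1))
  then show ?thesis
    using assms(4) commutant_comm[of k "{z}" z] by auto
qed

text \<open>Independence of the first \<open>m\<close> powers forces the top coefficient of a
  relation to be nonzero. Dividing by it, which stays in the center, gives the monic minimal
  polynomial.\<close>

lemma horner_relation:
  assumes x: "x \<in> carrier R"
    and indep: "indep m (\<lambda>i. x [^] i)" and dep: "\<not> indep (Suc m) (\<lambda>i. x [^] i)"
  obtains f where "\<And>i. i < m \<Longrightarrow> f i \<in> ring_center R" "horner f m x 0 = \<zero>"
proof -
  obtain c i where c: "\<And>i. i < Suc m \<Longrightarrow> c i \<in> ring_center R"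
      "psum (\<lambda>i. c i \<otimes> x [^] i) (Suc m) = \<zero>" and i: "i < Suc m" "c i \<noteq> \<zero>"
    using dep unfolding indep_def by blast
  have cc: "c i \<in> carrier R" if "i < Suc m" for i
    using c(1) that by simp
  have nz: "c m \<noteq> \<zero>"
  proof
    assume z: "c m = \<zero>"
    have "psum (\<lambda>i. c i \<otimes> x [^] i) m \<in> carrier R"
      using x cc by (intro psum_closed) auto
    then have "psum (\<lambda>i. c i \<otimes> x [^] i) m = \<zero>"
      using c(2) z x by simp
    then have "c i = \<zero>" if "i < m" for i
      using indepD[OF indep, of c i] c(1) that by auto
    then show False
      using i z by (cases "i = m") auto
  qed
  define f where "f = (\<lambda>i. inv (c m) \<otimes> c i)"
  have inv: "inv (c m) \<in> ring_center R" "inv (c m) \<in> carrier R"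
    using center_inv[of "c m"] c(1) nz by auto
  then have f: "f i \<in> ring_center R" if "i < m" for i
    using c(1) that by (auto simp: f_def)
  have "psum (\<lambda>i. f i \<otimes> x [^] i) m = psum (\<lambda>i. inv (c m) \<otimes> (c i \<otimes> x [^] i)) m"
    using cc inv x by (intro psum_cong) (simp add: f_def m_assoc)
  also have "\<dots> = inv (c m) \<otimes> psum (\<lambda>i. c i \<otimes> x [^] i) m"
    using cc inv x by (intro psum_lmult[symmetric]) auto
  finally have "horner f m x 0 = inv (c m) \<otimes> psum (\<lambda>i. c i \<otimes> x [^] i) m \<oplus> inv (c m) \<otimes> (c m \<otimes> x [^] m)"
    using cc[of m] x nz by (simp add: horner_def)
  also have "\<dots> = inv (c m) \<otimes> psum (\<lambda>i. c i \<otimes> x [^] i) (Suc m)"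
    using cc inv x by (simp add: r_distr)
  finally have "horner f m x 0 = \<zero>"
    using c(2) inv by simp
  then show thesis
    using that f by blast
qed

text \<open>For \<open>k > 0\<close> this is a monic polynomial in \<open>x\<close> of degree
  \<open>m - k < m\<close>, so its vanishing would contradict independence of the first
  \<open>m\<close> powers.\<close>

lemma horner_nonzero:
  assumes x: "x \<in> carrier R" and indep: "indep m (\<lambda>i. x [^] i)"
    and f: "\<And>i. i < m \<Longrightarrow> f i \<in> ring_center R" and k: "0 < k" "k \<le> m"
  shows "horner f m x k \<noteq> \<zero>"
proof
  assume z: "horner f m x k = \<zero>"
  define c where "c = (\<lambda>i. if i < m - k then f (k + i) else \<one>)"
  have "psum (\<lambda>i. c i \<otimes> x [^] i) (m - k) = psum (\<lambda>i. f (k + i) \<otimes> x [^] i) (m - k)"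
    by (intro psum_cong) (auto simp: c_def)
  then have "psum (\<lambda>i. c i \<otimes> x [^] i) (Suc (m - k)) = horner f m x k"
    using x by (simp add: horner_def c_def)
  moreover have "indep (Suc (m - k)) (\<lambda>i. x [^] i)"
    using x k by (intro indep_mono[OF indep]) auto
  moreover have "c i \<in> ring_center R" for i
    using f by (auto simp: c_def)
  ultimately have "c (m - k) = \<zero>"
    using z indepD[of "Suc (m - k)" "\<lambda>i. x [^] i" c "m - k"] by auto
  then show False
    using one_not_zero by (simp add: c_def)
qed

text \<open>In \<open>f 0 + x h = 0\<close> the cofactor \<open>h\<close> is nonzero by minimality,
  hence so is \<open>f 0\<close>, and the inverse of \<open>x\<close> is
  \<open>- inv (f 0) h\<close>, a polynomial in \<open>x\<close>.\<close>

lemma inv_mem_of_relation: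
  assumes x: "x \<in> carrier R" "x \<noteq> \<zero>" and indep: "indep m (\<lambda>i. x [^] i)"
    and f: "\<And>i. i < m \<Longrightarrow> f i \<in> ring_center R" "horner f m x 0 = \<zero>"
    and A: "x \<in> A" "ring_center R \<subseteq> A" "\<And>a b. a \<in> A \<Longrightarrow> b \<in> A \<Longrightarrow> a \<oplus> b \<in> A"
      "\<And>a b. a \<in> A \<Longrightarrow> b \<in> A \<Longrightarrow> a \<otimes> b \<in> A"
  shows "inv x \<in> A"
proof -
  have m: "0 < m"
    using f(2) one_not_zero by (cases m) (auto simp: horner_def)
  define h where "h = horner f m x (Suc 0)"
  have h: "h \<in> carrier R" "h \<noteq> \<zero>"
    unfolding h_def using x f m horner_closed[where f=f and m=m and x=x and k="Suc 0"] horner_nonzero[OF x(1) indep f(1), where k="Suc 0"]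
    by auto
  have f0: "f 0 \<in> ring_center R" "f 0 \<in> carrier R"
    using f m by auto
  have rel: "f 0 \<oplus> x \<otimes> h = \<zero>"
    using horner_step[where f=f and m=m and x=x and k=0] f x m by (simp add: h_def)
  then have f0nz: "f 0 \<noteq> \<zero>"
    using x h by (auto simp: mult_eq_zero)
  have xh: "x \<otimes> h = \<ominus> f 0"
    using rel f0 x h by (metis m_closed minus_equality minus_minus a_comm)
  have "inv x = \<ominus> (inv (f 0)) \<otimes> h"
  proof (rule mult_left_cancel[of x])
    have "x \<otimes> (\<ominus> (inv (f 0)) \<otimes> h) = \<ominus> (inv (f 0)) \<otimes> (x \<otimes> h)"
      using center_lcomm[of "\<ominus> (inv (f 0))" x h] center_inv[of "f 0"] f0 f0nz x h by simp
    also have "\<dots> = \<one>"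
      unfolding xh using f0 f0nz by (simp add: l_minus r_minus)
    finally show "x \<otimes> inv x = x \<otimes> (\<ominus> (inv (f 0)) \<otimes> h)"
      using x by simp
  qed (use x h f0 f0nz in auto)
  moreover have "\<ominus> (inv (f 0)) \<in> A"
    using center_inv[of "f 0"] f0 f0nz A(2) by (auto simp: subset_iff)
  moreover have "h \<in> A"
  proof -
    have "x [^] i \<in> A" for i :: nat
      using A by (induction i) auto
    moreover have "psum (\<lambda>i. f (Suc 0 + i) \<otimes> x [^] i) (m - Suc 0) \<in> center_span x (m - Suc 0)"
      using f(1) by (intro center_spanI) auto
    ultimately show ?thesis
      unfolding h_def horner_def using center_span_subset[OF A, of "m - Suc 0"] A(3) by blast
  qed
  ultimately show ?thesis
    using A(4) by simp
qed

context
  fixes f :: "nat \<Rightarrow> 'a" and m :: nat and x :: 'a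
  assumes x: "x \<in> carrier R" and indep: "indep m (\<lambda>i. x [^] i)"
    and f: "\<And>i. i < m \<Longrightarrow> f i \<in> ring_center R" and root: "horner f m x 0 = \<zero>"
begin

lemma relation_degree_pos: "0 < m"
  using root one_not_zero by (cases m) (auto simp: horner_def)

lemma center_span_add:
  assumes "k \<in> center_span x m" "l \<in> center_span x m"
  shows "k \<oplus> l \<in> center_span x m"
proof -
  obtain c where c: "\<And>i. i < m \<Longrightarrow> c i \<in> ring_center R" "k = psum (\<lambda>i. c i \<otimes> x [^] i) m"
    using assms(1) by (rule center_spanE) blast
  obtain d where d: "\<And>i. i < m \<Longrightarrow> d i \<in> ring_center R" "l = psum (\<lambda>i. d i \<otimes> x [^] i) m"
    using assms(2) by (rule center_spanE) blast
  have "k \<oplus> l = psum (\<lambda>i. (c i \<oplus> d i) \<otimes> x [^] i) m"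
    unfolding c(2) d(2) using c(1) d(1) x
    by (subst psum_add[symmetric]) (auto intro!: psum_cong simp: l_distr)
  then show ?thesis
    using center_spanI[of m "\<lambda>i. c i \<oplus> d i"] c(1) d(1) by simp
qed

lemma center_span_scale:
  assumes "z \<in> ring_center R" "k \<in> center_span x m"
  shows "z \<otimes> k \<in> center_span x m"
proof -
  obtain c where c: "\<And>i. i < m \<Longrightarrow> c i \<in> ring_center R" "k = psum (\<lambda>i. c i \<otimes> x [^] i) m"
    using assms(2) by (rule center_spanE) blast
  have "z \<otimes> k = psum (\<lambda>i. (z \<otimes> c i) \<otimes> x [^] i) m"
    unfolding c(2) using c(1) assms x
    by (subst psum_lmult) (auto intro!: psum_cong simp: m_assoc)
  then show ?thesis
    using center_spanI[of m "\<lambda>i. z \<otimes> c i"] c(1) assms by simp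
qed

lemma center_span_zero: "\<zero> \<in> center_span x m"
  using center_spanI[of m "\<lambda>i. \<zero>" x] x by (simp add: psum_zero)

lemma center_span_one: "\<one> \<in> center_span x m"
proof -
  have "psum (\<lambda>i. (if i = 0 then \<one> else \<zero>) \<otimes> x [^] i) m = \<one>"
    using relation_degree_pos x by (subst psum_single[of 0]) auto
  then show ?thesis
    using center_spanI[of m "\<lambda>i. if i = 0 then \<one> else \<zero>" x] by simp
qed

lemma center_span_psum:
  "(\<And>i. i < n \<Longrightarrow> g i \<in> center_span x m) \<Longrightarrow> psum g n \<in> center_span x m"
  by (induction n) (auto intro: center_span_zero center_span_add)

text \<open>Shifting the coefficients may produce a term with \<open>x [^] m\<close>, which the
  relation rewrites in lower powers. Closure under arbitrary products follows from this
  case.\<close>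

lemma center_span_shift:
  assumes "k \<in> center_span x m"
  shows "x \<otimes> k \<in> center_span x m"
proof -
  obtain c where c: "\<And>i. i < m \<Longrightarrow> c i \<in> ring_center R" "k = psum (\<lambda>i. c i \<otimes> x [^] i) m"
    using assms(1) by (rule center_spanE) blast
  define d where "d = (\<lambda>i. case i of 0 \<Rightarrow> \<zero> | Suc j \<Rightarrow> c j)"
  have d: "d i \<in> ring_center R" if "i < Suc m" for i
    using that c(1) by (cases i) (auto simp: d_def)
  have "x \<otimes> k = psum (\<lambda>i. d (Suc i) \<otimes> x [^] Suc i) m"
    unfolding c(2)
  proof (subst psum_lmult; (intro psum_cong)?)
    fix i assume i: "i < m"
    have "x \<otimes> (c i \<otimes> x [^] i) = c i \<otimes> (x \<otimes> x [^] i)"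
      using center_lcomm[of "c i" x "x [^] i"] c(1)[OF i] x by simp
    then show "x \<otimes> (c i \<otimes> x [^] i) = d (Suc i) \<otimes> x [^] Suc i"
      using x by (simp add: d_def nat_pow_comm[of x 1 i, simplified])
  qed (use x c(1) in auto)
  also have "\<dots> = psum (\<lambda>i. d i \<otimes> x [^] i) (Suc m)"
  proof -
    have "psum (\<lambda>i. d (Suc i) \<otimes> x [^] Suc i) m \<in> carrier R"
      using d x by (intro psum_closed) auto
    then show ?thesis
      using d x by (subst psum_shift) (auto simp: d_def)
  qed
  also have "\<dots> = psum (\<lambda>i. d i \<otimes> x [^] i) m \<oplus> (\<ominus> d m) \<otimes> psum (\<lambda>i. f i \<otimes> x [^] i) m"
  proof -
    have P: "psum (\<lambda>i. f i \<otimes> x [^] i) m \<in> carrier R"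
      using f x by (intro psum_closed) auto
    have "psum (\<lambda>i. f i \<otimes> x [^] i) m \<oplus> x [^] m = \<zero>"
      using root by (simp add: horner_def)
    then have "x [^] m = \<ominus> psum (\<lambda>i. f i \<otimes> x [^] i) m"
      using x P by (metis a_comm minus_equality minus_minus nat_pow_closed)
    then show ?thesis
      using d[of m] P by (simp add: l_minus r_minus)
  qed
  also have "\<dots> \<in> center_span x m"
    using d f by (intro center_span_add center_span_scale center_spanI) auto
  finally show ?thesis .
qed

lemma center_span_pow_mult:
  "k \<in> center_span x m \<Longrightarrow> x [^] (i::nat) \<otimes> k \<in> center_span x m"
proof (induction i arbitrary: k)
  case 0
  then show ?case
    using center_span_closed[OF x, of m] by (auto simp: subset_iff)
next
  case (Suc i)
  then have "x [^] i \<otimes> (x \<otimes> k) \<in> center_span x m"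
    by (simp add: center_span_shift)
  moreover have "k \<in> carrier R"
    using Suc.prems center_span_closed[OF x] by auto
  ultimately show ?case
    using x by (simp add: m_assoc)
qed

lemma center_span_mult:
  assumes "k \<in> center_span x m" "l \<in> center_span x m"
  shows "k \<otimes> l \<in> center_span x m"
proof -
  obtain c where c: "\<And>i. i < m \<Longrightarrow> c i \<in> ring_center R" "k = psum (\<lambda>i. c i \<otimes> x [^] i) m"
    using assms(1) by (rule center_spanE) blast
  have l: "l \<in> carrier R"
    using assms(2) center_span_closed[OF x] by auto
  have "k \<otimes> l = psum (\<lambda>i. c i \<otimes> (x [^] i \<otimes> l)) m"
    unfolding c(2) using c(1) x l by (subst psum_rmult) (auto intro!: psum_cong simp: m_assoc)
  also have "\<dots> \<in> center_span x m"
    using c(1) assms(2) by (intro center_span_psum center_span_scale center_span_pow_mult)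
  finally show ?thesis .
qed

lemma center_subset_center_span: "ring_center R \<subseteq> center_span x m"
proof
  show "z \<in> center_span x m" if "z \<in> ring_center R" for z
    using center_span_scale[OF that center_span_one] that by simp
qed

lemma center_span_pow: "x [^] (i::nat) \<in> center_span x m"
  using center_span_pow_mult[OF center_span_one] x by simp

lemma center_span_self: "x \<in> center_span x m"
  using center_span_pow[of 1] x by simp

text \<open>The bicommutant argument: if \<open>z\<close> were not in the span then the powers of \<open>x\<close> and their
  products with \<open>z\<close> would be independent, so \<open>z\<close> could not commute with all the values of
  \<open>twist\<close>.\<close>

lemma bicommutant_if_inv_closed:
  assumes inv: "\<And>k. k \<in> center_span x m \<Longrightarrow> k \<noteq> \<zero> \<Longrightarrow> inv k \<in> center_span x m"
    and z: "z \<in> carrier R"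
    and twist: "\<And>c. c \<in> carrier R \<Longrightarrow> z \<otimes> twist f m x x c = twist f m x x c \<otimes> z"
  shows "z \<in> center_span x m"
proof (rule ccontr)
  assume notin: "z \<notin> center_span x m"
  \<comment> \<open>The vectors are the \<open>x^j\<close> followed by the \<open>x^j z\<close>. The
    coefficients \<open>A\<close> are chosen so that the sum of \<open>A j c v j\<close> is
    \<open>z Q(c) - Q(c) z\<close>, where \<open>Q\<close> is \<open>twist f m x x\<close>.\<close>
  define v where "v = (\<lambda>j. if j < m then x [^] j else x [^] (j - m) \<otimes> z)"
  define A where "A = (\<lambda>j. if j < m then z \<otimes> horner f m x (Suc j) else \<ominus> horner f m x (Suc (j - m)))"
  have v: "v j \<in> carrier R" for j
    using x z by (auto simp: v_def)
  have h: "horner f m x j \<in> carrier R" for j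
    using x f by (rule horner_closed[rotated])
  have A: "A j \<in> carrier R" for j
    using z h by (auto simp: A_def)
  have "indep (m + m) v"
  proof (rule indepI)
    fix c i
    assume c: "\<And>i. i < m + m \<Longrightarrow> c i \<in> ring_center R" "psum (\<lambda>i. c i \<otimes> v i) (m + m) = \<zero>"
      and i: "i < m + m"
    define k where "k = psum (\<lambda>i. c i \<otimes> x [^] i) m"
    define l where "l = psum (\<lambda>i. c (m + i) \<otimes> x [^] i) m"
    have kl: "k \<in> center_span x m" "l \<in> center_span x m"
      unfolding k_def l_def using c(1) by (auto intro!: center_spanI)
    then have klc: "k \<in> carrier R" "l \<in> carrier R"
      using center_span_closed[OF x] by auto
    have "psum (\<lambda>i. c i \<otimes> v i) m = k"
      unfolding k_def by (intro psum_cong) (simp add: v_def)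
    moreover have "psum (\<lambda>i. c (m + i) \<otimes> v (m + i)) m = l \<otimes> z"
      unfolding l_def using c(1) x z
      by (subst psum_rmult) (auto intro!: psum_cong simp: v_def m_assoc)
    ultimately have kz: "k \<oplus> l \<otimes> z = \<zero>"
      using c v by (subst (asm) psum_split) auto
    \<comment> \<open>Otherwise \<open>z = - inv l k\<close>. This is where inverses in the span
      enter.\<close>
    have "l = \<zero>"
    proof (rule ccontr)
      assume nz: "l \<noteq> \<zero>"
      have "l \<otimes> z = \<ominus> k"
        using kz klc z by (metis a_comm m_closed minus_equality)
      also have "\<dots> = \<ominus> \<one> \<otimes> k"
        using klc by (simp add: l_minus)
      finally have "inv l \<otimes> (l \<otimes> z) = inv l \<otimes> (\<ominus> \<one> \<otimes> k)"
        by simp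
      then have "z = inv l \<otimes> (\<ominus> \<one> \<otimes> k)"
        using klc nz z by simp
      also have "\<dots> \<in> center_span x m"
        using kl nz by (intro center_span_mult inv center_span_scale) auto
      finally show False
        using notin by simp
    qed
    moreover from this have "k = \<zero>"
      using kz klc z by simp
    ultimately have "c i = \<zero>" if "i < m" for i
      using indepD[OF indep, of c i] c(1) that by (auto simp: k_def)
    moreover have "c (m + i) = \<zero>" if "i < m" for i
      using \<open>l = \<zero>\<close> indepD[OF indep, of "\<lambda>i. c (m + i)" i] c(1) that by (auto simp: l_def)
    ultimately show "c i = \<zero>"
      using i by (cases "i < m") (auto dest: le_Suc_ex simp: not_less)
  qed
  moreover have "psum (\<lambda>j. A j \<otimes> c \<otimes> v j) (m + m) = \<zero>" if c: "c \<in> carrier R" for c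
  proof -
    have t: "twist f m x x c \<in> carrier R"
      using x c f by (intro twist_closed) auto
    have "psum (\<lambda>j. A j \<otimes> c \<otimes> v j) m = z \<otimes> twist f m x x c"
      unfolding twist_def using h x z c
      by (subst psum_lmult) (auto intro!: psum_cong simp: A_def v_def m_assoc)
    moreover have "psum (\<lambda>j. A (m + j) \<otimes> c \<otimes> v (m + j)) m = \<ominus> (twist f m x x c \<otimes> z)"
    proof -
      have "psum (\<lambda>j. A (m + j) \<otimes> c \<otimes> v (m + j)) m
        = psum (\<lambda>j. \<ominus> (horner f m x (Suc j) \<otimes> c \<otimes> x [^] j \<otimes> z)) m"
        using h x z c by (intro psum_cong) (simp add: A_def v_def m_assoc l_minus)
      also have "\<dots> = \<ominus> psum (\<lambda>j. horner f m x (Suc j) \<otimes> c \<otimes> x [^] j \<otimes> z) m"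
        using h x z c by (intro psum_neg) auto
      also have "psum (\<lambda>j. horner f m x (Suc j) \<otimes> c \<otimes> x [^] j \<otimes> z) m = twist f m x x c \<otimes> z"
        unfolding twist_def using h x z c by (intro psum_rmult[symmetric]) auto
      finally show ?thesis .
    qed
    ultimately show ?thesis
      using A v c t z twist[OF c] by (subst psum_split) (auto simp: r_neg)
  qed
  \<comment> \<open>The last index is chosen because its coefficient is
    \<open>\<ominus> horner f m x m\<close>, that is \<open>\<ominus> \<one>\<close>.\<close>
  ultimately have "A (m + (m - 1)) = \<zero>"
    using relation_degree_pos v A by (intro indep_coeffs_zero[of "m + m" v A]) auto
  moreover have "m + (m - 1) - m = m - 1" "Suc (m - 1) = m" "\<not> m + (m - 1) < m"
    using relation_degree_pos by auto
  ultimately have "\<ominus> horner f m x m = \<zero>"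
    unfolding A_def by simp
  then show False
    using one_not_zero horner_top[where f=f and m=m and x=x] f by (metis minus_minus minus_zero one_closed)
qed

end

end

section \<open>Finite dimension over the center: bases, degrees and inverses\<close>

context centrally_finite_skew_field
begin

lemma combine_eq_psum:
  assumes "length Ks = length Us" "set Ks \<subseteq> carrier R" "set Us \<subseteq> carrier R"
  shows "combine Ks Us = psum (\<lambda>i. Ks ! i \<otimes> Us ! i) (length Us)"
  using assms
proof (induction Ks Us rule: list_induct2)
  case (Cons k Ks u Us)
  then have "psum (\<lambda>i. (k # Ks) ! i \<otimes> (u # Us) ! i) (length (u # Us))
      = k \<otimes> u \<oplus> psum (\<lambda>i. Ks ! i \<otimes> Us ! i) (length Us)"
    by (simp only: list.size add_0_right One_nat_def add_Suc_right psum_shift)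
      (subst psum_shift, auto simp: subset_iff nth_Cons split: nat.split)
  then show ?case
    using Cons by simp
qed simp

text \<open>The bridge to the dimension theory for lists of vectors, which provides the bound on
  independent families and the basis below.\<close>

lemma independent_map_iff:
  assumes "\<And>i. i < n \<Longrightarrow> v i \<in> carrier R"
  shows "independent (ring_center R) (map v [0..<n]) \<longleftrightarrow> indep n v"
proof
  let ?Us = "map v [0..<n]"
  have Us: "set ?Us \<subseteq> carrier R"
    using assms by auto
  have comb: "combine Ks ?Us = psum (\<lambda>i. Ks ! i \<otimes> v i) n"
    if "length Ks = n" "set Ks \<subseteq> ring_center R" for Ks
  proof -
    have "combine Ks ?Us = psum (\<lambda>i. Ks ! i \<otimes> ?Us ! i) (length ?Us)"
      using that Us ring_center_subset by (intro combine_eq_psum) auto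
    then show ?thesis
      by (auto intro: psum_cong)
  qed
  show "indep n v" if ind: "independent (ring_center R) ?Us"
  proof (rule indepI)
    fix c i
    assume c: "\<And>i. i < n \<Longrightarrow> c i \<in> ring_center R" "psum (\<lambda>i. c i \<otimes> v i) n = \<zero>" and i: "i < n"
    have "combine (map c [0..<n]) ?Us = psum (\<lambda>i. c i \<otimes> v i) n"
      using c(1) by (subst comb) (auto intro: psum_cong)
    then have "set (take (length ?Us) (map c [0..<n])) \<subseteq> {\<zero>}"
      using c by (intro independent_imp_trivial_combine[OF center_subfield ind]) auto
    then show "c i = \<zero>"
      using i by (auto simp: image_subset_iff)
  qed
  show "independent (ring_center R) ?Us" if ind: "indep n v"
  proof (rule trivial_combine_imp_independent[OF center_subfield Us])
    fix Ks assume Ks: "set Ks \<subseteq> ring_center R" "combine Ks ?Us = \<zero>"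
    \<comment> \<open>\<open>combine\<close> stops at the end of the shorter list, so
      \<open>Ks\<close> may have any length. Padding with zeros and truncating gives length
      \<open>n\<close> without changing the value.\<close>
    define Ls where "Ls = take n (Ks @ replicate n \<zero>)"
    have Ls: "length Ls = n" "set Ls \<subseteq> ring_center R"
      using Ks(1) by (auto simp: Ls_def dest!: in_set_takeD)
    have "combine Ls ?Us = combine (Ks @ replicate n \<zero>) ?Us"
      using combine_take[of ?Us "Ks @ replicate n \<zero>"] by (simp add: Ls_def)
    then have "combine Ls ?Us = \<zero>"
      using combine_append_replicate[OF Us, of Ks n] Ks(2) by simp
    then have "psum (\<lambda>i. Ls ! i \<otimes> v i) n = \<zero>"
      using comb[OF Ls] by simp
    then have "Ls ! i = \<zero>" if "i < n" for i
      using indepD[OF ind, of "(!) Ls" i] Ls that by (auto simp: subset_iff)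
    then have "set Ls \<subseteq> {\<zero>}"
      using Ls(1) by (auto simp: in_set_conv_nth)
    then show "set (take (length ?Us) Ks) \<subseteq> {\<zero>}"
      by (auto simp: Ls_def)
  qed
qed

lemma indep_bounded:
  obtains n where "\<And>k v. (\<And>i. i < k \<Longrightarrow> v i \<in> carrier R) \<Longrightarrow> indep k v \<Longrightarrow> k \<le> n"
proof -
  obtain n where n: "dimension n (ring_center R) (carrier R)"
    using finite_over_center by (rule finite_dimensionE')
  have "k \<le> n" if "\<And>i. i < k \<Longrightarrow> v i \<in> carrier R" "indep k v" for k v
    using independent_length_le_dimension[OF center_subfield n, of "map v [0..<k]"]
      independent_map_iff[of k v] that by (auto simp: image_subset_iff)
  then show thesis
    using that by blast
qed

lemma center_basis:
  obtains n u where "\<And>i. i < n \<Longrightarrow> u i \<in> carrier R" "indep n u"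
    "\<And>d. d \<in> carrier R \<Longrightarrow> \<exists>c. (\<forall>i<n. c i \<in> ring_center R) \<and> d = psum (\<lambda>i. c i \<otimes> u i) n"
proof -
  obtain n where n: "dimension n (ring_center R) (carrier R)"
    using finite_over_center by (rule finite_dimensionE')
  obtain Us where Us: "set Us \<subseteq> carrier R" "independent (ring_center R) Us" "length Us = n"
      "Span (ring_center R) Us = carrier R"
    using exists_base[OF center_subfield n] by blast
  show thesis
  proof (rule that[of n "(!) Us"])
    show c: "Us ! i \<in> carrier R" if "i < n" for i
      using that Us by auto
    have "map ((!) Us) [0..<n] = Us"
      using Us(3) by (metis map_nth)
    then show "indep n ((!) Us)"
      using independent_map_iff[of n "(!) Us"] c Us(2) by simp
    fix d assume "d \<in> carrier R"
    then obtain Ks where Ks: "set Ks \<subseteq> ring_center R" "length Ks = length Us" "d = combine Ks Us"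
      using Us(1,4) Span_mem_iff_length_version[OF center_subfield Us(1), of d] by auto
    then have "d = psum (\<lambda>i. Ks ! i \<otimes> Us ! i) n"
      using combine_eq_psum[of Ks Us] Us ring_center_subset by auto
    then show "\<exists>c. (\<forall>i<n. c i \<in> ring_center R) \<and> d = psum (\<lambda>i. c i \<otimes> Us ! i) n"
      using Ks Us(3) by (intro exI[of _ "(!) Ks"]) (auto simp: subset_iff)
  qed
qed

text \<open>Finite dimension bounds the number of independent powers. The largest such number is the
  degree, and one more power gives the minimal polynomial.\<close>

lemma relation_exists:
  assumes "x \<in> carrier R"
  obtains f m where "indep m (\<lambda>i. x [^] i)" "\<And>i. i < m \<Longrightarrow> f i \<in> ring_center R"
    "horner f m x 0 = \<zero>"
proof -
  obtain n where n: "\<And>k v. (\<And>i. i < k \<Longrightarrow> v i \<in> carrier R) \<Longrightarrow> indep k v \<Longrightarrow> k \<le> n"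
    using indep_bounded by blast
  define P where "P = (\<lambda>k. indep k (\<lambda>i. x [^] i))"
  have "P 0"
    by (simp add: P_def indep_def)
  moreover have "k \<le> n" if "P k" for k
    using that assms n[of k "\<lambda>i. x [^] i"] by (simp add: P_def)
  ultimately have "P (Greatest P)" "\<not> P (Suc (Greatest P))"
    using GreatestI_nat[of P 0 n] Greatest_le_nat[of P "Suc (Greatest P)" n] by auto
  then show thesis
    using horner_relation[OF assms, of "Greatest P"] that unfolding P_def by metis
qed

lemma inv_mem_subalgebra:
  assumes "x \<in> carrier R" "x \<noteq> \<zero>" "x \<in> A" "ring_center R \<subseteq> A"
    and "\<And>a b. a \<in> A \<Longrightarrow> b \<in> A \<Longrightarrow> a \<oplus> b \<in> A" "\<And>a b. a \<in> A \<Longrightarrow> b \<in> A \<Longrightarrow> a \<otimes> b \<in> A"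
  shows "inv x \<in> A"
proof -
  obtain f m where *: "indep m (\<lambda>i. x [^] i)" "\<And>i. i < m \<Longrightarrow> f i \<in> ring_center R"
      "horner f m x 0 = \<zero>"
    using relation_exists[OF assms(1)] by blast
  show ?thesis
    by (rule inv_mem_of_relation[OF assms(1,2) *(1)]) (use * assms in auto)
qed

lemma bicommutant_mem_center_span:
  assumes x: "x \<in> carrier R" and indep: "indep m (\<lambda>i. x [^] i)"
    and f: "\<And>i. i < m \<Longrightarrow> f i \<in> ring_center R" and root: "horner f m x 0 = \<zero>"
    and z: "z \<in> carrier R"
    and twist: "\<And>c. c \<in> carrier R \<Longrightarrow> z \<otimes> twist f m x x c = twist f m x x c \<otimes> z"
  shows "z \<in> center_span x m"
proof (rule bicommutant_if_inv_closed[OF x indep f root _ z twist])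
  note rel = x indep f root
  fix k assume k: "k \<in> center_span x m" "k \<noteq> \<zero>"
  then show "inv k \<in> center_span x m"
    using center_span_closed[OF x] center_subset_center_span[OF rel]
      center_span_add[OF rel] center_span_mult[OF rel]
    by (intro inv_mem_subalgebra) auto
qed auto

end

section \<open>Polynomial functions\<close>

context ring
begin

text \<open>Polynomial functions in Horner form on a commutative set \<open>S\<close>, of degree at most \<open>n\<close>. The
  coefficients may be noncommuting but have to commute with \<open>S\<close>.\<close>

primrec polyfun :: "'a set \<Rightarrow> nat \<Rightarrow> ('a \<Rightarrow> 'a) \<Rightarrow> bool"
  where
    "polyfun S 0 p \<longleftrightarrow> (\<exists>c \<in> commutant S. \<forall>t \<in> S. p t = c)"
  | "polyfun S (Suc n) p \<longleftrightarrow>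
      (\<exists>c \<in> commutant S. \<exists>q. polyfun S n q \<and> (\<forall>t \<in> S. p t = c \<oplus> t \<otimes> q t))"

definition poly_on :: "'a set \<Rightarrow> ('a \<Rightarrow> 'a) \<Rightarrow> bool"
  where "poly_on S p \<longleftrightarrow> (\<exists>n. polyfun S n p)"

lemma polyfun_cong: "polyfun S n p \<Longrightarrow> (\<And>t. t \<in> S \<Longrightarrow> q t = p t) \<Longrightarrow> polyfun S n q"
  by (cases n) auto

context
  fixes S :: "'a set"
  assumes S: "S \<subseteq> carrier R" and comm: "S \<subseteq> commutant S"
begin

lemma polyfun_value: "polyfun S n p \<Longrightarrow> t \<in> S \<Longrightarrow> p t \<in> commutant S"
proof (induction n arbitrary: p)
  case (Suc n)
  then obtain c q where "c \<in> commutant S" "polyfun S n q" "p t = c \<oplus> t \<otimes> q t"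
    by auto
  then show ?case
    using Suc comm by (auto intro!: commutant_add[OF S] commutant_mult[OF S])
qed auto

lemma polyfun_closed: "polyfun S n p \<Longrightarrow> t \<in> S \<Longrightarrow> p t \<in> carrier R"
  by (rule commutant_closed[OF polyfun_value])

lemma polyfun_const: "c \<in> commutant S \<Longrightarrow> polyfun S n (\<lambda>_. c)"
proof (induction n arbitrary: c)
  case (Suc n)
  have "c = c \<oplus> t \<otimes> \<zero>" if "t \<in> S" for t
    using that S commutant_closed[OF Suc.prems] by auto
  then show ?case
    using Suc.IH[OF commutant_zero[OF S]] Suc.prems by auto
qed auto

lemma polyfun_add:
  "polyfun S n p \<Longrightarrow> polyfun S n q \<Longrightarrow> polyfun S n (\<lambda>t. p t \<oplus> q t)"
proof (induction n arbitrary: p q)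
  case 0
  then show ?case
    using commutant_add[OF S] by auto
next
  case (Suc n)
  then obtain c p' d q' where p: "c \<in> commutant S" "polyfun S n p'" "\<And>t. t \<in> S \<Longrightarrow> p t = c \<oplus> t \<otimes> p' t"
    and q: "d \<in> commutant S" "polyfun S n q'" "\<And>t. t \<in> S \<Longrightarrow> q t = d \<oplus> t \<otimes> q' t"
    by auto
  have "p t \<oplus> q t = (c \<oplus> d) \<oplus> t \<otimes> (p' t \<oplus> q' t)" if t: "t \<in> S" for t
  proof -
    have "c \<in> carrier R" "d \<in> carrier R" "t \<in> carrier R" "p' t \<in> carrier R" "q' t \<in> carrier R"
      using commutant_closed[OF p(1)] commutant_closed[OF q(1)] polyfun_closed[OF p(2) t]
        polyfun_closed[OF q(2) t] S t by auto
    then show ?thesis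
      unfolding p(3)[OF t] q(3)[OF t] by algebra
  qed
  then show ?case
    using Suc.IH[OF p(2) q(2)] commutant_add[OF S p(1) q(1)] by auto
qed

lemma polyfun_smult: "c \<in> commutant S \<Longrightarrow> polyfun S n p \<Longrightarrow> polyfun S n (\<lambda>t. c \<otimes> p t)"
proof (induction n arbitrary: p)
  case 0
  then show ?case
    using commutant_mult[OF S] by auto
next
  case (Suc n)
  then obtain d q where q: "d \<in> commutant S" "polyfun S n q" "\<And>t. t \<in> S \<Longrightarrow> p t = d \<oplus> t \<otimes> q t"
    by auto
  have "c \<otimes> p t = c \<otimes> d \<oplus> t \<otimes> (c \<otimes> q t)" if t: "t \<in> S" for t
  proof -
    have cl: "c \<in> carrier R" "d \<in> carrier R" "t \<in> carrier R" "q t \<in> carrier R"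
      using commutant_closed[OF q(1)] commutant_closed[OF Suc.prems(1)] polyfun_closed[OF q(2) t] S t
      by auto
    have "c \<otimes> (t \<otimes> q t) = t \<otimes> (c \<otimes> q t)"
      using commutant_comm[OF Suc.prems(1) t] cl by (simp add: m_assoc[symmetric])
    then show ?thesis
      unfolding q(3)[OF t] using cl by (simp add: r_distr)
  qed
  then show ?case
    using Suc.IH[OF Suc.prems(1) q(2)] commutant_mult[OF S Suc.prems(1) q(1)] by auto
qed

lemma polyfun_Suc: "polyfun S n p \<Longrightarrow> polyfun S (Suc n) p"
proof (induction n arbitrary: p)
  case 0
  then obtain c where c: "c \<in> commutant S" "\<And>t. t \<in> S \<Longrightarrow> p t = c"
    by auto
  then show ?case
    using polyfun_cong[OF polyfun_const[OF c(1), of "Suc 0"]] by auto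
next
  case (Suc n)
  then obtain d q where q: "d \<in> commutant S" "polyfun S n q" "\<And>t. t \<in> S \<Longrightarrow> p t = d \<oplus> t \<otimes> q t"
    by auto
  then show ?case
    using Suc.IH[OF q(2)] by (subst polyfun.simps(2)) blast
qed

lemma polyfun_mono: "polyfun S n p \<Longrightarrow> n \<le> k \<Longrightarrow> polyfun S k p"
  by (induction k) (auto simp: le_Suc_eq simp del: polyfun.simps intro: polyfun_Suc)

lemma polyfun_shift: "polyfun S n p \<Longrightarrow> polyfun S (Suc n) (\<lambda>t. t \<otimes> p t)"
proof -
  assume p: "polyfun S n p"
  have "t \<otimes> p t = \<zero> \<oplus> t \<otimes> p t" if "t \<in> S" for t
    using polyfun_closed[OF p that] that S by auto
  then show ?thesis
    using p commutant_zero[OF S] by auto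
qed

lemma polyfun_mult:
  "polyfun S n p \<Longrightarrow> polyfun S k q \<Longrightarrow> polyfun S (n + k) (\<lambda>t. p t \<otimes> q t)"
proof (induction n arbitrary: p)
  case 0
  then obtain c where c: "c \<in> commutant S" "\<And>t. t \<in> S \<Longrightarrow> p t = c"
    by auto
  then show ?case
    using polyfun_cong[OF polyfun_smult[OF c(1) 0(2)]] by auto
next
  case (Suc n)
  then obtain d r where r: "d \<in> commutant S" "polyfun S n r" "\<And>t. t \<in> S \<Longrightarrow> p t = d \<oplus> t \<otimes> r t"
    by auto
  have eq: "p t \<otimes> q t = d \<otimes> q t \<oplus> t \<otimes> (r t \<otimes> q t)" if t: "t \<in> S" for t
  proof -
    have "d \<in> carrier R" "t \<in> carrier R" "r t \<in> carrier R" "q t \<in> carrier R"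
      using commutant_closed[OF r(1)] polyfun_closed[OF r(2) t] polyfun_closed[OF Suc.prems(2) t] S t
      by auto
    then show ?thesis
      unfolding r(3)[OF t] by algebra
  qed
  have 1: "polyfun S (Suc n + k) (\<lambda>t. d \<otimes> q t)"
    by (rule polyfun_mono[OF polyfun_smult[OF r(1) Suc.prems(2)]]) simp
  have 2: "polyfun S (Suc n + k) (\<lambda>t. t \<otimes> (r t \<otimes> q t))"
    using polyfun_shift[OF Suc.IH[OF r(2) Suc.prems(2)]] by (simp del: polyfun.simps)
  show ?case
    by (rule polyfun_cong[OF polyfun_add[OF 1 2]]) (rule eq)
qed

lemma polyfun_pow: "polyfun S n p \<Longrightarrow> polyfun S (k * n) (\<lambda>t. p t [^] (k::nat))"
proof (induction k)
  case 0
  show ?case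
    using polyfun_const[OF commutant_one[OF S]] by (simp del: polyfun.simps)
next
  case (Suc k)
  then show ?case
    using polyfun_mult[OF Suc.IH Suc.prems] Suc.prems by (simp add: add.commute del: polyfun.simps)
qed

lemma polyfun_id: "polyfun S 1 (\<lambda>t. t)"
proof -
  have "t \<otimes> \<one> = t" if "t \<in> S" for t
    using that S by auto
  then show ?thesis
    using polyfun_cong[OF polyfun_shift[OF polyfun_const[OF commutant_one[OF S]], of 0]] by simp
qed

text \<open>Synthetic division by \<open>t - s\<close>. If \<open>p = c + t p'\<close> and
  \<open>p' = p' s + (t - s) q\<close>, then the new quotient is \<open>p' s + t q\<close>; moving
  \<open>t\<close> past \<open>t - s\<close> uses that \<open>S\<close> is commutative.\<close>

lemma polyfun_divide:
  assumes "polyfun S (Suc n) p" "s \<in> S"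
  obtains q where "polyfun S n q" "\<And>t. t \<in> S \<Longrightarrow> p t = p s \<oplus> (t \<ominus> s) \<otimes> q t"
  using assms
proof (induction n arbitrary: p thesis)
  case 0
  then obtain c d where c: "c \<in> commutant S" "d \<in> commutant S" "\<And>t. t \<in> S \<Longrightarrow> p t = c \<oplus> t \<otimes> d"
    by auto
  show ?case
  proof (rule 0(1))
    show "polyfun S 0 (\<lambda>_. d)"
      using c(2) by auto
    fix t assume t: "t \<in> S"
    have "c \<in> carrier R" "d \<in> carrier R" "t \<in> carrier R" "s \<in> carrier R"
      using commutant_closed[OF c(1)] commutant_closed[OF c(2)] t 0(3) S by auto
    then show "p t = p s \<oplus> (t \<ominus> s) \<otimes> d"
      unfolding c(3)[OF t] c(3)[OF 0(3)] by algebra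
  qed
next
  case (Suc n)
  obtain c p' where c: "c \<in> commutant S" "polyfun S (Suc n) p'"
      "\<And>t. t \<in> S \<Longrightarrow> p t = c \<oplus> t \<otimes> p' t"
    using polyfun.simps(2)[THEN iffD1, OF Suc.prems(2)] by blast
  obtain q where q: "polyfun S n q" "\<And>t. t \<in> S \<Longrightarrow> p' t = p' s \<oplus> (t \<ominus> s) \<otimes> q t"
    using Suc.IH[OF _ c(2) Suc.prems(3)] by blast
  show ?case
  proof (rule Suc.prems(1))
    have "polyfun S (Suc n) (\<lambda>t. p' s)"
      using polyfun_value[OF c(2) Suc.prems(3)] by (rule polyfun_const)
    then show "polyfun S (Suc n) (\<lambda>t. p' s \<oplus> t \<otimes> q t)"
      by (rule polyfun_add[OF _ polyfun_shift[OF q(1)]])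
    fix t assume t: "t \<in> S"
    have cl: "c \<in> carrier R" "t \<in> carrier R" "s \<in> carrier R" "q t \<in> carrier R" "p' s \<in> carrier R"
      using commutant_closed[OF c(1)] polyfun_closed[OF q(1) t] polyfun_closed[OF c(2) Suc.prems(3)]
        S t Suc.prems(3) by auto
    have ts: "t \<otimes> s = s \<otimes> t"
      using comm commutant_comm[of t S s] t Suc.prems(3) by auto
    have "t \<otimes> (s \<otimes> q t) = s \<otimes> (t \<otimes> q t)"
      using cl ts by (simp add: m_assoc[symmetric])
    moreover have "t \<otimes> ((t \<ominus> s) \<otimes> q t) = t \<otimes> (t \<otimes> q t) \<ominus> t \<otimes> (s \<otimes> q t)"
      using cl by algebra
    moreover have "(t \<ominus> s) \<otimes> (t \<otimes> q t) = t \<otimes> (t \<otimes> q t) \<ominus> s \<otimes> (t \<otimes> q t)"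
      using cl by algebra
    ultimately have "t \<otimes> ((t \<ominus> s) \<otimes> q t) = (t \<ominus> s) \<otimes> (t \<otimes> q t)"
      by simp
    then have "p t = c \<oplus> (t \<otimes> p' s \<oplus> (t \<ominus> s) \<otimes> (t \<otimes> q t))"
      unfolding c(3)[OF t] q(2)[OF t] using cl by (simp add: r_distr)
    also have "\<dots> = (c \<oplus> s \<otimes> p' s) \<oplus> (t \<ominus> s) \<otimes> (p' s \<oplus> t \<otimes> q t)"
      using cl by algebra
    finally show "p t = p s \<oplus> (t \<ominus> s) \<otimes> (p' s \<oplus> t \<otimes> q t)"
      unfolding c(3)[OF Suc.prems(3)] .
  qed
qed

lemma poly_on_closed: "poly_on S p \<Longrightarrow> t \<in> S \<Longrightarrow> p t \<in> carrier R"
  unfolding poly_on_def using polyfun_closed by blast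

lemma poly_on_const: "c \<in> commutant S \<Longrightarrow> poly_on S (\<lambda>_. c)"
  unfolding poly_on_def using polyfun_const by blast

lemma poly_on_id: "poly_on S (\<lambda>t. t)"
  unfolding poly_on_def using polyfun_id by blast

lemma poly_on_add: "poly_on S p \<Longrightarrow> poly_on S q \<Longrightarrow> poly_on S (\<lambda>t. p t \<oplus> q t)"
proof -
  assume "poly_on S p" "poly_on S q"
  then obtain n k where "polyfun S n p" "polyfun S k q"
    unfolding poly_on_def by blast
  then have "polyfun S (max n k) p" "polyfun S (max n k) q"
    using polyfun_mono by auto
  then show ?thesis
    unfolding poly_on_def using polyfun_add by blast
qed

lemma poly_on_mult: "poly_on S p \<Longrightarrow> poly_on S q \<Longrightarrow> poly_on S (\<lambda>t. p t \<otimes> q t)"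
  unfolding poly_on_def using polyfun_mult by blast

lemma poly_on_cong: "poly_on S p \<Longrightarrow> (\<And>t. t \<in> S \<Longrightarrow> q t = p t) \<Longrightarrow> poly_on S q"
  unfolding poly_on_def using polyfun_cong by blast

lemma poly_on_pow: "poly_on S p \<Longrightarrow> poly_on S (\<lambda>t. p t [^] (k::nat))"
  unfolding poly_on_def using polyfun_pow by blast

lemma poly_on_neg:
  assumes "poly_on S p"
  shows "poly_on S (\<lambda>t. \<ominus> p t)"
proof (rule poly_on_cong)
  show "poly_on S (\<lambda>t. \<ominus> \<one> \<otimes> p t)"
    using assms by (intro poly_on_mult poly_on_const commutant_neg[OF S] commutant_one[OF S])
  show "\<ominus> p t = \<ominus> \<one> \<otimes> p t" if "t \<in> S" for t
    using poly_on_closed[OF assms that] by (simp add: l_minus)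
qed

lemma poly_on_diff: "poly_on S p \<Longrightarrow> poly_on S q \<Longrightarrow> poly_on S (\<lambda>t. p t \<ominus> q t)"
  unfolding a_minus_def by (intro poly_on_add poly_on_neg)

lemma poly_on_psum:
  "(\<And>i. i < n \<Longrightarrow> poly_on S (p i)) \<Longrightarrow> poly_on S (\<lambda>t. psum (\<lambda>i. p i t) n)"
proof (induction n)
  case 0
  show ?case
    using poly_on_const[OF commutant_zero[OF S]] by simp
qed (auto intro: poly_on_add)

end

end

section \<open>Counting roots\<close>

context skew_field
begin

context
  fixes S :: "'a set"
  assumes S: "S \<subseteq> carrier R" and comm: "S \<subseteq> commutant S"
begin

text \<open>The usual root count survives noncommuting coefficients, because the linear factor
  splits off on the left and there are no zero divisors. The conclusion is that the function
  vanishes on \<open>S\<close>, so coefficients need not be compared.\<close>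

lemma polyfun_roots:
  "polyfun S n p \<Longrightarrow> A \<subseteq> S \<Longrightarrow> n < card A \<Longrightarrow> (\<And>a. a \<in> A \<Longrightarrow> p a = \<zero>) \<Longrightarrow> t \<in> S \<Longrightarrow> p t = \<zero>"
proof (induction n arbitrary: p A t)
  case 0
  then obtain a where "a \<in> A"
    by (metis card.empty ex_in_conv less_not_refl)
  then show ?case
    using 0 by (auto simp: subset_iff)
next
  case (Suc n)
  have fin: "finite A"
    using Suc.prems(3) card.infinite by force
  obtain s where s: "s \<in> A"
    using Suc.prems(3) by fastforce
  then have sS: "s \<in> S"
    using Suc.prems(2) by blast
  obtain q where q: "polyfun S n q" "\<And>t. t \<in> S \<Longrightarrow> p t = p s \<oplus> (t \<ominus> s) \<otimes> q t"
    using polyfun_divide[OF S comm Suc.prems(1) sS] by blast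
  have qc: "q t \<in> carrier R" if "t \<in> S" for t
    using polyfun_closed[OF S comm q(1) that] .
  have p: "p t = (t \<ominus> s) \<otimes> q t" if "t \<in> S" for t
    using q(2)[OF that] Suc.prems(4)[OF s] qc[OF that] that sS S by (auto simp: subset_iff)
  have "q a = \<zero>" if a: "a \<in> A - {s}" for a
  proof -
    have ac: "a \<in> S" "a \<in> carrier R" "s \<in> carrier R"
      using a Suc.prems(2) S sS by auto
    have "(a \<ominus> s) \<otimes> q a = \<zero>"
      using p[OF ac(1)] Suc.prems(4) a by auto
    moreover have "a \<ominus> s \<noteq> \<zero>"
      using a ac by simp
    ultimately show ?thesis
      using ac qc mult_eq_zero[of "a \<ominus> s" "q a"] by auto
  qed
  moreover have "n < card (A - {s})"
    using Suc.prems(3) s fin by simp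
  ultimately have "q t = \<zero>"
    using Suc.IH[OF q(1), of "A - {s}" t] Suc.prems(2,5) by auto
  then show ?case
    using p[OF Suc.prems(5)] Suc.prems(5) S sS by (auto simp: subset_iff)
qed

lemma poly_on_finite_roots:
  assumes "poly_on S p" "s \<in> S" "p s \<noteq> \<zero>"
  shows "finite {t \<in> S. p t = \<zero>}"
proof (rule ccontr)
  assume inf: "infinite {t \<in> S. p t = \<zero>}"
  obtain n where n: "polyfun S n p"
    using assms(1) unfolding poly_on_def by blast
  obtain A where "A \<subseteq> {t \<in> S. p t = \<zero>}" "card A = Suc n"
    using infinite_arbitrarily_large[OF inf] by blast
  then have "p s = \<zero>"
    using polyfun_roots[OF n, of A s] assms(2) by auto
  then show False
    using assms(3) by simp
qed

end

end

section \<open>Generic independence and perturbation\<close>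

context ring
begin

lemma center_commutative:
  "ring_center R \<subseteq> carrier R" "ring_center R \<subseteq> commutant (ring_center R)"
  by (auto intro!: commutantI ring_center_comm)

text \<open>For a central parameter \<open>t\<close>, polynomial functions may therefore have
  arbitrary coefficients in the skew field.\<close>

lemma commutant_center: "commutant (ring_center R) = carrier R"
  by (auto simp: commutant_closed intro!: commutantI ring_center_comm[symmetric])

lemmas center_poly_on_const = poly_on_const[OF center_commutative, unfolded commutant_center]
lemmas center_poly_on_id = poly_on_id[OF center_commutative]
lemmas center_poly_on_add = poly_on_add[OF center_commutative]
lemmas center_poly_on_diff = poly_on_diff[OF center_commutative]
lemmas center_poly_on_mult = poly_on_mult[OF center_commutative]
lemmas center_poly_on_pow = poly_on_pow[OF center_commutative]
lemmas center_poly_on_psum = poly_on_psum[OF center_commutative]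
lemmas center_poly_on_closed = poly_on_closed[OF center_commutative]

text \<open>The linear functionals over the center. They turn polynomial curves of vectors into
  polynomial functions with central values, which can serve as pivots.\<close>

definition center_linear :: "('a \<Rightarrow> 'a) \<Rightarrow> bool"
  where "center_linear l \<longleftrightarrow> (\<forall>d \<in> carrier R. l d \<in> ring_center R) \<and>
    (\<forall>d \<in> carrier R. \<forall>e \<in> carrier R. l (d \<oplus> e) = l d \<oplus> l e) \<and>
    (\<forall>z \<in> ring_center R. \<forall>d \<in> carrier R. l (z \<otimes> d) = z \<otimes> l d)"

context
  fixes l :: "'a \<Rightarrow> 'a"
  assumes l: "center_linear l"
begin

lemma center_linear_mem: "d \<in> carrier R \<Longrightarrow> l d \<in> ring_center R"
  and center_linear_add: "d \<in> carrier R \<Longrightarrow> e \<in> carrier R \<Longrightarrow> l (d \<oplus> e) = l d \<oplus> l e"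
  and center_linear_scale: "z \<in> ring_center R \<Longrightarrow> d \<in> carrier R \<Longrightarrow> l (z \<otimes> d) = z \<otimes> l d"
  using l unfolding center_linear_def by blast+

lemma center_linear_zero: "l \<zero> = \<zero>"
  using center_linear_scale[of \<zero> \<zero>] center_linear_mem[of \<zero>] by simp

lemma center_linear_psum:
  assumes "\<And>i. i < n \<Longrightarrow> c i \<in> ring_center R" "\<And>i. i < n \<Longrightarrow> v i \<in> carrier R"
  shows "l (psum (\<lambda>i. c i \<otimes> v i) n) = psum (\<lambda>i. c i \<otimes> l (v i)) n"
  using assms
proof (induction n)
  case (Suc n)
  have "psum (\<lambda>i. c i \<otimes> v i) n \<in> carrier R" "c n \<otimes> v n \<in> carrier R"
    using Suc.prems by (auto intro!: psum_closed)
  then show ?case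
    using Suc by (simp add: center_linear_add center_linear_scale)
qed (simp add: center_linear_zero)

lemma center_linear_polyfun:
  "polyfun (ring_center R) n p \<Longrightarrow> polyfun (ring_center R) n (\<lambda>t. l (p t))"
proof (induction n arbitrary: p)
  case 0
  then show ?case
    using center_linear_mem by (auto simp: commutant_center)
next
  case (Suc n)
  then obtain c q where q: "c \<in> carrier R" "polyfun (ring_center R) n q"
      "\<And>t. t \<in> ring_center R \<Longrightarrow> p t = c \<oplus> t \<otimes> q t"
    by (auto simp: commutant_center)
  have "l (p t) = l c \<oplus> t \<otimes> l (q t)" if t: "t \<in> ring_center R" for t
    using q(1) t polyfun_closed[OF center_commutative q(2) t]
    by (simp add: q(3)[OF t] center_linear_add center_linear_scale)
  then show ?case
    using Suc.IH[OF q(2)] center_linear_mem[OF q(1)] by (auto simp: commutant_center)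
qed

lemma center_linear_poly_on:
  "poly_on (ring_center R) p \<Longrightarrow> poly_on (ring_center R) (\<lambda>t. l (p t))"
  unfolding poly_on_def using center_linear_polyfun by blast

end

end

context skew_field
begin

text \<open>One step of Gaussian elimination, with the last vector as the pivot.\<close>

lemma indep_pivot:
  assumes l: "center_linear l" and V: "\<And>i. i < Suc k \<Longrightarrow> V i \<in> carrier R"
    and nz: "l (V k) \<noteq> \<zero>"
  shows "indep k (\<lambda>i. l (V k) \<otimes> V i \<ominus> l (V i) \<otimes> V k) \<longleftrightarrow> indep (Suc k) V"
proof -
  define H where "H = l (V k)"
  define W where "W = (\<lambda>i. H \<otimes> V i \<ominus> l (V i) \<otimes> V k)"
  have lc: "l (V i) \<in> ring_center R" if "i < Suc k" for i
    using center_linear_mem[OF l V[OF that]] .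
  have H: "H \<in> ring_center R" "H \<in> carrier R" "H \<noteq> \<zero>" "V k \<in> carrier R"
    using lc nz V by (auto simp: H_def)
  have key: "psum (\<lambda>i. c i \<otimes> W i) k
      = H \<otimes> psum (\<lambda>i. c i \<otimes> V i) k \<ominus> l (psum (\<lambda>i. c i \<otimes> V i) k) \<otimes> V k"
    if c: "\<And>i. i < k \<Longrightarrow> c i \<in> ring_center R" for c
  proof -
    have *: "c i \<otimes> W i = H \<otimes> (c i \<otimes> V i) \<ominus> (c i \<otimes> l (V i)) \<otimes> V k" if i: "i < k" for i
    proof -
      have cl: "c i \<in> carrier R" "V i \<in> carrier R" "l (V i) \<in> carrier R"
        using c[OF i] V lc i by auto
      have "c i \<otimes> (H \<otimes> V i) = H \<otimes> (c i \<otimes> V i)"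
        using center_lcomm[OF H(1)] cl by simp
      then show ?thesis
        unfolding W_def using cl H
        by (simp add: a_minus_def r_distr r_minus m_assoc)
    qed
    have "psum (\<lambda>i. c i \<otimes> W i) k
        = psum (\<lambda>i. H \<otimes> (c i \<otimes> V i) \<ominus> (c i \<otimes> l (V i)) \<otimes> V k) k"
      using * by (rule psum_cong)
    also have "\<dots> = psum (\<lambda>i. H \<otimes> (c i \<otimes> V i)) k \<ominus> psum (\<lambda>i. (c i \<otimes> l (V i)) \<otimes> V k) k"
      using c V lc H by (intro psum_diff) auto
    also have "psum (\<lambda>i. H \<otimes> (c i \<otimes> V i)) k = H \<otimes> psum (\<lambda>i. c i \<otimes> V i) k"
      using c V H by (intro psum_lmult[symmetric]) auto
    also have "psum (\<lambda>i. (c i \<otimes> l (V i)) \<otimes> V k) k = psum (\<lambda>i. c i \<otimes> l (V i)) k \<otimes> V k"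
      using c lc H by (intro psum_rmult[symmetric]) auto
    also have "psum (\<lambda>i. c i \<otimes> l (V i)) k = l (psum (\<lambda>i. c i \<otimes> V i) k)"
      using c V by (intro center_linear_psum[OF l, symmetric]) auto
    finally show ?thesis .
  qed
  have P: "psum (\<lambda>i. c i \<otimes> V i) k \<in> carrier R"
    if "\<And>i. i < k \<Longrightarrow> c i \<in> ring_center R" for c
    using that V by (intro psum_closed) auto
  show ?thesis
    unfolding H_def[symmetric] W_def[symmetric]
  proof
    assume ind: "indep k W"
    show "indep (Suc k) V"
    proof (rule indepI)
      fix c i
      assume c: "\<And>i. i < Suc k \<Longrightarrow> c i \<in> ring_center R" "psum (\<lambda>i. c i \<otimes> V i) (Suc k) = \<zero>"
        and i: "i < Suc k"
      define p where "p = psum (\<lambda>i. c i \<otimes> V i) k"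
      have p: "p \<in> carrier R"
        unfolding p_def using c(1) by (intro P) auto
      have ck: "c k \<in> ring_center R" "c k \<in> carrier R"
        using c(1) by auto
      have rel: "p \<oplus> c k \<otimes> V k = \<zero>"
        using c(2) by (simp add: p_def)
      then have "l p \<oplus> c k \<otimes> H = \<zero>"
        using center_linear_add[OF l p, of "c k \<otimes> V k"] center_linear_scale[OF l ck(1) H(4)]
          center_linear_zero[OF l] ck H by (simp add: H_def)
      then have lp: "l p = \<ominus> (c k \<otimes> H)"
        using center_linear_mem[OF l p] ck H by (metis minus_equality m_closed ring_center_closed)
      have pe: "p = \<ominus> (c k \<otimes> V k)"
        using rel p ck H by (metis minus_equality m_closed)
      have "psum (\<lambda>i. c i \<otimes> W i) k = H \<otimes> p \<ominus> l p \<otimes> V k"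
        unfolding p_def using c(1) by (intro key) auto
      also have "\<dots> = \<ominus> (H \<otimes> (c k \<otimes> V k)) \<oplus> c k \<otimes> H \<otimes> V k"
        unfolding lp unfolding pe using ck H by (simp add: a_minus_def l_minus r_minus)
      also have "H \<otimes> (c k \<otimes> V k) = c k \<otimes> H \<otimes> V k"
        using center_lcomm[OF H(1)] ck H by (simp add: m_assoc)
      finally have "psum (\<lambda>i. c i \<otimes> W i) k = \<zero>"
        using ck H by (simp add: l_neg)
      then have ci: "c i = \<zero>" if "i < k" for i
        using indepD[OF ind, of c i] c(1) that by auto
      then have "p = \<zero>"
        unfolding p_def using V by (intro psum_zero) auto
      moreover have "V k \<noteq> \<zero>"
        using nz center_linear_zero[OF l] by auto
      ultimately have "c k = \<zero>"
        using rel ck H mult_eq_zero[of "c k" "V k"] by simp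
      then show "c i = \<zero>"
        using ci i by (cases "i = k") auto
    qed
  next
    assume ind: "indep (Suc k) V"
    show "indep k W"
    proof (rule indepI)
      fix c i
      assume c: "\<And>i. i < k \<Longrightarrow> c i \<in> ring_center R" "psum (\<lambda>i. c i \<otimes> W i) k = \<zero>" and i: "i < k"
      define p where "p = psum (\<lambda>i. c i \<otimes> V i) k"
      have p: "p \<in> carrier R" "l p \<in> ring_center R"
        unfolding p_def using center_linear_mem[OF l] P c(1) by auto
      define d where "d = (\<lambda>i. if i < k then H \<otimes> c i else \<ominus> l p)"
      have d: "d i \<in> ring_center R" for i
        using H c(1) p by (auto simp: d_def)
      have "psum (\<lambda>i. d i \<otimes> V i) k = psum (\<lambda>i. H \<otimes> (c i \<otimes> V i)) k"
        using c(1) V H by (intro psum_cong) (simp add: d_def m_assoc)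
      also have "\<dots> = H \<otimes> p"
        unfolding p_def using c(1) V H by (intro psum_lmult[symmetric]) auto
      finally have "psum (\<lambda>i. d i \<otimes> V i) (Suc k) = H \<otimes> p \<ominus> l p \<otimes> V k"
        using p H by (simp add: d_def a_minus_def l_minus)
      also have "\<dots> = \<zero>"
        using key[OF c(1)] c(2) by (simp add: p_def)
      finally have "d i = \<zero>"
        using indepD[OF ind, of d i] d i by auto
      then show "c i = \<zero>"
        using i H c(1)[OF i] mult_eq_zero[of H "c i"] by (simp add: d_def)
    qed
  qed
qed

end

section \<open>Coordinate functionals, independence for generic parameters, and perturbation\<close>

context centrally_finite_skew_field
begin

text \<open>Some coordinate of \<open>v\<close> in a basis is nonzero, and that coordinate function
  is the functional.\<close>

lemma center_functional:
  assumes v: "v \<in> carrier R" "v \<noteq> \<zero>"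
  obtains l where "center_linear l" "l v \<noteq> \<zero>"
proof -
  obtain n u where u: "\<And>i. i < n \<Longrightarrow> u i \<in> carrier R" "indep n u"
    "\<And>d. d \<in> carrier R \<Longrightarrow> \<exists>c. (\<forall>i<n. c i \<in> ring_center R) \<and> d = psum (\<lambda>i. c i \<otimes> u i) n"
    using center_basis by blast
  obtain co where co: "\<And>d i. d \<in> carrier R \<Longrightarrow> i < n \<Longrightarrow> co d i \<in> ring_center R"
    "\<And>d. d \<in> carrier R \<Longrightarrow> d = psum (\<lambda>i. co d i \<otimes> u i) n"
    using u(3) by metis
  have unique: "c i = co d i"
    if "d \<in> carrier R" "\<And>i. i < n \<Longrightarrow> c i \<in> ring_center R" "d = psum (\<lambda>i. c i \<otimes> u i) n" "i < n"
    for c d i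
  proof -
    have "psum (\<lambda>i. (c i \<ominus> co d i) \<otimes> u i) n = psum (\<lambda>i. c i \<otimes> u i \<ominus> co d i \<otimes> u i) n"
      using that(2) co(1)[OF that(1)] u(1)
      by (intro psum_cong) (simp add: a_minus_def l_distr l_minus)
    also have "\<dots> = psum (\<lambda>i. c i \<otimes> u i) n \<ominus> psum (\<lambda>i. co d i \<otimes> u i) n"
      using that(2) co(1)[OF that(1)] u(1) by (intro psum_diff) auto
    also have "\<dots> = \<zero>"
      using that(1,3) co(2)[OF that(1)] by (simp add: a_minus_def r_neg)
    finally have "c i \<ominus> co d i = \<zero>"
      using indepD[OF u(2), of "\<lambda>i. c i \<ominus> co d i" i] that co(1) by auto
    then show ?thesis
      using that co(1) by simp
  qed
  obtain i where i: "i < n" "co v i \<noteq> \<zero>"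
  proof (rule ccontr)
    assume "\<not> thesis"
    then have "co v i = \<zero>" if "i < n" for i
      using that \<open>\<And>i. \<lbrakk>i < n; co v i \<noteq> \<zero>\<rbrakk> \<Longrightarrow> thesis\<close> by blast
    then have "psum (\<lambda>i. co v i \<otimes> u i) n = \<zero>"
      using u(1) by (intro psum_zero) auto
    then show False
      using co(2)[OF v(1)] v(2) by simp
  qed
  have "center_linear (\<lambda>d. co d i)"
    unfolding center_linear_def
  proof (intro conjI ballI)
    show "co d i \<in> ring_center R" if "d \<in> carrier R" for d
      using co(1)[OF that i(1)] .
    fix d e assume d: "d \<in> carrier R" and e: "e \<in> carrier R"
    have "d \<oplus> e = psum (\<lambda>i. co d i \<otimes> u i) n \<oplus> psum (\<lambda>i. co e i \<otimes> u i) n"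
      using co(2)[OF d] co(2)[OF e] by simp
    also have "\<dots> = psum (\<lambda>i. co d i \<otimes> u i \<oplus> co e i \<otimes> u i) n"
      using co(1)[OF d] co(1)[OF e] u(1) by (intro psum_add[symmetric]) auto
    also have "\<dots> = psum (\<lambda>i. (co d i \<oplus> co e i) \<otimes> u i) n"
      using co(1)[OF d] co(1)[OF e] u(1) by (intro psum_cong) (simp add: l_distr)
    finally show "co (d \<oplus> e) i = co d i \<oplus> co e i"
      using co(1)[OF d] co(1)[OF e] a_closed[OF d e] i(1)
      by (intro unique[of "d \<oplus> e" "\<lambda>i. co d i \<oplus> co e i" i, symmetric]) simp_all
  next
    fix z d assume z: "z \<in> ring_center R" and d: "d \<in> carrier R"
    have "z \<otimes> d = z \<otimes> psum (\<lambda>i. co d i \<otimes> u i) n"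
      using co(2)[OF d] by simp
    also have "\<dots> = psum (\<lambda>i. z \<otimes> (co d i \<otimes> u i)) n"
      using co(1)[OF d] u(1) z by (intro psum_lmult) auto
    also have "\<dots> = psum (\<lambda>i. (z \<otimes> co d i) \<otimes> u i) n"
      using co(1)[OF d] u(1) z by (intro psum_cong) (simp add: m_assoc)
    finally show "co (z \<otimes> d) i = z \<otimes> co d i"
      using co(1)[OF d] m_closed[OF ring_center_closed[OF z] d] z i(1)
      by (intro unique[of "z \<otimes> d" "\<lambda>i. z \<otimes> co d i" i, symmetric]) simp_all
  qed
  then show thesis
    using that i(2) by blast
qed

text \<open>Independence is an open condition, shown by elimination in place of determinants: a
  functional that is nonzero on the last vector at \<open>t = 0\<close> is nonzero on it for all but
  finitely many \<open>t\<close>, and pivoting there leaves one vector fewer.\<close>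

lemma indep_generic:
  assumes "\<And>i. i < k \<Longrightarrow> poly_on (ring_center R) (v i)" "indep k (\<lambda>i. v i \<zero>)"
  shows "finite {t \<in> ring_center R. \<not> indep k (\<lambda>i. v i t)}"
  using assms
proof (induction k arbitrary: v)
  case 0
  then show ?case
    by (simp add: indep_def)
next
  case (Suc k)
  have vc: "v i t \<in> carrier R" if "i < Suc k" "t \<in> ring_center R" for i t
    using center_poly_on_closed[OF Suc.prems(1)[OF that(1)] that(2)] .
  have "v k \<zero> \<noteq> \<zero>"
    using indep_nonzero[OF Suc.prems(2), of k] vc by simp
  then obtain l where l: "center_linear l" "l (v k \<zero>) \<noteq> \<zero>"
    using center_functional[of "v k \<zero>"] vc by auto
  \<comment> \<open>Elimination without division keeps the new vectors polynomial in
    \<open>t\<close>, as the induction hypothesis demands.\<close>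
  define w where "w = (\<lambda>i t. l (v k t) \<otimes> v i t \<ominus> l (v i t) \<otimes> v k t)"
  have piv: "indep k (\<lambda>i. w i t) \<longleftrightarrow> indep (Suc k) (\<lambda>i. v i t)"
    if "t \<in> ring_center R" "l (v k t) \<noteq> \<zero>" for t
    unfolding w_def using indep_pivot[OF l(1), of k "\<lambda>i. v i t"] vc that by auto
  have lv: "poly_on (ring_center R) (\<lambda>t. l (v i t))" if "i < Suc k" for i
    using center_linear_poly_on[OF l(1) Suc.prems(1)[OF that]] .
  have "poly_on (ring_center R) (w i)" if "i < k" for i
    unfolding w_def using that lv Suc.prems(1)
    by (intro center_poly_on_diff center_poly_on_mult) auto
  moreover have "indep k (\<lambda>i. w i \<zero>)"
    using piv[of \<zero>] l(2) Suc.prems(2) by simp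
  ultimately have "finite {t \<in> ring_center R. \<not> indep k (\<lambda>i. w i t)}"
    by (rule Suc.IH)
  moreover have "finite {t \<in> ring_center R. l (v k t) = \<zero>}"
    using poly_on_finite_roots[OF center_commutative lv[of k], of \<zero>] l(2) by simp
  moreover have "{t \<in> ring_center R. \<not> indep (Suc k) (\<lambda>i. v i t)}
      \<subseteq> {t \<in> ring_center R. \<not> indep k (\<lambda>i. w i t)} \<union> {t \<in> ring_center R. l (v k t) = \<zero>}"
    using piv by auto
  ultimately show ?case
    using finite_subset[OF _ finite_UnI] by blast
qed

lemma twist_center:
  assumes f: "\<And>i. i < m \<Longrightarrow> f i \<in> ring_center R"
    and x: "x \<in> carrier R" "w \<in> carrier R" "d \<in> carrier R" "z \<in> ring_center R"
  shows "twist f m x w (z \<otimes> d) = z \<otimes> twist f m x w d"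
proof -
  have h: "horner f m x j \<in> carrier R" for j
    using f x(1) by (intro horner_closed) auto
  have "horner f m x (Suc j) \<otimes> (z \<otimes> d) = z \<otimes> (horner f m x (Suc j) \<otimes> d)" for j
    using center_lcomm[OF x(4) h x(3)] .
  then show ?thesis
    unfolding twist_def using h x
    by (subst psum_lmult) (auto intro!: psum_cong simp: m_assoc)
qed

text \<open>If \<open>x\<close> has maximal degree along the curve \<open>x + t Y(t)\<close>, then the first-order term of
  \<open>f(x + t Y(t))\<close>, which is \<open>twist f m x x (Y 0)\<close>, cannot leave the span of the powers of \<open>x\<close>.\<close>

lemma perturbation:
  assumes x: "x \<in> carrier R" and indep: "indep m (\<lambda>i. x [^] i)"
    and f: "\<And>i. i < m \<Longrightarrow> f i \<in> ring_center R" and root: "horner f m x 0 = \<zero>"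
    and Y: "poly_on (ring_center R) Y"
    and inf: "infinite (ring_center R)" and E: "finite E"
    and dep: "\<And>t. t \<in> ring_center R \<Longrightarrow> t \<notin> E \<Longrightarrow> \<not> indep (Suc m) (\<lambda>i. (x \<oplus> t \<otimes> Y t) [^] i)"
  shows "twist f m x x (Y \<zero>) \<in> center_span x m"
proof (rule ccontr)
  assume notin: "twist f m x x (Y \<zero>) \<notin> center_span x m"
  note rel = x indep f root
  define xt where "xt = (\<lambda>t. x \<oplus> t \<otimes> Y t)"
  \<comment> \<open>Along the curve \<open>f(xt t) = t G t\<close>, because \<open>f(x) = 0\<close>.
    Modulo lower powers the \<open>m\<close>-th power of \<open>xt t\<close> is thus
    \<open>t G t\<close>. Dividing out \<open>t\<close> gives the family \<open>v\<close>, which is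
    still independent at \<open>t = 0\<close> if \<open>G \<zero>\<close> lies outside the
    span.\<close>
  define G where "G = (\<lambda>t. twist f m x (xt t) (Y t))"
  define v where "v = (\<lambda>i t. if i < m then xt t [^] i else G t)"
  have Yc: "Y t \<in> carrier R" if "t \<in> ring_center R" for t
    using center_poly_on_closed[OF Y that] .
  have xtc: "xt t \<in> carrier R" if "t \<in> ring_center R" for t
    using Yc[OF that] x that by (simp add: xt_def)
  have h: "horner f m y j \<in> carrier R" if "y \<in> carrier R" for y j
    using f that by (intro horner_closed) auto
  have Gc: "G t \<in> carrier R" if "t \<in> ring_center R" for t
    unfolding G_def using f x xtc[OF that] Yc[OF that] by (intro twist_closed) auto
  have xtp: "poly_on (ring_center R) xt"
    unfolding xt_def using x Y
    by (intro center_poly_on_add center_poly_on_mult center_poly_on_const center_poly_on_id)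
  have "poly_on (ring_center R) G"
    unfolding G_def twist_def using xtp Y h[OF x]
    by (intro center_poly_on_psum center_poly_on_mult center_poly_on_pow center_poly_on_const)
  then have vp: "poly_on (ring_center R) (v i)" for i
    using center_poly_on_pow[OF xtp, of i] by (cases "i < m") (auto simp: v_def)
  have xt0: "xt \<zero> = x"
    using x Yc by (simp add: xt_def)
  have G0: "G \<zero> = twist f m x x (Y \<zero>)"
    by (simp add: G_def xt0)
  have "indep (Suc m) (\<lambda>i. v i \<zero>)"
  proof (rule indepI)
    fix c i
    assume c: "\<And>i. i < Suc m \<Longrightarrow> c i \<in> ring_center R" "psum (\<lambda>i. c i \<otimes> v i \<zero>) (Suc m) = \<zero>"
      and i: "i < Suc m"
    define p where "p = psum (\<lambda>i. c i \<otimes> x [^] i) m"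
    have pe: "psum (\<lambda>i. c i \<otimes> v i \<zero>) m = p"
      unfolding p_def by (intro psum_cong) (simp add: v_def xt0)
    have p: "p \<in> center_span x m" "p \<in> carrier R"
      using c(1) center_spanI[of m c x] center_span_closed[OF x, of m] by (auto simp: p_def)
    have ck: "c m \<in> ring_center R" "c m \<in> carrier R"
      using c(1) by auto
    have g: "G \<zero> \<in> carrier R"
      using Gc by simp
    have rel0: "p \<oplus> c m \<otimes> G \<zero> = \<zero>"
      using c(2) pe by (simp add: v_def)
    have cm: "c m = \<zero>"
    proof (rule ccontr)
      assume nz: "c m \<noteq> \<zero>"
      have "c m \<otimes> G \<zero> = \<ominus> p"
        using rel0 p ck g by (metis a_comm m_closed minus_equality)
      then have "G \<zero> = inv (c m) \<otimes> (\<ominus> p)"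
        using inv_cancel(1)[OF ck(2) nz g] by simp
      also have "\<dots> = (\<ominus> (inv (c m))) \<otimes> p"
        using ck nz p by (simp add: l_minus r_minus)
      also have "\<dots> \<in> center_span x m"
        using center_inv[OF ck(1) nz] p by (intro center_span_scale[OF rel]) auto
      finally show False
        using notin G0 by simp
    qed
    then have "p = \<zero>"
      using rel0 p g by simp
    then show "c i = \<zero>"
      using indepD[OF indep, of c i] c(1) i cm by (cases "i = m") (auto simp: p_def)
  qed
  then have "finite {t \<in> ring_center R. \<not> indep (Suc m) (\<lambda>i. v i t)}"
    using vp by (intro indep_generic) auto
  then have "finite ({t \<in> ring_center R. \<not> indep (Suc m) (\<lambda>i. v i t)} \<union> E \<union> {\<zero>})"
    using E by simp
  then have "ring_center R - ({t \<in> ring_center R. \<not> indep (Suc m) (\<lambda>i. v i t)} \<union> E \<union> {\<zero>}) \<noteq> {}"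
    using Diff_infinite_finite[OF _ inf] infinite_imp_nonempty by blast
  then obtain t where t: "t \<in> ring_center R" "t \<notin> E" "t \<noteq> \<zero>" "indep (Suc m) (\<lambda>i. v i t)"
    by blast
  have tc: "t \<in> carrier R"
    using t by simp
  have "horner f m (xt t) 0 = t \<otimes> G t"
  proof -
    have "twist f m x (xt t) (\<one> \<otimes> xt t \<ominus> x \<otimes> \<one>) = \<one> \<otimes> horner f m (xt t) 0 \<ominus> horner f m x 0 \<otimes> \<one>"
      using f x xtc[OF t(1)] by (intro twist_telescope) auto
    moreover have "\<one> \<otimes> xt t \<ominus> x \<otimes> \<one> = t \<otimes> Y t"
    proof -
      have "x \<oplus> t \<otimes> Y t \<ominus> x = t \<otimes> Y t"
        using x tc Yc[OF t(1)] by algebra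
      then show ?thesis
        using x xtc[OF t(1)] by (simp add: xt_def)
    qed
    ultimately show ?thesis
      using twist_center[OF f x xtc[OF t(1)] Yc[OF t(1)] t(1)] root h[OF xtc[OF t(1)]]
      by (simp add: G_def a_minus_def)
  qed
  then have top: "psum (\<lambda>i. f i \<otimes> xt t [^] i) m \<oplus> xt t [^] m = t \<otimes> G t"
    by (simp add: horner_def)
  have "indep (Suc m) (\<lambda>i. xt t [^] i)"
  proof (rule indepI)
    fix c i
    assume c: "\<And>i. i < Suc m \<Longrightarrow> c i \<in> ring_center R" "psum (\<lambda>i. c i \<otimes> xt t [^] i) (Suc m) = \<zero>"
      and i: "i < Suc m"
    define p where "p = psum (\<lambda>i. c i \<otimes> xt t [^] i) m"
    define q where "q = psum (\<lambda>i. f i \<otimes> xt t [^] i) m"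
    have ck: "c m \<in> ring_center R" "c m \<in> carrier R"
      using c(1) by auto
    have cl: "p \<in> carrier R" "q \<in> carrier R" "xt t [^] m \<in> carrier R" "G t \<in> carrier R"
      unfolding p_def q_def using c(1) f xtc[OF t(1)] Gc[OF t(1)] by (auto intro!: psum_closed)
    \<comment> \<open>The relation rewritten in terms of \<open>v\<close>: replacing the
      \<open>m\<close>-th power by \<open>t G t\<close> minus the lower terms of \<open>f\<close>
      subtracts \<open>c m f i\<close> from \<open>c i\<close> and makes \<open>c m t\<close> the
      last coefficient. As \<open>t\<close> is nonzero, \<open>c m\<close> can be recovered.\<close>
    define d where "d = (\<lambda>i. if i < m then c i \<ominus> c m \<otimes> f i else c m \<otimes> t)"
    have d: "d i \<in> ring_center R" if "i < Suc m" for i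
      using c(1)[OF that] ck f t by (auto simp: d_def)
    have "psum (\<lambda>i. d i \<otimes> v i t) m = psum (\<lambda>i. c i \<otimes> xt t [^] i \<ominus> c m \<otimes> (f i \<otimes> xt t [^] i)) m"
      using c(1) ck f xtc[OF t(1)]
      by (intro psum_cong) (simp add: d_def v_def a_minus_def l_distr l_minus m_assoc)
    also have "\<dots> = p \<ominus> psum (\<lambda>i. c m \<otimes> (f i \<otimes> xt t [^] i)) m"
      unfolding p_def using c(1) ck f xtc[OF t(1)] by (intro psum_diff) auto
    also have "psum (\<lambda>i. c m \<otimes> (f i \<otimes> xt t [^] i)) m = c m \<otimes> q"
      unfolding q_def using ck f xtc[OF t(1)] by (intro psum_lmult[symmetric]) auto
    finally have "psum (\<lambda>i. d i \<otimes> v i t) (Suc m) = (p \<ominus> c m \<otimes> q) \<oplus> c m \<otimes> (t \<otimes> G t)"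
      using ck tc cl by (simp add: d_def v_def m_assoc)
    also have "\<dots> = (p \<ominus> c m \<otimes> q) \<oplus> c m \<otimes> (q \<oplus> xt t [^] m)"
      using top by (simp add: q_def)
    also have "\<dots> = p \<oplus> c m \<otimes> xt t [^] m"
      using cl ck(2) by algebra
    also have "\<dots> = \<zero>"
      using c(2) by (simp add: p_def)
    finally have dz: "d i = \<zero>" if "i < Suc m" for i
      using indepD[OF t(4), of d i] d that by auto
    then have cm: "c m = \<zero>"
      using dz[of m] ck tc t(3) mult_eq_zero[of "c m" t] by (simp add: d_def)
    show "c i = \<zero>"
    proof (cases "i = m")
      case False
      then have "i < m"
        using i by simp
      then show ?thesis
        using dz[of i] cm c(1)[OF i] f[of i] by (simp add: d_def)
    qed (use cm in simp)
  qed
  then show False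
    using dep[OF t(1,2)] by (simp add: xt_def)
qed

end

section \<open>Additive commutators\<close>

context skew_field
begin

text \<open>Here \<open>y\<close> is \<open>z\<close> times a conjugate of \<open>x\<close>, and
  \<open>s y^j = z^j x^j s\<close>. So degrees do not notice conjugation or central scaling, the two
  changes that make a curve of multiplicative commutators polynomial.\<close>

lemma indep_powers_conjugate:
  assumes s: "s \<in> carrier R" "s \<noteq> \<zero>" and z: "z \<in> ring_center R" "z \<noteq> \<zero>"
    and x: "x \<in> carrier R" "y \<in> carrier R" and eq: "s \<otimes> y = z \<otimes> (x \<otimes> s)"
    and ind: "indep k (\<lambda>i. y [^] i)"
  shows "indep k (\<lambda>i. x [^] i)"
proof (rule indepI)
  fix c i
  assume c: "\<And>i. i < k \<Longrightarrow> c i \<in> ring_center R" "psum (\<lambda>i. c i \<otimes> x [^] i) k = \<zero>" and i: "i < k"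
  have zc: "z \<in> carrier R"
    using z by simp
  have iz: "inv z \<in> ring_center R" "inv z \<in> carrier R"
    using center_inv[OF z] by auto
  have pow: "s \<otimes> y [^] j = z [^] j \<otimes> (x [^] j \<otimes> s)" for j :: nat
  proof (induction j)
    case (Suc j)
    have "s \<otimes> y [^] Suc j = (s \<otimes> y [^] j) \<otimes> y"
      using s x by (simp add: m_assoc)
    also have "\<dots> = z [^] j \<otimes> x [^] j \<otimes> (s \<otimes> y)"
      unfolding Suc using s x zc by (simp add: m_assoc)
    also have "\<dots> = z [^] j \<otimes> (x [^] j \<otimes> (z \<otimes> (x \<otimes> s)))"
      unfolding eq using s x zc by (simp add: m_assoc)
    also have "x [^] j \<otimes> (z \<otimes> (x \<otimes> s)) = z \<otimes> (x [^] j \<otimes> (x \<otimes> s))"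
      using center_lcomm[OF z(1)] s x by simp
    finally show ?case
      using s x zc by (simp add: m_assoc)
  qed (use s in simp)
  have izp: "inv z [^] j \<otimes> z [^] j = \<one>" for j :: nat
  proof (induction j)
    case (Suc j)
    have "inv z [^] Suc j \<otimes> z [^] Suc j = inv z [^] j \<otimes> (inv z \<otimes> (z [^] j \<otimes> z))"
      using zc iz by (simp add: m_assoc)
    also have "inv z \<otimes> (z [^] j \<otimes> z) = z [^] j \<otimes> (inv z \<otimes> z)"
      using center_lcomm[OF iz(1)] zc by simp
    finally show ?case
      using Suc zc iz z(2) by simp
  qed (use zc in simp)
  define d where "d = (\<lambda>i. c i \<otimes> inv z [^] i)"
  have d: "d i \<in> ring_center R" if "i < k" for i
    using c(1)[OF that] iz by (simp add: d_def)
  have "s \<otimes> psum (\<lambda>i. d i \<otimes> y [^] i) k = psum (\<lambda>i. s \<otimes> (d i \<otimes> y [^] i)) k"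
    using d s x by (intro psum_lmult) auto
  also have "\<dots> = psum (\<lambda>i. c i \<otimes> x [^] i \<otimes> s) k"
  proof (rule psum_cong)
    fix j assume j: "j < k"
    have cj: "c j \<in> carrier R"
      using c(1)[OF j] by simp
    have "s \<otimes> (d j \<otimes> y [^] j) = d j \<otimes> (z [^] j \<otimes> (x [^] j \<otimes> s))"
      using center_lcomm[OF d[OF j]] s x by (simp add: pow)
    also have "\<dots> = c j \<otimes> (inv z [^] j \<otimes> z [^] j) \<otimes> x [^] j \<otimes> s"
      using cj zc iz x s by (simp add: d_def m_assoc)
    finally show "s \<otimes> (d j \<otimes> y [^] j) = c j \<otimes> x [^] j \<otimes> s"
      using cj by (simp add: izp)
  qed
  also have "\<dots> = psum (\<lambda>i. c i \<otimes> x [^] i) k \<otimes> s"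
    using c(1) x s by (intro psum_rmult[symmetric]) auto
  finally have "s \<otimes> psum (\<lambda>i. d i \<otimes> y [^] i) k = \<zero>"
    using c(2) s by simp
  moreover have "psum (\<lambda>i. d i \<otimes> y [^] i) k \<in> carrier R"
    using d x by (intro psum_closed) auto
  ultimately have "psum (\<lambda>i. d i \<otimes> y [^] i) k = \<zero>"
    using s mult_eq_zero by blast
  then have "d i = \<zero>"
    using indepD[OF ind, of d i] d i by auto
  then show "c i = \<zero>"
    using mult_eq_zero[of "c i" "inv z [^] i"] c(1)[OF i] iz pow_nonzero[OF iz(2) inv_nonzero[OF zc z(2)]]
    by (simp add: d_def)
qed

text \<open>The span lies in \<open>F(x)\<close> and \<open>F(x)\<close> lies in the centralizer of
  \<open>x\<close>. The assumption closes this circle, and the span is commutative.\<close>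

lemma maximal_subfield_center_adjoin:
  assumes x: "x \<in> carrier R" and sub: "commutant {x} \<subseteq> center_span x m"
  shows "maximal_subfield (center_adjoin R x) R"
proof -
  have "h \<in> commutant {x}" if "h \<in> generate_field R (insert x (ring_center R))" for h
    using that
  proof (induction rule: generate_field.induct)
    case (incl h)
    then show ?case
      using x commutant_self[OF x] center_commutant[of h "{x}"] by auto
  qed (use x in \<open>auto intro: commutant_one commutant_neg commutant_inv commutant_add commutant_mult\<close>)
  moreover have "center_span x m \<subseteq> generate_field R (insert x (ring_center R))"
    by (rule center_span_subset) (auto intro: generate_field.intros)
  ultimately have "center_adjoin R x = commutant {x}"
    using sub unfolding center_adjoin_def by blast
  moreover have "y \<otimes> z = z \<otimes> y" if "y \<in> commutant {x}" "z \<in> commutant {x}" for y z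
    using center_span_commutant[OF x, of z y m] that sub commutant_closed[OF that(2)]
      commutant_comm[OF that(2), of x] by auto
  ultimately show ?thesis
    using maximal_subfield_commutant[OF x] by simp
qed

end

section \<open>Elements of maximal degree and their centralizers\<close>

context centrally_finite_skew_field
begin

lemma max_degree:
  assumes "V \<noteq> {}" "V \<subseteq> carrier R"
  obtains m x where "x \<in> V" "indep m (\<lambda>i. x [^] i)" "\<And>y. y \<in> V \<Longrightarrow> \<not> indep (Suc m) (\<lambda>i. y [^] i)"
proof -
  obtain n where n: "\<And>k v. (\<And>i. i < k \<Longrightarrow> v i \<in> carrier R) \<Longrightarrow> indep k v \<Longrightarrow> k \<le> n"
    using indep_bounded by blast
  define P where "P = (\<lambda>k. \<exists>x \<in> V. indep k (\<lambda>i. x [^] i))"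
  have "P 0"
    using assms(1) by (auto simp: P_def indep_def)
  moreover have "k \<le> n" if "P k" for k
    using that assms(2) n[of k "\<lambda>i. _ [^] i"] by (force simp: P_def)
  ultimately have "P (Greatest P)" "\<not> P (Suc (Greatest P))"
    using GreatestI_nat[of P 0 n] Greatest_le_nat[of P "Suc (Greatest P)" n] by auto
  then show thesis
    using that unfolding P_def by blast
qed

context
  fixes f :: "nat \<Rightarrow> 'a" and m :: nat and x :: 'a
  assumes x: "x \<in> carrier R" and indep: "indep m (\<lambda>i. x [^] i)"
    and f: "\<And>i. i < m \<Longrightarrow> f i \<in> ring_center R" and root: "horner f m x 0 = \<zero>"
begin

text \<open>The map \<open>H y = [z, twist f m x x y]\<close> satisfies \<open>H (y z) = H y z\<close> and \<open>H (a y) = H (y a)\<close>, so it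
  vanishes on all \<open>y [a, z]\<close>. Unless \<open>[a, z] = 0\<close> it vanishes identically.\<close>

lemma commutant_dichotomy:
  assumes a: "a \<in> carrier R"
    and twist: "\<And>y. y \<in> carrier R \<Longrightarrow> twist f m x x (a \<otimes> y \<ominus> y \<otimes> a) \<in> center_span x m"
    and z: "z \<in> carrier R" "z \<otimes> x = x \<otimes> z"
  shows "z \<in> center_span x m \<or> a \<otimes> z = z \<otimes> a"
proof (rule disjCI)
  assume nc: "a \<otimes> z \<noteq> z \<otimes> a"
  let ?Q = "twist f m x x"
  have Q: "?Q y \<in> carrier R" if "y \<in> carrier R" for y
    using f x that by (intro twist_closed) auto
  have Qd: "?Q (y \<ominus> w) = ?Q y \<ominus> ?Q w" if "y \<in> carrier R" "w \<in> carrier R" for y w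
    using f x that by (intro twist_diff) auto
  have Qz: "?Q (y \<otimes> z) = ?Q y \<otimes> z" if "y \<in> carrier R" for y
    using f x that z by (intro twist_rmult) auto
  define H where "H = (\<lambda>y. z \<otimes> ?Q y \<ominus> ?Q y \<otimes> z)"
  have Hc: "H y \<in> carrier R" if "y \<in> carrier R" for y
    using Q[OF that] z by (simp add: H_def)
  have Hd: "H (y \<ominus> w) = H y \<ominus> H w" if "y \<in> carrier R" "w \<in> carrier R" for y w
    unfolding H_def Qd[OF that] using Q[OF that(1)] Q[OF that(2)] z(1) by algebra
  have Hz: "H (y \<otimes> z) = H y \<otimes> z" if "y \<in> carrier R" for y
    unfolding H_def Qz[OF that] using Q[OF that] z(1) by algebra
  have Ha: "H (a \<otimes> y) = H (y \<otimes> a)" if y: "y \<in> carrier R" for y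
  proof -
    have "z \<otimes> ?Q (a \<otimes> y \<ominus> y \<otimes> a) = ?Q (a \<otimes> y \<ominus> y \<otimes> a) \<otimes> z"
      using center_span_commutant[OF x z twist[OF y]] .
    then have "H (a \<otimes> y \<ominus> y \<otimes> a) = \<zero>"
      using a y z Q by (simp add: H_def)
    then show ?thesis
      using Hd[of "a \<otimes> y" "y \<otimes> a"] Hc a y by simp
  qed
  define e where "e = a \<otimes> z \<ominus> z \<otimes> a"
  have e: "e \<in> carrier R" "e \<noteq> \<zero>"
    using a z nc by (auto simp: e_def)
  show "z \<in> center_span x m"
  proof (rule bicommutant_mem_center_span[OF x indep f root z(1)])
    fix c assume c: "c \<in> carrier R"
    define y where "y = c \<otimes> inv e"
    have y: "y \<in> carrier R"
      using c e by (simp add: y_def)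
    have "c = y \<otimes> e"
      using c e by (simp add: y_def m_assoc)
    also have "\<dots> = y \<otimes> a \<otimes> z \<ominus> y \<otimes> z \<otimes> a"
      unfolding e_def using a y z(1) by algebra
    finally have "H c = H (y \<otimes> a \<otimes> z) \<ominus> H (y \<otimes> z \<otimes> a)"
      using Hd[of "y \<otimes> a \<otimes> z" "y \<otimes> z \<otimes> a"] a y z by simp
    also have "H (y \<otimes> a \<otimes> z) = H (y \<otimes> z \<otimes> a)"
      using Hz[of "y \<otimes> a"] Ha[OF y] Hz[of "a \<otimes> y"] Ha[of "y \<otimes> z"] a y z by (simp add: m_assoc)
    finally have "H c = \<zero>"
      using Hc[of "y \<otimes> z \<otimes> a"] a y z by (simp add: a_minus_def r_neg)
    then show "z \<otimes> ?Q c = ?Q c \<otimes> z"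
      using Q[OF c] z by (simp add: H_def)
  qed
qed

text \<open>The dichotomy says nothing about \<open>x\<close>, which lies in its own span. If
  \<open>z\<close> centralizes \<open>x\<close> outside the span, then so does \<open>x + z\<close>;
  as \<open>a\<close> commutes with both, it commutes with their difference
  \<open>x\<close>.\<close>

lemma maximal_or_commutes:
  assumes a: "a \<in> carrier R"
    and twist: "\<And>y. y \<in> carrier R \<Longrightarrow> twist f m x x (a \<otimes> y \<ominus> y \<otimes> a) \<in> center_span x m"
    and nmax: "\<not> maximal_subfield (center_adjoin R x) R"
  shows "a \<otimes> x = x \<otimes> a"
proof -
  note rel = x indep f root
  obtain z where z: "z \<in> commutant {x}" "z \<notin> center_span x m"
    using maximal_subfield_center_adjoin[OF x] nmax by blast
  have zc: "z \<in> carrier R" "z \<otimes> x = x \<otimes> z"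
    using commutant_closed[OF z(1)] commutant_comm[OF z(1), of x] by auto
  have "x \<oplus> z \<notin> center_span x m"
  proof
    assume xz: "x \<oplus> z \<in> center_span x m"
    have nx: "\<ominus> \<one> \<otimes> x \<in> center_span x m"
      by (intro center_span_scale[OF rel] center_span_self[OF rel]) auto
    have "(x \<oplus> z) \<oplus> \<ominus> \<one> \<otimes> x \<in> center_span x m"
      by (rule center_span_add[OF rel xz nx]) auto
    moreover have "(x \<oplus> z) \<oplus> \<ominus> \<one> \<otimes> x = z"
    proof -
      have "(x \<oplus> z) \<oplus> \<ominus> x = z"
        using x zc(1) by algebra
      then show ?thesis
        using x by (simp add: l_minus)
    qed
    ultimately show False
      using z(2) by simp
  qed
  moreover have "(x \<oplus> z) \<otimes> x = x \<otimes> (x \<oplus> z)"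
    using x zc by (simp add: l_distr r_distr)
  ultimately have "a \<otimes> (x \<oplus> z) = (x \<oplus> z) \<otimes> a"
    using commutant_dichotomy[OF a twist, of "x \<oplus> z"] x zc by auto
  moreover have "a \<otimes> z = z \<otimes> a"
    using commutant_dichotomy[OF a twist zc] z(2) by blast
  ultimately show ?thesis
    using a x zc by (simp add: l_distr r_distr)
qed

end

lemma generic_nonzero:
  assumes "infinite (ring_center R)" "finite E"
  obtains t where "t \<in> ring_center R" "t \<notin> E" "t \<noteq> \<zero>"
proof -
  have "ring_center R - (insert \<zero> E) \<noteq> {}"
    using Diff_infinite_finite[of "insert \<zero> E", OF _ assms(1)] assms(2) infinite_imp_nonempty by blast
  then show thesis
    using that by blast
qed

text \<open>The additive commutators form a space \<open>V\<close>. Elements of maximal degree in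
  \<open>V\<close> commute with \<open>a\<close>. For such an \<open>x\<close> and any
  \<open>y\<close> in \<open>V\<close>, some \<open>x + t y\<close> with nonzero \<open>t\<close>
  also has maximal degree, and subtracting shows that \<open>y\<close> commutes with
  \<open>a\<close>.\<close>

lemma commutator_maximal_or_nilpotent:
  assumes inf: "infinite (ring_center R)" and a: "a \<in> carrier R"
    and nmax: "\<And>c. c \<in> carrier R \<Longrightarrow> \<not> maximal_subfield (center_adjoin R (a \<otimes> c \<ominus> c \<otimes> a)) R"
    and c: "c \<in> carrier R"
  shows "a \<otimes> (a \<otimes> c \<ominus> c \<otimes> a) = (a \<otimes> c \<ominus> c \<otimes> a) \<otimes> a"
proof -
  define V where "V = (\<lambda>c. a \<otimes> c \<ominus> c \<otimes> a) ` carrier R"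
  have Vc: "V \<subseteq> carrier R" "V \<noteq> {}"
    using a by (auto simp: V_def)
  have line: "x \<oplus> t \<otimes> y \<in> V" if xyV: "x \<in> V" "y \<in> V" and t: "t \<in> ring_center R" for x y t
  proof -
    obtain d e where d: "d \<in> carrier R" "x = a \<otimes> d \<ominus> d \<otimes> a" and e: "e \<in> carrier R" "y = a \<otimes> e \<ominus> e \<otimes> a"
      using xyV unfolding V_def by blast
    have tc: "t \<in> carrier R"
      using t by simp
    have at: "a \<otimes> (t \<otimes> e) = t \<otimes> (a \<otimes> e)"
      using center_lcomm[OF t a e(1)] .
    have "x \<oplus> t \<otimes> y = (a \<otimes> d \<oplus> t \<otimes> (a \<otimes> e)) \<ominus> (d \<oplus> t \<otimes> e) \<otimes> a"
      unfolding d(2) e(2) using a d(1) e(1) tc by algebra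
    also have "\<dots> = a \<otimes> (d \<oplus> t \<otimes> e) \<ominus> (d \<oplus> t \<otimes> e) \<otimes> a"
      using a d(1) e(1) tc by (simp add: r_distr at)
    finally show ?thesis
      using d(1) e(1) tc by (auto simp: V_def)
  qed
  obtain m x where xV: "x \<in> V" and ind: "indep m (\<lambda>i. x [^] i)"
    and top: "\<And>y. y \<in> V \<Longrightarrow> \<not> indep (Suc m) (\<lambda>i. y [^] i)"
    by (rule max_degree[OF Vc(2,1)]) blast
  have comm: "a \<otimes> y = y \<otimes> a" if yV: "y \<in> V" and indy: "indep m (\<lambda>i. y [^] i)" for y
  proof -
    have y: "y \<in> carrier R"
      using yV Vc by auto
    obtain f where f: "\<And>i. i < m \<Longrightarrow> f i \<in> ring_center R" "horner f m y 0 = \<zero>"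
      by (rule horner_relation[OF y indy top[OF yV]]) blast
    show ?thesis
    proof (rule maximal_or_commutes[OF y indy f a])
      fix w assume w: "w \<in> carrier R"
      then have wV: "a \<otimes> w \<ominus> w \<otimes> a \<in> V"
        unfolding V_def by (rule imageI)
      have "twist f m y y ((\<lambda>_. a \<otimes> w \<ominus> w \<otimes> a) \<zero>) \<in> center_span y m"
        using a w top line[OF yV wV]
        by (intro perturbation[OF y indy f _ inf finite.emptyI] center_poly_on_const) auto
      then show "twist f m y y (a \<otimes> w \<ominus> w \<otimes> a) \<in> center_span y m" .
    qed (use yV nmax in \<open>auto simp: V_def\<close>)
  qed
  define y where "y = a \<otimes> c \<ominus> c \<otimes> a"
  have yV: "y \<in> V"
    using c unfolding V_def y_def by (rule imageI)
  have xy: "x \<in> carrier R" "y \<in> carrier R"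
    using xV yV Vc by auto
  have "poly_on (ring_center R) (\<lambda>t. x \<oplus> t \<otimes> y)"
    using xy by (intro center_poly_on_add center_poly_on_mult center_poly_on_const center_poly_on_id)
  moreover have "indep m (\<lambda>i. (x \<oplus> \<zero> \<otimes> y) [^] i)"
    using xy ind by simp
  ultimately have "finite {t \<in> ring_center R. \<not> indep m (\<lambda>i. (x \<oplus> t \<otimes> y) [^] i)}"
    using indep_generic[of m "\<lambda>i t. (x \<oplus> t \<otimes> y) [^] i"] center_poly_on_pow by simp
  then obtain t where t: "t \<in> ring_center R" "t \<noteq> \<zero>" "indep m (\<lambda>i. (x \<oplus> t \<otimes> y) [^] i)"
    using generic_nonzero[OF inf] by blast
  have tc: "t \<in> carrier R"
    using t by simp
  have "a \<otimes> (x \<oplus> t \<otimes> y) = (x \<oplus> t \<otimes> y) \<otimes> a"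
    by (rule comm[OF line[OF xV yV t(1)] t(3)])
  then have "a \<otimes> x \<oplus> t \<otimes> (a \<otimes> y) = x \<otimes> a \<oplus> t \<otimes> (y \<otimes> a)"
    using a xy tc center_lcomm[OF t(1) a xy(2)] by (simp add: l_distr r_distr m_assoc)
  then have "t \<otimes> (a \<otimes> y) = t \<otimes> (y \<otimes> a)"
    using comm[OF xV ind] a xy tc by simp
  then have "a \<otimes> y = y \<otimes> a"
    using mult_left_cancel[OF tc _ _ t(2)] a xy by simp
  then show ?thesis
    by (simp add: y_def)
qed

text \<open>A derivation \<open>\<delta>\<close> with \<open>\<delta>\<^sup>2 = 0\<close> satisfies \<open>0 = \<delta>\<^sup>2(c\<^sup>2) = 2 \<delta>(c)\<^sup>2\<close>.\<close>

lemma nilpotent_derivation: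
  assumes a: "a \<in> carrier R" "a \<notin> ring_center R"
    and nil: "\<And>c. c \<in> carrier R \<Longrightarrow> a \<otimes> (a \<otimes> c \<ominus> c \<otimes> a) = (a \<otimes> c \<ominus> c \<otimes> a) \<otimes> a"
  shows "\<one> \<oplus> \<one> = \<zero>" "a \<otimes> a \<in> ring_center R"
proof -
  obtain c where c: "c \<in> carrier R" "a \<otimes> c \<noteq> c \<otimes> a"
    using a ring_centerI by blast
  define d where "d = a \<otimes> c \<ominus> c \<otimes> a"
  have d: "d \<in> carrier R" "d \<noteq> \<zero>"
    using a c by (auto simp: d_def)
  have ac: "a \<otimes> c = c \<otimes> a \<oplus> d"
    unfolding d_def using a(1) c(1) by algebra
  have ad: "a \<otimes> d = d \<otimes> a"
    using nil[OF c(1)] by (simp add: d_def)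
  have cd: "a \<otimes> (c \<otimes> c) \<ominus> (c \<otimes> c) \<otimes> a = c \<otimes> d \<oplus> d \<otimes> c"
    unfolding d_def using a(1) c(1) by algebra
  have "a \<otimes> (c \<otimes> d \<oplus> d \<otimes> c) = (c \<otimes> d \<oplus> d \<otimes> c) \<otimes> a"
    using nil[of "c \<otimes> c"] cd c(1) by simp
  moreover have "a \<otimes> (c \<otimes> d \<oplus> d \<otimes> c) = (a \<otimes> c) \<otimes> d \<oplus> (a \<otimes> d) \<otimes> c"
    using a(1) c(1) d(1) by (simp add: r_distr m_assoc)
  moreover have "\<dots> = (c \<otimes> d \<oplus> d \<otimes> c) \<otimes> a \<oplus> (d \<otimes> d \<oplus> d \<otimes> d)"
  proof -
    have "(a \<otimes> c) \<otimes> d = c \<otimes> (a \<otimes> d) \<oplus> d \<otimes> d"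
      unfolding ac using a(1) c(1) d(1) by (simp add: l_distr m_assoc)
    moreover have "(a \<otimes> d) \<otimes> c = d \<otimes> (a \<otimes> c)"
      unfolding ad using a(1) c(1) d(1) by (simp add: m_assoc)
    ultimately have "(a \<otimes> c) \<otimes> d \<oplus> (a \<otimes> d) \<otimes> c = (c \<otimes> (d \<otimes> a) \<oplus> d \<otimes> d) \<oplus> d \<otimes> (c \<otimes> a \<oplus> d)"
      unfolding ac ad by simp
    also have "\<dots> = (c \<otimes> d \<oplus> d \<otimes> c) \<otimes> a \<oplus> (d \<otimes> d \<oplus> d \<otimes> d)"
      using a(1) c(1) d(1) by algebra
    finally show ?thesis .
  qed
  ultimately have "(c \<otimes> d \<oplus> d \<otimes> c) \<otimes> a = (c \<otimes> d \<oplus> d \<otimes> c) \<otimes> a \<oplus> (d \<otimes> d \<oplus> d \<otimes> d)"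
    by simp
  moreover have "d \<otimes> d \<oplus> d \<otimes> d
      = ((c \<otimes> d \<oplus> d \<otimes> c) \<otimes> a \<oplus> (d \<otimes> d \<oplus> d \<otimes> d)) \<ominus> (c \<otimes> d \<oplus> d \<otimes> c) \<otimes> a"
    using a(1) c(1) d(1) by algebra
  ultimately have "d \<otimes> d \<oplus> d \<otimes> d = \<zero>"
    using a(1) c(1) d(1) by simp
  then have "(\<one> \<oplus> \<one>) \<otimes> (d \<otimes> d) = \<zero>"
    using d(1) by (simp add: l_distr)
  then show two: "\<one> \<oplus> \<one> = \<zero>"
    using d by (simp add: mult_eq_zero)
  have dbl: "y \<oplus> y = \<zero>" if "y \<in> carrier R" for y
    using two that by (metis l_distr l_null l_one one_closed)
  show "a \<otimes> a \<in> ring_center R"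
  proof (rule ring_centerI)
    fix y assume y: "y \<in> carrier R"
    \<comment> \<open>The hypothesis reads \<open>a^2 y - w = w - y a^2\<close>. In characteristic 2
      the term \<open>2 w\<close> and the sign disappear.\<close>
    define w where "w = a \<otimes> y \<otimes> a"
    have w: "w \<in> carrier R"
      using a(1) y by (simp add: w_def)
    have "a \<otimes> a \<otimes> y \<ominus> w = w \<ominus> y \<otimes> (a \<otimes> a)"
      using nil[OF y] a(1) y unfolding w_def by (simp add: a_minus_def r_distr l_distr r_minus l_minus m_assoc)
    moreover have "a \<otimes> a \<otimes> y = (a \<otimes> a \<otimes> y \<ominus> w) \<oplus> w"
      "(w \<ominus> y \<otimes> (a \<otimes> a)) \<oplus> w = (w \<oplus> w) \<ominus> y \<otimes> (a \<otimes> a)"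
      using a(1) y w by algebra+
    ultimately have "a \<otimes> a \<otimes> y = (w \<oplus> w) \<ominus> y \<otimes> (a \<otimes> a)"
      by simp
    also have "\<dots> = \<ominus> (y \<otimes> (a \<otimes> a))"
      using dbl[OF w] a(1) y by (simp add: a_minus_def)
    also have "\<dots> = y \<otimes> (a \<otimes> a)"
      using dbl[of "y \<otimes> (a \<otimes> a)"] a(1) y by (metis m_closed minus_equality)
    finally show "a \<otimes> a \<otimes> y = y \<otimes> (a \<otimes> a)" .
  qed (use a in simp)
qed

end

section \<open>Multiplicative commutators\<close>

context skew_field
begin

lemma inv_mult:
  assumes "x \<in> carrier R" "y \<in> carrier R" "x \<noteq> \<zero>" "y \<noteq> \<zero>"
  shows "inv (x \<otimes> y) = inv y \<otimes> inv x"
proof (rule mult_left_cancel[of "x \<otimes> y"])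
  have "x \<otimes> y \<otimes> (inv y \<otimes> inv x) = x \<otimes> (y \<otimes> inv y) \<otimes> inv x"
    using assms by (simp add: m_assoc)
  then show "x \<otimes> y \<otimes> inv (x \<otimes> y) = x \<otimes> y \<otimes> (inv y \<otimes> inv x)"
    using assms by (simp add: mult_eq_zero)
qed (use assms in \<open>auto simp: mult_eq_zero\<close>)

lemma inv_inv:
  assumes "x \<in> carrier R" "x \<noteq> \<zero>"
  shows "inv (inv x) = x"
  by (rule mult_left_cancel[of "inv x"]) (use assms inv_nonzero[OF assms] in auto)

end

context centrally_finite_skew_field
begin

text \<open>The inverse of \<open>1 + t y\<close> is a polynomial in \<open>t\<close> up to a central factor, because \<open>y\<close> is
  algebraic. The induction multiplies the Horner scheme of the minimal relation by powers of \<open>-t\<close>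
  and replaces \<open>-t y\<close> by \<open>1 - (1 + t y)\<close>.\<close>

lemma resolvent:
  assumes y: "y \<in> carrier R"
  obtains N A where "poly_on (ring_center R) N" "poly_on (ring_center R) A"
    "\<And>t. t \<in> ring_center R \<Longrightarrow> N t \<in> ring_center R"
    "\<And>t. t \<in> ring_center R \<Longrightarrow> (\<one> \<oplus> t \<otimes> y) \<otimes> A t = \<one> \<oplus> t \<otimes> N t"
proof -
  obtain g k where g: "\<And>i. i < k \<Longrightarrow> g i \<in> ring_center R" "horner g k y 0 = \<zero>"
    by (rule relation_exists[OF y]) blast
  have h: "horner g k y j \<in> carrier R" for j
    using g(1) y by (intro horner_closed) auto
  have up: "poly_on (ring_center R) (\<lambda>t. \<one> \<oplus> t \<otimes> y)"
    using y by (intro center_poly_on_add center_poly_on_mult center_poly_on_const center_poly_on_id) auto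
  have "\<exists>N B. poly_on (ring_center R) N \<and> poly_on (ring_center R) B \<and>
      (\<forall>t \<in> ring_center R. N t \<in> ring_center R \<and>
        (\<ominus> t) [^] r \<otimes> horner g k y (k - r) = (\<one> \<oplus> t \<otimes> N t) \<oplus> (\<one> \<oplus> t \<otimes> y) \<otimes> B t)"
    if "r \<le> k" for r
    using that
  proof (induction r)
    case 0
    have "horner g k y k = \<one>"
      using g(1) by (rule horner_top)
    then show ?case
      using y center_poly_on_const[OF zero_closed] by (intro exI[of _ "\<lambda>_. \<zero>"]) simp
  next
    case (Suc r)
    from Suc.IH[OF Suc_leD[OF Suc.prems]] obtain N B where N: "poly_on (ring_center R) N" "poly_on (ring_center R) B"
      "\<And>t. t \<in> ring_center R \<Longrightarrow> N t \<in> ring_center R"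
      "\<And>t. t \<in> ring_center R \<Longrightarrow>
        (\<ominus> t) [^] r \<otimes> horner g k y (k - r) = (\<one> \<oplus> t \<otimes> N t) \<oplus> (\<one> \<oplus> t \<otimes> y) \<otimes> B t"
      by blast
    define j where "j = k - Suc r"
    have j: "j < k" "Suc j = k - r"
      using Suc.prems by (auto simp: j_def)
    have gj: "g j \<in> ring_center R" "g j \<in> carrier R"
      using g(1)[OF j(1)] by auto
    \<comment> \<open>Let \<open>X\<close> be the right-hand side for \<open>r\<close> and
      \<open>u = 1 + t y\<close>. Multiplying by \<open>-t\<close> and adding the coefficient
      \<open>g j\<close> gives \<open>-t y X - t (-t)^r g j\<close>, and
      \<open>-t y X = X - u X\<close>. The part divisible by \<open>u\<close> goes to
      \<open>B'\<close> and the rest to \<open>N'\<close>.\<close>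
    define N' where "N' = (\<lambda>t. N t \<ominus> (\<ominus> t) [^] r \<otimes> g j)"
    define B' where "B' = (\<lambda>t. B t \<ominus> ((\<one> \<oplus> t \<otimes> N t) \<oplus> (\<one> \<oplus> t \<otimes> y) \<otimes> B t))"
    have "poly_on (ring_center R) (\<lambda>t. (\<ominus> t) [^] r \<otimes> g j)"
      using gj
      by (intro center_poly_on_mult center_poly_on_pow center_poly_on_const poly_on_neg
          center_poly_on_id center_commutative)
    then have N'p: "poly_on (ring_center R) N'"
      unfolding N'_def by (rule center_poly_on_diff[OF N(1)])
    have B'p: "poly_on (ring_center R) B'"
      unfolding B'_def
      by (intro center_poly_on_diff center_poly_on_add center_poly_on_mult N up
          center_poly_on_id center_poly_on_const one_closed)
    have "N' t \<in> ring_center R \<and>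
        (\<ominus> t) [^] Suc r \<otimes> horner g k y j = (\<one> \<oplus> t \<otimes> N' t) \<oplus> (\<one> \<oplus> t \<otimes> y) \<otimes> B' t"
      if t: "t \<in> ring_center R" for t
    proof
      have tc: "t \<in> carrier R" "N t \<in> carrier R"
        using t N(3)[OF t] by auto
      have bc: "B t \<in> carrier R"
        using center_poly_on_closed[OF N(2) t] .
      show "N' t \<in> ring_center R"
        using t N(3)[OF t] gj by (simp add: N'_def)
      define P where "P = (\<ominus> t) [^] r"
      have P: "P \<in> ring_center R" "P \<in> carrier R"
        using t by (auto simp: P_def)
      define h' where "h' = horner g k y (Suc j)"
      have h': "h' \<in> carrier R"
        using h by (simp add: h'_def)
      define M where "M = \<one> \<oplus> t \<otimes> N t"
      have M: "M \<in> carrier R"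
        using tc by (simp add: M_def)
      have Ph: "P \<otimes> h' = M \<oplus> (\<one> \<oplus> t \<otimes> y) \<otimes> B t"
        using N(4)[OF t] by (simp add: P_def h'_def M_def j(2))
      have "P \<otimes> (t \<otimes> (y \<otimes> h')) = t \<otimes> (y \<otimes> (P \<otimes> h'))"
        using center_lcomm[OF P(1), of y h'] center_lcomm[OF P(1), of t "y \<otimes> h'"] tc(1) y h' by simp
      moreover have "P \<otimes> (t \<otimes> g j) = t \<otimes> (P \<otimes> g j)"
        using center_lcomm[OF t P(2) gj(2)] .
      moreover have "(\<ominus> t) [^] Suc r \<otimes> (g j \<oplus> y \<otimes> h')
          = \<ominus> (P \<otimes> (t \<otimes> g j)) \<ominus> P \<otimes> (t \<otimes> (y \<otimes> h'))"
        unfolding nat_pow_Suc P_def[symmetric] using P(2) tc(1) gj(2) y h' by algebra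
      ultimately have "(\<ominus> t) [^] Suc r \<otimes> (g j \<oplus> y \<otimes> h')
          = \<ominus> (t \<otimes> (P \<otimes> g j)) \<ominus> t \<otimes> y \<otimes> (M \<oplus> (\<one> \<oplus> t \<otimes> y) \<otimes> B t)"
        using Ph tc(1) y h' P(2) bc M by (simp add: m_assoc)
      moreover have "horner g k y j = g j \<oplus> y \<otimes> h'"
        unfolding h'_def using g(1) y j(1) by (intro horner_step) auto
      moreover have "\<one> \<oplus> t \<otimes> N' t = M \<ominus> t \<otimes> (P \<otimes> g j)"
        unfolding N'_def M_def P_def[symmetric] using tc P(2) gj(2)
        by (simp add: a_minus_def r_distr r_minus a_assoc)
      moreover have "(M \<ominus> t \<otimes> (P \<otimes> g j)) \<oplus> (\<one> \<oplus> t \<otimes> y) \<otimes> B' t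
          = \<ominus> (t \<otimes> (P \<otimes> g j)) \<ominus> t \<otimes> y \<otimes> (M \<oplus> (\<one> \<oplus> t \<otimes> y) \<otimes> B t)"
      proof -
        define w where "w = t \<otimes> y"
        define b where "b = B t"
        have wb: "w \<in> carrier R" "b \<in> carrier R" "P \<otimes> g j \<in> carrier R"
          using tc(1) y bc P(2) gj(2) by (auto simp: w_def b_def)
        have l: "(\<one> \<oplus> w) \<otimes> v = v \<oplus> w \<otimes> v" if "v \<in> carrier R" for v
          using wb that by (simp add: l_distr)
        have "(M \<ominus> t \<otimes> (P \<otimes> g j)) \<oplus> ((b \<ominus> (M \<oplus> (b \<oplus> w \<otimes> b))) \<oplus> w \<otimes> (b \<ominus> (M \<oplus> (b \<oplus> w \<otimes> b))))
          = \<ominus> (t \<otimes> (P \<otimes> g j)) \<ominus> w \<otimes> (M \<oplus> (b \<oplus> w \<otimes> b))"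
          using M wb tc(1) by algebra
        then show ?thesis
          unfolding B'_def M_def[symmetric] w_def[symmetric] b_def[symmetric] using M wb by (simp add: l)
      qed
      ultimately show "(\<ominus> t) [^] Suc r \<otimes> horner g k y j = (\<one> \<oplus> t \<otimes> N' t) \<oplus> (\<one> \<oplus> t \<otimes> y) \<otimes> B' t"
        by simp
    qed
    then show ?case
      unfolding j_def[symmetric] using N'p B'p by blast
  qed
  \<comment> \<open>At \<open>r = k\<close> the left side contains \<open>g(y) = 0\<close>, so
    \<open>A = - B\<close> works. The central factor \<open>1 + t N t\<close> is the reversed
    polynomial \<open>(-t)^k g(-1/t)\<close>; its value 1 at \<open>t = 0\<close> makes it nonzero
    for all but finitely many \<open>t\<close>.\<close>
  from this[of k] obtain N B where N: "poly_on (ring_center R) N" "poly_on (ring_center R) B"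
    "\<And>t. t \<in> ring_center R \<Longrightarrow> N t \<in> ring_center R"
    "\<And>t. t \<in> ring_center R \<Longrightarrow>
      (\<ominus> t) [^] k \<otimes> horner g k y 0 = (\<one> \<oplus> t \<otimes> N t) \<oplus> (\<one> \<oplus> t \<otimes> y) \<otimes> B t"
    by auto
  show thesis
  proof (rule that[of N "\<lambda>t. \<ominus> B t"])
    show "poly_on (ring_center R) (\<lambda>t. \<ominus> B t)"
      by (rule poly_on_neg[OF center_commutative N(2)])
    fix t assume t: "t \<in> ring_center R"
    define M where "M = \<one> \<oplus> t \<otimes> N t"
    define u where "u = \<one> \<oplus> t \<otimes> y"
    have cl: "M \<in> carrier R" "u \<in> carrier R" "B t \<in> carrier R"
      using t y N(3)[OF t] center_poly_on_closed[OF N(2) t] by (auto simp: M_def u_def)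
    have "M \<oplus> u \<otimes> B t = \<zero>"
      using N(4)[OF t] g(2) t by (simp add: M_def u_def)
    moreover have "u \<otimes> \<ominus> B t = M \<ominus> (M \<oplus> u \<otimes> B t)"
      using cl by algebra
    ultimately show "(\<one> \<oplus> t \<otimes> y) \<otimes> \<ominus> B t = \<one> \<oplus> t \<otimes> N t"
      using cl by (simp add: M_def[symmetric] u_def[symmetric] a_minus_def)
  qed (fact N(1,3))+
qed

text \<open>Clearing denominators in the curve \<open>t \<mapsto> u\<^sup>-\<^sup>1 a u e\<close> with \<open>u = 1 + t y\<close>.\<close>

lemma conjugation_curve:
  assumes y: "y \<in> carrier R" and a: "a \<in> carrier R" and e: "e \<in> carrier R"
  obtains Y n E where "poly_on (ring_center R) Y" "n \<in> ring_center R"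
    "Y \<zero> = (a \<otimes> y \<ominus> y \<otimes> a) \<otimes> e \<oplus> n \<otimes> (a \<otimes> e)" "finite E"
    "\<And>t. t \<in> ring_center R \<Longrightarrow> t \<notin> E \<Longrightarrow> \<one> \<oplus> t \<otimes> y \<noteq> \<zero>"
    "\<And>t. t \<in> ring_center R \<Longrightarrow> t \<notin> E \<Longrightarrow> \<exists>z \<in> ring_center R. z \<noteq> \<zero> \<and>
      (\<one> \<oplus> t \<otimes> y) \<otimes> (a \<otimes> e \<oplus> t \<otimes> Y t) = z \<otimes> (a \<otimes> (\<one> \<oplus> t \<otimes> y) \<otimes> e)"
proof -
  obtain N A where N: "poly_on (ring_center R) N" "poly_on (ring_center R) A"
    "\<And>t. t \<in> ring_center R \<Longrightarrow> N t \<in> ring_center R"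
    "\<And>t. t \<in> ring_center R \<Longrightarrow> (\<one> \<oplus> t \<otimes> y) \<otimes> A t = \<one> \<oplus> t \<otimes> N t"
    by (rule resolvent[OF y]) blast
  \<comment> \<open>From \<open>u A = 1 + t N\<close> follows \<open>A = 1 + t (N - y A)\<close>.
    Hence the cleared curve \<open>A a u e\<close> equals \<open>a e + t Y\<close> with this
    \<open>Y\<close>.\<close>
  define Y where "Y = (\<lambda>t. (N t \<ominus> y \<otimes> A t) \<otimes> a \<otimes> (\<one> \<oplus> t \<otimes> y) \<otimes> e \<oplus> a \<otimes> y \<otimes> e)"
  define E where "E = {t \<in> ring_center R. \<one> \<oplus> t \<otimes> N t = \<zero>}"
  have Ac: "A t \<in> carrier R" if "t \<in> ring_center R" for t
    using center_poly_on_closed[OF N(2) that] .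
  show thesis
  proof (rule that[of Y "N \<zero>" E])
    show "poly_on (ring_center R) Y"
      unfolding Y_def using y a e
      by (intro center_poly_on_add center_poly_on_mult center_poly_on_diff N(1,2)
          center_poly_on_id center_poly_on_const) auto
    show "N \<zero> \<in> ring_center R"
      using N(3) by simp
    then have N0: "N \<zero> \<in> carrier R"
      by simp
    have "A \<zero> = \<one>"
      using N(4)[of \<zero>] Ac[of \<zero>] y N0 by simp
    then have "Y \<zero> = (N \<zero> \<ominus> y) \<otimes> a \<otimes> e \<oplus> a \<otimes> y \<otimes> e"
      using y a N0 by (simp add: Y_def)
    also have "\<dots> = (a \<otimes> y \<ominus> y \<otimes> a) \<otimes> e \<oplus> N \<zero> \<otimes> (a \<otimes> e)"
      using y a e N0 by algebra
    finally show "Y \<zero> = (a \<otimes> y \<ominus> y \<otimes> a) \<otimes> e \<oplus> N \<zero> \<otimes> (a \<otimes> e)" .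
    have "poly_on (ring_center R) (\<lambda>t. \<one> \<oplus> t \<otimes> N t)"
      by (intro center_poly_on_add center_poly_on_mult N(1) center_poly_on_id center_poly_on_const one_closed)
    then show "finite E"
      unfolding E_def using poly_on_finite_roots[OF center_commutative, of "\<lambda>t. \<one> \<oplus> t \<otimes> N t" \<zero>]
        N0 one_not_zero by simp
    fix t assume t: "t \<in> ring_center R" "t \<notin> E"
    have tc: "t \<in> carrier R" "N t \<in> carrier R" "A t \<in> carrier R"
      using t N(3)[OF t(1)] Ac[OF t(1)] by auto
    have nz: "\<one> \<oplus> t \<otimes> N t \<noteq> \<zero>"
      using t by (simp add: E_def)
    then show "\<one> \<oplus> t \<otimes> y \<noteq> \<zero>"
      using N(4)[OF t(1)] tc by auto
    define u where "u = \<one> \<oplus> t \<otimes> y"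
    have u: "u \<in> carrier R"
      using tc(1) y by (simp add: u_def)
    have eq: "A t \<oplus> t \<otimes> (y \<otimes> A t) = \<one> \<oplus> t \<otimes> N t"
      using N(4)[OF t(1)] tc y by (simp add: l_distr m_assoc)
    have At: "A t = \<one> \<oplus> t \<otimes> (N t \<ominus> y \<otimes> A t)"
    proof -
      have "A t = (A t \<oplus> t \<otimes> (y \<otimes> A t)) \<ominus> t \<otimes> (y \<otimes> A t)"
        using tc y by algebra
      also have "\<dots> = \<one> \<oplus> t \<otimes> (N t \<ominus> y \<otimes> A t)"
        unfolding eq using tc y by (simp add: a_minus_def r_distr r_minus a_assoc)
      finally show ?thesis .
    qed
    define B where "B = N t \<ominus> y \<otimes> A t"
    have B: "B \<in> carrier R"
      using tc y by (simp add: B_def)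
    have "a \<otimes> e \<oplus> t \<otimes> Y t = a \<otimes> e \<oplus> t \<otimes> (a \<otimes> (y \<otimes> e)) \<oplus> t \<otimes> (B \<otimes> a \<otimes> u \<otimes> e)"
      unfolding Y_def B_def[symmetric] u_def[symmetric] using a e y tc(1) B u by algebra
    also have "t \<otimes> (a \<otimes> (y \<otimes> e)) = a \<otimes> (t \<otimes> (y \<otimes> e))"
      using center_lcomm[OF t(1), of a "y \<otimes> e"] a y e by simp
    also have "a \<otimes> e \<oplus> a \<otimes> (t \<otimes> (y \<otimes> e)) = a \<otimes> u \<otimes> e"
      unfolding u_def using a e y tc(1) by (simp add: r_distr l_distr m_assoc)
    also have "a \<otimes> u \<otimes> e \<oplus> t \<otimes> (B \<otimes> a \<otimes> u \<otimes> e) = (\<one> \<oplus> t \<otimes> B) \<otimes> (a \<otimes> u \<otimes> e)"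
      using a e u tc(1) B by (simp add: l_distr m_assoc)
    also have "\<one> \<oplus> t \<otimes> B = A t"
      using At by (simp add: B_def)
    finally have "u \<otimes> (a \<otimes> e \<oplus> t \<otimes> Y t) = (u \<otimes> A t) \<otimes> (a \<otimes> u \<otimes> e)"
      using a e u tc by (simp add: m_assoc)
    also have "u \<otimes> A t = \<one> \<oplus> t \<otimes> N t"
      using N(4)[OF t(1)] by (simp add: u_def)
    finally show "\<exists>z \<in> ring_center R. z \<noteq> \<zero> \<and>
      (\<one> \<oplus> t \<otimes> y) \<otimes> (a \<otimes> e \<oplus> t \<otimes> Y t) = z \<otimes> (a \<otimes> (\<one> \<oplus> t \<otimes> y) \<otimes> e)"
      using nz t(1) N(3)[OF t(1)] by (intro bexI[of _ "\<one> \<oplus> t \<otimes> N t"]) (auto simp: u_def)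
  qed
qed

text \<open>This value is \<open>f'(x)\<close>, a polynomial in \<open>x\<close>. The denominator of
  the conjugation curve adds a central multiple of the base point to its direction, and the
  resulting term is removed by this membership.\<close>

lemma twist_one_mem:
  assumes x: "x \<in> carrier R" and indep: "indep m (\<lambda>i. x [^] i)"
    and f: "\<And>i. i < m \<Longrightarrow> f i \<in> ring_center R" and root: "horner f m x 0 = \<zero>"
  shows "twist f m x x \<one> \<in> center_span x m"
proof -
  note rel = x indep f root
  have "horner f m x j \<in> center_span x m" for j
    unfolding horner_def
    by (intro center_span_add[OF rel] center_span_psum[OF rel] center_span_scale[OF rel]
        center_span_pow[OF rel]) (auto intro: f)
  moreover have "horner f m x j \<in> carrier R" for j
    using f x by (intro horner_closed) auto
  ultimately show ?thesis
    unfolding twist_def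
    by (intro center_span_psum[OF rel] center_span_mult[OF rel] center_span_pow[OF rel]
        center_span_one[OF rel]) auto
qed

text \<open>A group is not the union of two proper subgroups, applied to the additive group and the
  centralizers of \<open>a\<close> and \<open>b\<close>.\<close>

lemma not_union_of_two_commutants:
  assumes a: "a \<in> carrier R" "a \<notin> ring_center R" and b: "b \<in> carrier R" "b \<notin> ring_center R"
  obtains y where "y \<in> carrier R" "a \<otimes> y \<noteq> y \<otimes> a" "b \<otimes> y \<noteq> y \<otimes> b"
proof -
  obtain u where u: "u \<in> carrier R" "a \<otimes> u \<noteq> u \<otimes> a"
    using a ring_centerI by blast
  obtain v where v: "v \<in> carrier R" "b \<otimes> v \<noteq> v \<otimes> b"
    using b ring_centerI by blast
  consider "b \<otimes> u \<noteq> u \<otimes> b" | "a \<otimes> v \<noteq> v \<otimes> a" | "b \<otimes> u = u \<otimes> b" "a \<otimes> v = v \<otimes> a"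
    by blast
  then show thesis
  proof cases
    case 3
    have "a \<otimes> (u \<oplus> v) \<noteq> (u \<oplus> v) \<otimes> a"
      using u v a(1) 3(2) by (simp add: l_distr r_distr)
    moreover have "b \<otimes> (u \<oplus> v) \<noteq> (u \<oplus> v) \<otimes> b"
      using u v b(1) 3(1) by (simp add: l_distr r_distr)
    ultimately show ?thesis
      using that[of "u \<oplus> v"] u v by blast
  qed (use that u v in blast)+
qed

text \<open>If no \<open>b\<close> works, then \<open>a\<close> commutes with \<open>u g u\<^sup>-\<^sup>1\<close> for a fixed noncentral \<open>g\<close> and all but finitely
  many \<open>u = 1 + t y\<close>. Comparing two values of \<open>t\<close>, every \<open>y\<close> commutes with \<open>a\<close> or with \<open>g\<close>.\<close>

lemma group_commutator_maximal:
  assumes inf: "infinite (ring_center R)" and a: "a \<in> carrier R" "a \<notin> ring_center R"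
  obtains b where "b \<in> carrier R" "b \<noteq> \<zero>"
    "maximal_subfield (center_adjoin R (a \<otimes> b \<otimes> inv a \<otimes> inv b)) R"
proof (rule ccontr)
  assume "\<not> thesis"
  then have nmax: "\<not> maximal_subfield (center_adjoin R (a \<otimes> b \<otimes> inv a \<otimes> inv b)) R"
    if "b \<in> carrier R" "b \<noteq> \<zero>" for b
    using that \<open>\<And>b. \<lbrakk>b \<in> carrier R; b \<noteq> \<zero>; maximal_subfield (center_adjoin R (a \<otimes> b \<otimes> inv a \<otimes> inv b)) R\<rbrakk> \<Longrightarrow> thesis\<close>
    by blast
  have a0: "a \<noteq> \<zero>"
    using a by auto
  define s where "s = inv a"
  have s: "s \<in> carrier R" "s \<noteq> \<zero>"
    using a(1) a0 inv_nonzero by (auto simp: s_def)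
  \<comment> \<open>The group commutator is \<open>x b = a e b\<close> with \<open>e b\<close> a
    conjugate of \<open>a^-1\<close>. Replacing \<open>b\<close> by \<open>u b\<close> conjugates
    \<open>e b\<close> by \<open>u\<close>, so \<open>x (u b)\<close> is conjugate to
    \<open>u^-1 a u (e b)\<close>, the point of the conjugation curve.\<close>
  define e where "e = (\<lambda>b. b \<otimes> s \<otimes> inv b)"
  define x where "x = (\<lambda>b. a \<otimes> e b)"
  have e: "e b \<in> carrier R" "e b \<noteq> \<zero>" if "b \<in> carrier R" "b \<noteq> \<zero>" for b
    using that s inv_nonzero[OF that] by (auto simp: e_def mult_eq_zero)
  have x: "x b \<in> carrier R" "x b \<noteq> \<zero>" if "b \<in> carrier R" "b \<noteq> \<zero>" for b
    using e[OF that] a(1) a0 by (auto simp: x_def mult_eq_zero)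
  have x_eq: "x b = a \<otimes> b \<otimes> inv a \<otimes> inv b" if "b \<in> carrier R" "b \<noteq> \<zero>" for b
    using that a(1) s by (simp add: x_def e_def s_def[symmetric] m_assoc)
  have e_mult: "e (u \<otimes> b) \<otimes> u = u \<otimes> e b"
    if "b \<in> carrier R" "b \<noteq> \<zero>" "u \<in> carrier R" "u \<noteq> \<zero>" for u b
    unfolding e_def inv_mult[OF that(3,1,4,2)] using that s by (simp add: m_assoc)
  obtain m b0 where b0: "b0 \<in> carrier R" "b0 \<noteq> \<zero>" and ind0: "indep m (\<lambda>i. x b0 [^] i)"
    and top: "\<And>b. b \<in> carrier R \<Longrightarrow> b \<noteq> \<zero> \<Longrightarrow> \<not> indep (Suc m) (\<lambda>i. x b [^] i)"
  proof -
    have "x ` (carrier R - {\<zero>}) \<noteq> {}"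
      using one_not_zero by auto
    moreover have "x ` (carrier R - {\<zero>}) \<subseteq> carrier R"
      using x by auto
    ultimately obtain m w where w: "w \<in> x ` (carrier R - {\<zero>})" "indep m (\<lambda>i. w [^] i)"
      "\<And>y. y \<in> x ` (carrier R - {\<zero>}) \<Longrightarrow> \<not> indep (Suc m) (\<lambda>i. y [^] i)"
      by (rule max_degree) blast
    from w(1) obtain b where "b \<in> carrier R" "b \<noteq> \<zero>" "w = x b"
      by blast
    then show thesis
      using that w(2,3) by blast
  qed
  have curve: "\<exists>Y n E. poly_on (ring_center R) Y \<and> n \<in> ring_center R \<and>
      Y \<zero> = (a \<otimes> y \<ominus> y \<otimes> a) \<otimes> e b \<oplus> n \<otimes> x b \<and> finite E \<and>
      (\<forall>t \<in> ring_center R. t \<notin> E \<longrightarrow> \<one> \<oplus> t \<otimes> y \<noteq> \<zero> \<and>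
        (\<forall>k. indep k (\<lambda>i. (x b \<oplus> t \<otimes> Y t) [^] i) \<longrightarrow> indep k (\<lambda>i. x ((\<one> \<oplus> t \<otimes> y) \<otimes> b) [^] i)))"
    if b: "b \<in> carrier R" "b \<noteq> \<zero>" and y: "y \<in> carrier R" for b y
  proof -
    obtain Y n E where Y: "poly_on (ring_center R) Y" "n \<in> ring_center R"
      "Y \<zero> = (a \<otimes> y \<ominus> y \<otimes> a) \<otimes> e b \<oplus> n \<otimes> (a \<otimes> e b)" "finite E"
      "\<And>t. t \<in> ring_center R \<Longrightarrow> t \<notin> E \<Longrightarrow> \<one> \<oplus> t \<otimes> y \<noteq> \<zero>"
      "\<And>t. t \<in> ring_center R \<Longrightarrow> t \<notin> E \<Longrightarrow> \<exists>z \<in> ring_center R. z \<noteq> \<zero> \<and>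
        (\<one> \<oplus> t \<otimes> y) \<otimes> (a \<otimes> e b \<oplus> t \<otimes> Y t) = z \<otimes> (a \<otimes> (\<one> \<oplus> t \<otimes> y) \<otimes> e b)"
      by (rule conjugation_curve[OF y a(1) e(1)[OF b]]) blast
    have "indep k (\<lambda>i. x ((\<one> \<oplus> t \<otimes> y) \<otimes> b) [^] i)"
      if t: "t \<in> ring_center R" "t \<notin> E" and ind: "indep k (\<lambda>i. (x b \<oplus> t \<otimes> Y t) [^] i)" for t k
    proof -
      define u where "u = \<one> \<oplus> t \<otimes> y"
      have u: "u \<in> carrier R" "u \<noteq> \<zero>"
        using Y(5)[OF t] t(1) y by (auto simp: u_def)
      have ub: "u \<otimes> b \<in> carrier R" "u \<otimes> b \<noteq> \<zero>"
        using u b by (auto simp: mult_eq_zero)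
      obtain z where z: "z \<in> ring_center R" "z \<noteq> \<zero>"
        "u \<otimes> (x b \<oplus> t \<otimes> Y t) = z \<otimes> (a \<otimes> u \<otimes> e b)"
        using Y(6)[OF t] unfolding x_def u_def by blast
      have "a \<otimes> u \<otimes> e b = x (u \<otimes> b) \<otimes> u"
        unfolding x_def using a(1) u e(1)[OF ub] e(1)[OF b] e_mult[OF b u] by (simp add: m_assoc)
      then have eq: "u \<otimes> (x b \<oplus> t \<otimes> Y t) = z \<otimes> (x (u \<otimes> b) \<otimes> u)"
        using z(3) by simp
      have "x b \<oplus> t \<otimes> Y t \<in> carrier R"
        using x(1)[OF b] t(1) center_poly_on_closed[OF Y(1) t(1)] by simp
      then show ?thesis
        unfolding u_def[symmetric]
        using indep_powers_conjugate[OF u z(1,2) x(1)[OF ub] _ eq ind] by simp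
    qed
    then show ?thesis
      using Y(1-5) unfolding x_def by blast
  qed
  have comm: "a \<otimes> e b = e b \<otimes> a"
    if b: "b \<in> carrier R" "b \<noteq> \<zero>" and ind: "indep m (\<lambda>i. x b [^] i)" for b
  proof -
    note xb = x(1)[OF b]
    obtain f where f: "\<And>i. i < m \<Longrightarrow> f i \<in> ring_center R" "horner f m (x b) 0 = \<zero>"
      by (rule horner_relation[OF xb ind top[OF b]]) blast
    note rel = xb ind f
    let ?Q = "twist f m (x b) (x b)"
    have "a \<otimes> x b = x b \<otimes> a"
    proof (rule maximal_or_commutes[OF rel a(1)])
      fix w assume w: "w \<in> carrier R"
      define d where "d = a \<otimes> w \<ominus> w \<otimes> a"
      have d: "d \<in> carrier R"
        using a(1) w by (simp add: d_def)
      \<comment> \<open>The direction \<open>w a\<close> is chosen because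
        \<open>[a, w a] e b = [a, w] a e b = [a, w] x b\<close>, which exposes the additive
        commutator \<open>[a, w]\<close> up to a factor in the span.\<close>
      obtain Y n E where Y: "poly_on (ring_center R) Y" "n \<in> ring_center R"
        "Y \<zero> = (a \<otimes> (w \<otimes> a) \<ominus> w \<otimes> a \<otimes> a) \<otimes> e b \<oplus> n \<otimes> x b" "finite E"
        "\<And>t. t \<in> ring_center R \<Longrightarrow> t \<notin> E \<Longrightarrow> \<one> \<oplus> t \<otimes> (w \<otimes> a) \<noteq> \<zero>"
        "\<And>t k. t \<in> ring_center R \<Longrightarrow> t \<notin> E \<Longrightarrow> indep k (\<lambda>i. (x b \<oplus> t \<otimes> Y t) [^] i) \<Longrightarrow>
          indep k (\<lambda>i. x ((\<one> \<oplus> t \<otimes> (w \<otimes> a)) \<otimes> b) [^] i)"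
        using curve[OF b m_closed[OF w a(1)]] by blast
      have n: "n \<in> carrier R"
        using Y(2) by simp
      have "?Q (Y \<zero>) \<in> center_span (x b) m"
      proof (rule perturbation[OF rel Y(1) inf Y(4)])
        fix t assume t: "t \<in> ring_center R" "t \<notin> E"
        have "(\<one> \<oplus> t \<otimes> (w \<otimes> a)) \<otimes> b \<in> carrier R" "(\<one> \<oplus> t \<otimes> (w \<otimes> a)) \<otimes> b \<noteq> \<zero>"
          using Y(5)[OF t] t(1) a(1) b w by (auto simp: mult_eq_zero)
        then show "\<not> indep (Suc m) (\<lambda>i. (x b \<oplus> t \<otimes> Y t) [^] i)"
          using Y(6)[OF t] top by blast
      qed auto
      moreover have "Y \<zero> = (d \<oplus> n \<otimes> \<one>) \<otimes> x b"
      proof -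
        have "Y \<zero> = d \<otimes> (a \<otimes> e b) \<oplus> n \<otimes> x b"
          unfolding Y(3) d_def using a(1) w e(1)[OF b] n xb by algebra
        also have "a \<otimes> e b = x b"
          by (simp add: x_def)
        finally show ?thesis
          using d n xb by (simp add: l_distr)
      qed
      moreover have "?Q ((d \<oplus> n \<otimes> \<one>) \<otimes> x b) = (?Q d \<oplus> n \<otimes> ?Q \<one>) \<otimes> x b"
      proof -
        have "?Q ((d \<oplus> n \<otimes> \<one>) \<otimes> x b) = ?Q (d \<oplus> n \<otimes> \<one>) \<otimes> x b"
          using f(1) d n xb by (intro twist_rmult) auto
        also have "?Q (d \<oplus> n \<otimes> \<one>) = ?Q d \<oplus> ?Q (n \<otimes> \<one>)"
          using f(1) d n xb by (intro twist_add) auto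
        also have "?Q (n \<otimes> \<one>) = n \<otimes> ?Q \<one>"
          using f(1) Y(2) xb by (intro twist_center) auto
        finally show ?thesis .
      qed
      ultimately have "(?Q d \<oplus> n \<otimes> ?Q \<one>) \<otimes> x b \<in> center_span (x b) m"
        by simp
      \<comment> \<open>Inside the span \<open>x b\<close> can be divided out and
        \<open>n f'(x b)\<close> subtracted, which leaves the derivative in the direction
        \<open>[a, w]\<close>.\<close>
      moreover have "inv (x b) \<in> center_span (x b) m"
        by (rule inv_mem_subalgebra[OF xb x(2)[OF b] center_span_self[OF rel]
              center_subset_center_span[OF rel] center_span_add[OF rel] center_span_mult[OF rel]]) auto
      ultimately have "(?Q d \<oplus> n \<otimes> ?Q \<one>) \<otimes> x b \<otimes> inv (x b) \<in> center_span (x b) m"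
        by (simp add: center_span_mult[OF rel])
      moreover have Qc: "?Q d \<in> carrier R" "?Q \<one> \<in> carrier R"
        using f(1) d xb by (auto intro!: twist_closed)
      ultimately have *: "?Q d \<oplus> n \<otimes> ?Q \<one> \<in> center_span (x b) m"
        using n xb x(2)[OF b] by (simp add: m_assoc)
      have **: "\<ominus> n \<otimes> ?Q \<one> \<in> center_span (x b) m"
        using Y(2) twist_one_mem[OF rel] by (intro center_span_scale[OF rel]) auto
      have "?Q d = (?Q d \<oplus> n \<otimes> ?Q \<one>) \<oplus> \<ominus> n \<otimes> ?Q \<one>"
        using Qc n by algebra
      then show "?Q (a \<otimes> w \<ominus> w \<otimes> a) \<in> center_span (x b) m"
        using center_span_add[OF rel * **] by (simp add: d_def)
    next
      show "\<not> maximal_subfield (center_adjoin R (x b)) R"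
        using nmax[OF b] x_eq[OF b] by simp
    qed auto
    then have "a \<otimes> (a \<otimes> e b) = a \<otimes> (e b \<otimes> a)"
      unfolding x_def using a(1) e(1)[OF b] by (simp add: m_assoc)
    then show ?thesis
      using mult_left_cancel[OF a(1) _ _ a0] a(1) e(1)[OF b] by simp
  qed
  define g where "g = e b0"
  have g: "g \<in> carrier R"
    using e(1)[OF b0] by (simp add: g_def)
  have gnc: "g \<notin> ring_center R"
  proof
    assume gc: "g \<in> ring_center R"
    have "g \<otimes> b0 = b0 \<otimes> s"
      using b0 s by (simp add: g_def e_def m_assoc)
    then have "b0 \<otimes> g = b0 \<otimes> s"
      using ring_center_comm[OF gc b0(1)] by simp
    then have "s \<in> ring_center R"
      using mult_left_cancel[OF b0(1) g s(1) b0(2)] gc by simp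
    then have "inv s \<in> ring_center R"
      using center_inv s(2) by blast
    then show False
      using a inv_inv[OF a(1) a0] by (simp add: s_def)
  qed
  obtain y where y: "y \<in> carrier R" "a \<otimes> y \<noteq> y \<otimes> a" "g \<otimes> y \<noteq> y \<otimes> g"
    by (rule not_union_of_two_commutants[OF a g gnc])
  obtain Y n E where Y: "poly_on (ring_center R) Y" "finite E"
    "\<And>t. t \<in> ring_center R \<Longrightarrow> t \<notin> E \<Longrightarrow> \<one> \<oplus> t \<otimes> y \<noteq> \<zero>"
    "\<And>t k. t \<in> ring_center R \<Longrightarrow> t \<notin> E \<Longrightarrow> indep k (\<lambda>i. (x b0 \<oplus> t \<otimes> Y t) [^] i) \<Longrightarrow>
      indep k (\<lambda>i. x ((\<one> \<oplus> t \<otimes> y) \<otimes> b0) [^] i)"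
    using curve[OF b0 y(1)] by blast
  define E' where "E' = E \<union> {t \<in> ring_center R. \<not> indep m (\<lambda>i. (x b0 \<oplus> t \<otimes> Y t) [^] i)}"
  have "poly_on (ring_center R) (\<lambda>t. x b0 \<oplus> t \<otimes> Y t)"
    using x(1)[OF b0] by (intro center_poly_on_add center_poly_on_mult center_poly_on_const center_poly_on_id Y(1))
  moreover have "indep m (\<lambda>i. (x b0 \<oplus> \<zero> \<otimes> Y \<zero>) [^] i)"
    using x(1)[OF b0] center_poly_on_closed[OF Y(1), of \<zero>] ind0 by simp
  ultimately have "finite {t \<in> ring_center R. \<not> indep m (\<lambda>i. (x b0 \<oplus> t \<otimes> Y t) [^] i)}"
    using indep_generic[of m "\<lambda>i t. (x b0 \<oplus> t \<otimes> Y t) [^] i"] center_poly_on_pow by simp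
  then have E': "finite E'"
    using Y(2) by (simp add: E'_def)
  \<comment> \<open>The witness is \<open>h = u g u^-1\<close> with \<open>u = 1 + t y\<close>: the
    equation is \<open>h u = u g\<close> expanded, and \<open>h\<close> commutes with
    \<open>a\<close> because the corresponding commutator still has degree \<open>m\<close>.\<close>
  have good: "\<exists>h \<in> carrier R. a \<otimes> h = h \<otimes> a \<and> h \<oplus> t \<otimes> (h \<otimes> y) = g \<oplus> t \<otimes> (y \<otimes> g)"
    if t: "t \<in> ring_center R" "t \<notin> E'" for t
  proof -
    define u where "u = \<one> \<oplus> t \<otimes> y"
    have tE: "t \<notin> E" and ind: "indep m (\<lambda>i. (x b0 \<oplus> t \<otimes> Y t) [^] i)"
      using t by (auto simp: E'_def)
    have tc: "t \<in> carrier R"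
      using t(1) by simp
    have u: "u \<in> carrier R" "u \<noteq> \<zero>"
      using Y(3)[OF t(1) tE] tc y(1) by (auto simp: u_def)
    have ub: "u \<otimes> b0 \<in> carrier R" "u \<otimes> b0 \<noteq> \<zero>"
      using u b0 by (auto simp: mult_eq_zero)
    define h where "h = e (u \<otimes> b0)"
    have h: "h \<in> carrier R"
      using e(1)[OF ub] by (simp add: h_def)
    have "a \<otimes> h = h \<otimes> a"
      unfolding h_def using comm[OF ub] Y(4)[OF t(1) tE ind] by (simp add: u_def)
    moreover have "h \<otimes> u = u \<otimes> g"
      using e_mult[OF b0 u] by (simp add: h_def g_def)
    then have "h \<oplus> t \<otimes> (h \<otimes> y) = g \<oplus> t \<otimes> (y \<otimes> g)"
      using h g y(1) tc center_lcomm[OF t(1) h y(1)] by (simp add: u_def l_distr r_distr m_assoc)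
    ultimately show ?thesis
      using h by blast
  qed
  obtain t where t: "t \<in> ring_center R" "t \<notin> E'" "t \<noteq> \<zero>"
    by (rule generic_nonzero[OF inf E'])
  obtain r where r: "r \<in> ring_center R" "r \<notin> insert t E'" "r \<noteq> \<zero>"
    by (rule generic_nonzero[OF inf finite.insertI[OF E']])
  have tr: "t \<in> carrier R" "r \<in> carrier R" "r \<notin> E'" "r \<noteq> t"
    using t r by auto
  obtain h where h: "h \<in> carrier R" "a \<otimes> h = h \<otimes> a" "h \<oplus> t \<otimes> (h \<otimes> y) = g \<oplus> t \<otimes> (y \<otimes> g)"
    using good[OF t(1,2)] by blast
  obtain k where k: "k \<in> carrier R" "a \<otimes> k = k \<otimes> a" "k \<oplus> r \<otimes> (k \<otimes> y) = g \<oplus> r \<otimes> (y \<otimes> g)"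
    using good[OF r(1) tr(3)] by blast
  have ag: "a \<otimes> g = g \<otimes> a"
    using comm[OF b0 ind0] by (simp add: g_def)
  define q where "q = t \<otimes> r"
  have q: "q \<in> ring_center R" "q \<in> carrier R" "q \<noteq> \<zero>" "r \<otimes> t = q"
    using t r tr ring_center_comm[OF t(1) tr(2)] by (auto simp: q_def mult_eq_zero)
  \<comment> \<open>Taking \<open>r\<close> times the relation for \<open>t\<close> minus
    \<open>t\<close> times the relation for \<open>r\<close> cancels the terms with
    \<open>y g\<close>; only terms with \<open>y\<close> on the right of \<open>h\<close> and
    \<open>k\<close> are left.\<close>
  have "r \<otimes> (h \<oplus> t \<otimes> (h \<otimes> y)) \<ominus> t \<otimes> (k \<oplus> r \<otimes> (k \<otimes> y))
      = r \<otimes> (g \<oplus> t \<otimes> (y \<otimes> g)) \<ominus> t \<otimes> (g \<oplus> r \<otimes> (y \<otimes> g))"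
    using h(3) k(3) by simp
  moreover have "r \<otimes> (h \<oplus> t \<otimes> (h \<otimes> y)) \<ominus> t \<otimes> (k \<oplus> r \<otimes> (k \<otimes> y))
      = (r \<otimes> h \<ominus> t \<otimes> k) \<oplus> ((r \<otimes> t) \<otimes> (h \<otimes> y) \<ominus> (t \<otimes> r) \<otimes> (k \<otimes> y))"
    using h(1) k(1) tr(1,2) y(1) by algebra
  moreover have "r \<otimes> (g \<oplus> t \<otimes> (y \<otimes> g)) \<ominus> t \<otimes> (g \<oplus> r \<otimes> (y \<otimes> g))
      = (r \<otimes> g \<ominus> t \<otimes> g) \<oplus> ((r \<otimes> t) \<otimes> (y \<otimes> g) \<ominus> (t \<otimes> r) \<otimes> (y \<otimes> g))"
    using g tr(1,2) y(1) by algebra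
  ultimately have "(r \<otimes> h \<ominus> t \<otimes> k) \<oplus> (q \<otimes> (h \<otimes> y) \<ominus> q \<otimes> (k \<otimes> y))
      = (r \<otimes> g \<ominus> t \<otimes> g) \<oplus> (q \<otimes> (y \<otimes> g) \<ominus> q \<otimes> (y \<otimes> g))"
    unfolding q(4) q_def[symmetric] by simp
  also have "\<dots> = r \<otimes> g \<ominus> t \<otimes> g"
    using g tr(1,2) y(1) q(2) by (simp add: a_minus_def r_neg)
  finally have key: "(r \<otimes> h \<ominus> t \<otimes> k) \<oplus> (q \<otimes> (h \<otimes> y) \<ominus> q \<otimes> (k \<otimes> y)) = r \<otimes> g \<ominus> t \<otimes> g" .
  \<comment> \<open>If \<open>h = k\<close>, then \<open>r \<noteq> t\<close> gives
    \<open>h = g\<close>, so \<open>y\<close> commutes with \<open>g\<close>. Otherwise the relation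
    can be solved for \<open>y\<close> within the centralizer of \<open>a\<close>.\<close>
  show False
  proof (cases "h = k")
    case True
    have "h \<otimes> y \<in> carrier R"
      using h(1) y(1) by simp
    then have "r \<otimes> h \<ominus> t \<otimes> h = r \<otimes> g \<ominus> t \<otimes> g"
      using key h(1) tr(1,2) q(2) unfolding True[symmetric] by (simp add: a_minus_def r_neg)
    then have "(r \<ominus> t) \<otimes> h = (r \<ominus> t) \<otimes> g"
      using h(1) g tr(1,2) by (simp add: a_minus_def l_distr l_minus)
    moreover have "r \<ominus> t \<noteq> \<zero>"
      using tr by simp
    ultimately have "h = g"
      using mult_left_cancel[of "r \<ominus> t" h g] h(1) g tr(1,2) by simp
    then have "t \<otimes> (g \<otimes> y) = t \<otimes> (y \<otimes> g)"
      using h(3) g tr(1) y(1) by simp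
    then show False
      using mult_left_cancel[OF tr(1) _ _ t(3)] g y by simp
  next
    case False
    define p where "p = q \<otimes> (h \<ominus> k)"
    define w where "w = r \<otimes> g \<ominus> t \<otimes> g \<ominus> (r \<otimes> h \<ominus> t \<otimes> k)"
    have pc: "p \<in> carrier R" "p \<noteq> \<zero>"
      using False h(1) k(1) q by (auto simp: p_def mult_eq_zero)
    have "p \<otimes> y = w"
    proof -
      have "p \<otimes> y = ((r \<otimes> h \<ominus> t \<otimes> k) \<oplus> (q \<otimes> (h \<otimes> y) \<ominus> q \<otimes> (k \<otimes> y))) \<ominus> (r \<otimes> h \<ominus> t \<otimes> k)"
        unfolding p_def using h(1) k(1) q(2) tr(1,2) y(1) by algebra
      then show ?thesis
        unfolding key w_def .
    qed
    then have "y = inv p \<otimes> w"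
      using inv_cancel(1)[OF pc y(1)] by simp
    moreover have ca: "{a} \<subseteq> carrier R"
      using a(1) by simp
    have "h \<in> commutant {a}" "k \<in> commutant {a}" "g \<in> commutant {a}"
      using h(1,2) k(1,2) g ag by (auto intro: commutantI)
    then have "p \<in> commutant {a}" "w \<in> commutant {a}"
      unfolding p_def w_def using t(1) r(1) q(1) center_commutant[OF _ ca]
      by (auto intro!: commutant_mult[OF ca] commutant_diff[OF ca])
    then have "inv p \<otimes> w \<in> commutant {a}"
      using commutant_inv[OF ca _ pc(2)] commutant_mult[OF ca] by blast
    ultimately have "y \<otimes> a = a \<otimes> y"
      using commutant_comm[of y "{a}" a] by simp
    then show False
      using y(2) by simp
  qed
qed

end

section \<open>Wedderburn's little theorem\<close>

context ring
begin

lemma finite_subfield_generator: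
  assumes K: "subfield K R" and fin: "finite K"
  obtains x where "x \<in> K" "x \<noteq> \<zero>" "\<And>y. y \<in> K \<Longrightarrow> y \<noteq> \<zero> \<Longrightarrow> \<exists>i::nat. y = x [^] i"
    "\<And>i::nat. x [^] i = \<one> \<longleftrightarrow> (card K - 1) dvd i"
proof -
  interpret K: field "R\<lparr>carrier := K\<rparr>"
    using subfield_iff(2)[OF K] .
  let ?G = "Multiplicative_Group.mult_of (R\<lparr>carrier := K\<rparr>)"
  interpret G: group ?G
    by (rule K.field_mult_group)
  have pow: "y [^]\<^bsub>?G\<^esub> (i::nat) = y [^] i" for y i
    by (simp add: Multiplicative_Group.nat_pow_mult_of nat_pow_def)
  have pow': "y [^]\<^bsub>R\<lparr>carrier := K\<rparr>\<^esub> (i::nat) = y [^] i" for y i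
    by (simp add: nat_pow_def)
  have fin': "finite (carrier ?G)"
    using fin by simp
  obtain x where x: "x \<in> carrier ?G" "carrier ?G = {x [^]\<^bsub>R\<lparr>carrier := K\<rparr>\<^esub> i | i::nat. i \<in> UNIV}"
    using K.finite_field_mult_group_has_gen fin by auto
  then have gen: "carrier ?G = {x [^]\<^bsub>?G\<^esub> i | i::nat. i \<in> UNIV}"
    by (simp add: pow pow')
  have "card (carrier ?G) \<le> G.ord x"
  proof -
    have "carrier ?G = (\<lambda>i. x [^]\<^bsub>?G\<^esub> i) ` {0..G.ord x - 1}"
      using gen G.ord_elems[OF fin' x(1)] by auto
    then have "card (carrier ?G) \<le> card {0..G.ord x - 1}"
      by (metis card_image_le finite_atLeastAtMost)
    then show ?thesis
      using G.ord_ge_1[OF fin' x(1)] by simp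
  qed
  moreover have "G.ord x \<le> card (carrier ?G)"
    using G.ord_le_group_order[OF fin' x(1)] by (simp add: order_def)
  moreover have "card (carrier ?G) = card K - 1"
    using fin subringE(2)[OF subfieldE(1)[OF K]] by simp
  ultimately have ord: "G.ord x = card K - 1"
    by simp
  show thesis
  proof (rule that[of x])
    show "x \<in> K" "x \<noteq> \<zero>"
      using x(1) by auto
    show "\<exists>i::nat. y = x [^] i" if "y \<in> K" "y \<noteq> \<zero>" for y
    proof -
      have "y \<in> carrier ?G"
        using that by simp
      then show ?thesis
        unfolding gen by (auto simp: pow)
    qed
    show "x [^] i = \<one> \<longleftrightarrow> (card K - 1) dvd i" for i :: nat
      using G.pow_eq_id[OF x(1), of i] by (simp add: pow ord)
  qed
qed

lemma semiconjugate_pow: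
  assumes "v \<in> carrier R" "y \<in> carrier R" "z \<in> carrier R" "v \<otimes> y = z \<otimes> v"
  shows "v \<otimes> y [^] (j::nat) = z [^] j \<otimes> v"
proof (induction j)
  case (Suc j)
  have "v \<otimes> y [^] Suc j = (v \<otimes> y [^] j) \<otimes> y"
    using assms by (simp add: m_assoc)
  also have "\<dots> = z [^] j \<otimes> (v \<otimes> y)"
    unfolding Suc using assms by (simp add: m_assoc)
  also have "\<dots> = z [^] Suc j \<otimes> v"
    unfolding assms(4) using assms by (simp add: m_assoc)
  finally show ?case .
qed (use assms in simp)

text \<open>Conjugation by \<open>v\<close> acts on powers of \<open>x\<close> as the
  \<open>q\<close>-th power map, so conjugation by \<open>v^i\<close> acts as its
  \<open>i\<close>-th iterate.\<close>

lemma semiconjugate_iterate: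
  assumes "v \<in> carrier R" "x \<in> carrier R" "v \<otimes> x = x [^] (q::nat) \<otimes> v"
  shows "v [^] (i::nat) \<otimes> x [^] (j::nat) = (x [^] j) [^] (q ^ i) \<otimes> v [^] i"
proof (induction i)
  case (Suc i)
  have "v [^] Suc i \<otimes> x [^] j = v [^] i \<otimes> (v \<otimes> x [^] j)"
    using assms by (simp add: m_assoc)
  also have "v \<otimes> x [^] j = (x [^] q) [^] j \<otimes> v"
    using assms by (intro semiconjugate_pow) auto
  also have "(x [^] q) [^] j = (x [^] j) [^] q"
    using assms by (simp add: nat_pow_pow mult.commute)
  also have "v [^] i \<otimes> ((x [^] j) [^] q \<otimes> v) = (v [^] i \<otimes> (x [^] j) [^] q) \<otimes> v"
    using assms by (simp add: m_assoc)
  also have "v [^] i \<otimes> (x [^] j) [^] q = ((x [^] j) [^] (q ^ i)) [^] q \<otimes> v [^] i"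
    using assms Suc by (intro semiconjugate_pow) auto
  finally show ?case
    using assms by (simp add: nat_pow_pow m_assoc mult_ac)
qed (use assms in simp)

lemma psum_geometric:
  assumes "v \<in> carrier R"
  shows "(v \<ominus> \<one>) \<otimes> psum (\<lambda>i. v [^] i) n = v [^] n \<ominus> \<one>"
proof (induction n)
  case (Suc n)
  have p: "psum (\<lambda>i. v [^] i) n \<in> carrier R"
    using assms by (intro psum_closed) auto
  have "(v \<ominus> \<one>) \<otimes> psum (\<lambda>i. v [^] i) (Suc n) = (v [^] n \<ominus> \<one>) \<oplus> (v \<ominus> \<one>) \<otimes> v [^] n"
    using assms p Suc by (simp add: r_distr)
  also have "(v \<ominus> \<one>) \<otimes> v [^] n = v [^] Suc n \<ominus> v [^] n"
    using assms by (simp add: a_minus_def l_distr l_minus nat_pow_comm[of v 1 n, simplified])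
  also have "(v [^] n \<ominus> \<one>) \<oplus> (v [^] Suc n \<ominus> v [^] n) = v [^] Suc n \<ominus> \<one>"
    using nat_pow_closed[OF assms] one_closed by algebra
  finally show ?case .
qed (use assms in \<open>simp add: a_minus_def r_neg\<close>)

text \<open>The leading terms cancel, so the degree bound is one below the exponent. This gap is
  what lets exactly \<open>q\<close> roots suffice for the additivity of the \<open>q\<close>-th
  power.\<close>

lemma polyfun_power_difference:
  assumes S: "S \<subseteq> carrier R" and comm: "S \<subseteq> commutant S" and v: "v \<in> commutant S"
  shows "polyfun S k (\<lambda>t. (t \<oplus> v) [^] Suc k \<ominus> t [^] Suc k)"
proof (induction k)
  note vc = commutant_closed[OF v]
  case 0
  have "polyfun S 0 (\<lambda>_. v)"
    using v by auto
  moreover have "(t \<oplus> v) [^] Suc 0 \<ominus> t [^] Suc 0 = v" if "t \<in> S" for t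
  proof -
    have tc: "t \<in> carrier R"
      using that S by blast
    then have "t \<oplus> v \<ominus> t = v"
      using vc by algebra
    then show ?thesis
      using tc vc by simp
  qed
  ultimately show ?case
    by (rule polyfun_cong)
next
  note vc = commutant_closed[OF v]
  case (Suc k)
  have "polyfun S 1 (\<lambda>t. t \<oplus> v)"
    by (rule polyfun_add[OF S comm polyfun_id[OF S comm] polyfun_const[OF S comm v]])
  then have "polyfun S (Suc k) (\<lambda>t. (t \<oplus> v) [^] Suc k)"
    using polyfun_pow[OF S comm, of 1 _ "Suc k"] by simp
  then have "polyfun S (Suc k) (\<lambda>t. v \<otimes> (t \<oplus> v) [^] Suc k)"
    by (rule polyfun_smult[OF S comm v])
  then have "polyfun S (Suc k)
      (\<lambda>t. t \<otimes> ((t \<oplus> v) [^] Suc k \<ominus> t [^] Suc k) \<oplus> v \<otimes> (t \<oplus> v) [^] Suc k)"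
    by (rule polyfun_add[OF S comm polyfun_shift[OF S comm Suc]])
  moreover have "(t \<oplus> v) [^] Suc (Suc k) \<ominus> t [^] Suc (Suc k)
      = t \<otimes> ((t \<oplus> v) [^] Suc k \<ominus> t [^] Suc k) \<oplus> v \<otimes> (t \<oplus> v) [^] Suc k" if t: "t \<in> S" for t
  proof -
    define P where "P = (t \<oplus> v) [^] Suc k"
    define T where "T = t [^] Suc k"
    have tc: "t \<in> carrier R"
      using t S by blast
    have cl: "P \<in> carrier R" "T \<in> carrier R"
      using tc vc by (auto simp: P_def T_def)
    have PT: "(t \<oplus> v) [^] Suc (Suc k) = P \<otimes> (t \<oplus> v)" "t [^] Suc (Suc k) = T \<otimes> t"
      by (simp_all add: P_def T_def)
    have "P \<otimes> (t \<oplus> v) = (t \<oplus> v) \<otimes> P" "T \<otimes> t = t \<otimes> T"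
      using tc vc nat_pow_comm[of "t \<oplus> v" "Suc k" 1] nat_pow_comm[of t "Suc k" 1]
      by (auto simp: P_def T_def)
    then have "(t \<oplus> v) [^] Suc (Suc k) \<ominus> t [^] Suc (Suc k) = (t \<oplus> v) \<otimes> P \<ominus> t \<otimes> T"
      unfolding PT by simp
    also have "\<dots> = t \<otimes> (P \<ominus> T) \<oplus> v \<otimes> P"
      using tc vc cl by algebra
    finally show ?thesis
      by (simp add: P_def T_def)
  qed
  ultimately show ?case
    by (rule polyfun_cong)
qed

end

context skew_field
begin

text \<open>The degree of \<open>(t + v)^q - t^q - v^q\<close> in \<open>t\<close> is less than \<open>q\<close>. Hence this difference
  vanishes as soon as it has the \<open>q\<close> elements of \<open>Z\<close> as roots, first for \<open>v \<in> Z\<close> and then, with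
  the roles of \<open>t\<close> and \<open>v\<close> exchanged, for all \<open>v \<in> K\<close>.\<close>

lemma frobenius_add:
  assumes K: "K \<subseteq> carrier R" "K \<subseteq> commutant K" "\<And>u v. u \<in> K \<Longrightarrow> v \<in> K \<Longrightarrow> u \<oplus> v \<in> K"
    and Z: "Z \<subseteq> K" "finite Z" "Z \<noteq> {}" "\<And>u v. u \<in> Z \<Longrightarrow> v \<in> Z \<Longrightarrow> u \<oplus> v \<in> Z"
    and frob: "\<And>z. z \<in> Z \<Longrightarrow> z [^] card Z = z"
    and uv: "u \<in> K" "v \<in> K"
  shows "(u \<oplus> v) [^] card Z = u [^] card Z \<oplus> v [^] card Z"
proof -
  define q where "q = card Z"
  define r where "r = q - 1"
  have q: "q = Suc r"
    using Z(2,3) by (simp add: q_def r_def card_gt_0_iff)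
  define g where "g = (\<lambda>v t. ((t \<oplus> v) [^] q \<ominus> t [^] q) \<oplus> \<ominus> (v [^] q))"
  have cl: "x \<in> carrier R" if "x \<in> K" for x
    using that K(1) by blast
  have poly: "polyfun K r (g v)" if v: "v \<in> K" for v
  proof -
    have vK: "v \<in> commutant K"
      using v K(2) by blast
    have "\<ominus> (v [^] q) \<in> commutant K"
      by (intro commutant_neg[OF K(1)] commutant_pow[OF K(1)] vK)
    from polyfun_add[OF K(1,2) polyfun_power_difference[OF K(1,2) vK, of r] polyfun_const[OF K(1,2) this]]
    show ?thesis
      by (simp add: g_def q)
  qed
  have zero: "g v t = \<zero>" if v: "v \<in> K" and "\<And>c. c \<in> Z \<Longrightarrow> g v c = \<zero>" and t: "t \<in> K" for v t
    by (rule polyfun_roots[OF K(1,2) poly[OF v] Z(1) _ that(2) t]) (simp add: q q_def[symmetric])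
  have sym: "g v t = g t v" if "v \<in> K" "t \<in> K" for v t
    unfolding g_def using cl[OF that(1)] cl[OF that(2)] by (simp add: a_minus_def a_ac)
  have gZ: "g v t = \<zero>" if "v \<in> Z" "t \<in> K" for v t
  proof (rule zero)
    fix c assume c: "c \<in> Z"
    have vc: "v \<in> carrier R" "c \<in> carrier R"
      using that(1) c Z(1) cl by auto
    have "g v c = c \<oplus> v \<ominus> c \<oplus> \<ominus> v"
      using frob[OF that(1)] frob[OF c] frob[OF Z(4)[OF c that(1)]] by (simp add: g_def q_def)
    also have "\<dots> = \<zero>"
      using vc by algebra
    finally show "g v c = \<zero>" .
  qed (use that Z(1) in auto)
  have "g v u = \<zero>"
  proof (rule zero[OF uv(2) _ uv(1)])
    fix c assume "c \<in> Z"
    then show "g v c = \<zero>"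
      using sym[of v c] gZ[of c v] uv Z(1) by auto
  qed
  moreover have "(u \<oplus> v) [^] q = g v u \<oplus> (u [^] q \<oplus> v [^] q)"
  proof -
    have "(u \<oplus> v) [^] q \<in> carrier R" "u [^] q \<in> carrier R" "v [^] q \<in> carrier R"
      using uv cl by auto
    then show ?thesis
      unfolding g_def by algebra
  qed
  ultimately show ?thesis
    using uv cl by (simp add: q_def)
qed

end

section \<open>Conjugacy of roots and independence of conjugations\<close>

context skew_field
begin

lemma twist_lmult:
  assumes f: "\<And>i. i < m \<Longrightarrow> f i \<in> ring_center R"
    and x: "x \<in> carrier R" "w \<in> carrier R" "d \<in> carrier R"
  shows "twist f m x w (x \<otimes> d) = x \<otimes> twist f m x w d"
proof -
  have h: "horner f m x j \<in> carrier R" for j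
    using f x(1) by (intro horner_closed) auto
  have hx: "horner f m x (Suc j) \<otimes> x = x \<otimes> horner f m x (Suc j)" if "j < m" for j
  proof -
    have "f i \<in> commutant {x}" if "i < m" for i
      using f[OF that] x(1) by (intro center_commutant) auto
    then have "horner f m x (Suc j) \<in> commutant {x}"
      unfolding horner_def using x(1) that
      by (intro commutant_add commutant_psum commutant_mult commutant_pow)
        (auto simp: commutant_self)
    then show ?thesis
      using commutant_comm[of _ "{x}" x] by simp
  qed
  have "horner f m x (Suc j) \<otimes> (x \<otimes> d) \<otimes> w [^] j = x \<otimes> (horner f m x (Suc j) \<otimes> d \<otimes> w [^] j)"
    if j: "j < m" for j
  proof -
    have "horner f m x (Suc j) \<otimes> (x \<otimes> d) \<otimes> w [^] j = (horner f m x (Suc j) \<otimes> x) \<otimes> (d \<otimes> w [^] j)"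
      using h x by (simp add: m_assoc)
    then show ?thesis
      unfolding hx[OF j] using h x by (simp add: m_assoc)
  qed
  then have "twist f m x w (x \<otimes> d) = psum (\<lambda>j. x \<otimes> (horner f m x (Suc j) \<otimes> d \<otimes> w [^] j)) m"
    unfolding twist_def by (rule psum_cong)
  also have "\<dots> = x \<otimes> twist f m x w d"
    unfolding twist_def using h x by (intro psum_lmult[symmetric]) auto
  finally show ?thesis .
qed

text \<open>A special case of the Skolem--Noether theorem.\<close>

lemma roots_conjugate:
  assumes f: "\<And>i. i < m \<Longrightarrow> f i \<in> ring_center R"
    and x: "x \<in> carrier R" "horner f m x 0 = \<zero>"
    and w: "w \<in> carrier R" "horner f m w 0 = \<zero>" "indep m (\<lambda>i. w [^] i)"
  obtains b where "b \<in> carrier R" "b \<noteq> \<zero>" "b \<otimes> x = w \<otimes> b"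
proof -
  have m: "0 < m"
    using x(2) one_not_zero by (cases m) (auto simp: horner_def)
  have h: "horner f m x j \<in> carrier R" for j
    using f x(1) by (intro horner_closed) auto
  \<comment> \<open>The last coefficient of \<open>twist\<close> is
    \<open>horner f m x m = \<one>\<close> and the powers of \<open>w\<close> are independent, so
    \<open>twist f m x w\<close> cannot vanish identically.\<close>
  obtain d where d: "d \<in> carrier R" "twist f m x w d \<noteq> \<zero>"
  proof (rule ccontr)
    assume "\<not> thesis"
    then have "psum (\<lambda>j. horner f m x (Suc j) \<otimes> d \<otimes> w [^] j) m = \<zero>" if "d \<in> carrier R" for d
      using that \<open>\<And>d. \<lbrakk>d \<in> carrier R; twist f m x w d \<noteq> \<zero>\<rbrakk> \<Longrightarrow> thesis\<close> unfolding twist_def by blast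
    then have "horner f m x (Suc (m - 1)) = \<zero>"
      using m w(1) h
      by (intro indep_coeffs_zero[OF w(3), where A = "\<lambda>j. horner f m x (Suc j)" and i = "m - 1"]) auto
    moreover have "horner f m x m = \<one>"
      using f by (rule horner_top)
    ultimately show False
      using m one_not_zero by simp
  qed
  define e where "e = twist f m x w d"
  have e: "e \<in> carrier R" "e \<noteq> \<zero>"
    using f x(1) w(1) d by (auto simp: e_def intro!: twist_closed)
  have "twist f m x w (d \<otimes> w \<ominus> x \<otimes> d) = d \<otimes> horner f m w 0 \<ominus> horner f m x 0 \<otimes> d"
    using f x(1) w(1) d(1) by (intro twist_telescope) auto
  also have "\<dots> = \<zero>"
    using x(2) w(2) d(1) by (simp add: a_minus_def)
  finally have "twist f m x w (d \<otimes> w) \<ominus> twist f m x w (x \<otimes> d) = \<zero>"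
    using f x(1) w(1) d(1) by (subst twist_diff[symmetric]) auto
  moreover have "twist f m x w (d \<otimes> w) = e \<otimes> w"
    unfolding e_def using f x(1) w(1) d(1) by (intro twist_rmult) auto
  moreover have "twist f m x w (x \<otimes> d) = x \<otimes> e"
    unfolding e_def using f x(1) w(1) d(1) by (intro twist_lmult) auto
  ultimately have ew: "e \<otimes> w = x \<otimes> e"
    using e x(1) w(1) by simp
  have "inv e \<otimes> x = inv e \<otimes> (x \<otimes> e) \<otimes> inv e"
    using e x(1) by (simp add: m_assoc)
  also have "\<dots> = w \<otimes> inv e"
    unfolding ew[symmetric] using e w(1) by (simp add: m_assoc)
  finally show thesis
    using that[of "inv e"] e inv_nonzero[OF e] by simp
qed

text \<open>Dedekind independence of the distinct conjugations \<open>x \<mapsto> x^(q^i)\<close>.\<close>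

lemma semiconjugate_powers_independent:
  assumes K: "K \<subseteq> carrier R" "K \<subseteq> commutant K"
      "\<And>u v. u \<in> K \<Longrightarrow> v \<in> K \<Longrightarrow> u \<otimes> v \<in> K" "\<And>u v. u \<in> K \<Longrightarrow> v \<in> K \<Longrightarrow> u \<ominus> v \<in> K"
    and x: "x \<in> carrier R" "\<And>i::nat. x [^] i \<in> K"
    and v: "v \<in> carrier R" "v \<noteq> \<zero>" "v \<otimes> x = x [^] (q::nat) \<otimes> v"
    and dist: "\<And>i k. i < k \<Longrightarrow> k < m \<Longrightarrow> x [^] (q ^ i) \<noteq> x [^] (q ^ k)"
    and n: "n \<le> m" and c: "\<And>i. i < n \<Longrightarrow> c i \<in> K" "psum (\<lambda>i. c i \<otimes> v [^] i) n = \<zero>" "j < n"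
  shows "c j = \<zero>"
  using n c
proof (induction n arbitrary: c j)
  case (Suc n)
  have cc: "c i \<in> carrier R" if "i < Suc n" for i
    using Suc.prems(2)[OF that] K(1) by blast
  define y where "y = (\<lambda>i::nat. x [^] (q ^ i))"
  have y: "y i \<in> K" "y i \<in> carrier R" for i
    using x by (auto simp: y_def)
  have vy: "v [^] i \<otimes> x = y i \<otimes> v [^] i" for i :: nat
    using semiconjugate_iterate[OF v(1) x(1) v(3), of i 1] x(1) by (simp add: y_def)
  have cy: "c i \<otimes> y k = y k \<otimes> c i" if "i < Suc n" for i k
    using K(2) commutant_comm[of "c i" K "y k"] Suc.prems(2)[OF that] y by blast
  \<comment> \<open>The relation times \<open>x\<close> on the right minus \<open>y n\<close> times
    the relation: the factor \<open>y i - y n\<close> kills the last term and is nonzero in all the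
    others.\<close>
  have "psum (\<lambda>i. (c i \<otimes> (y i \<ominus> y n)) \<otimes> v [^] i) (Suc n)
      = psum (\<lambda>i. (c i \<otimes> v [^] i) \<otimes> x \<ominus> y n \<otimes> (c i \<otimes> v [^] i)) (Suc n)"
  proof (rule psum_cong)
    fix i assume i: "i < Suc n"
    have "(c i \<otimes> v [^] i) \<otimes> x = c i \<otimes> (y i \<otimes> v [^] i)"
      using cc[OF i] v x by (simp add: m_assoc vy)
    moreover have "y n \<otimes> (c i \<otimes> v [^] i) = c i \<otimes> (y n \<otimes> v [^] i)"
      using cc[OF i] cy[OF i, of n] v y by (simp add: m_assoc[symmetric])
    ultimately show "(c i \<otimes> (y i \<ominus> y n)) \<otimes> v [^] i = (c i \<otimes> v [^] i) \<otimes> x \<ominus> y n \<otimes> (c i \<otimes> v [^] i)"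
      using cc[OF i] v y by (simp add: a_minus_def l_distr r_distr l_minus r_minus m_assoc)
  qed
  also have "\<dots> = psum (\<lambda>i. (c i \<otimes> v [^] i) \<otimes> x) (Suc n) \<ominus> psum (\<lambda>i. y n \<otimes> (c i \<otimes> v [^] i)) (Suc n)"
    using cc v x y by (intro psum_diff) auto
  also have "psum (\<lambda>i. (c i \<otimes> v [^] i) \<otimes> x) (Suc n) = psum (\<lambda>i. c i \<otimes> v [^] i) (Suc n) \<otimes> x"
    using cc v x by (intro psum_rmult[symmetric]) auto
  also have "psum (\<lambda>i. y n \<otimes> (c i \<otimes> v [^] i)) (Suc n) = y n \<otimes> psum (\<lambda>i. c i \<otimes> v [^] i) (Suc n)"
    using cc v y by (intro psum_lmult[symmetric]) auto
  finally have "psum (\<lambda>i. (c i \<otimes> (y i \<ominus> y n)) \<otimes> v [^] i) (Suc n) = \<zero>"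
    unfolding Suc.prems(3) using x y by (simp add: a_minus_def)
  moreover have "psum (\<lambda>i. (c i \<otimes> (y i \<ominus> y n)) \<otimes> v [^] i) n \<in> carrier R"
    using cc v y by (intro psum_closed) auto
  ultimately have rel: "psum (\<lambda>i. (c i \<otimes> (y i \<ominus> y n)) \<otimes> v [^] i) n = \<zero>"
    using cc[of n] v y by (simp add: a_minus_def r_neg)
  have small: "c i = \<zero>" if i: "i < n" for i
  proof -
    have "c i \<otimes> (y i \<ominus> y n) = \<zero>"
      using Suc.IH[of "\<lambda>i. c i \<otimes> (y i \<ominus> y n)" i] Suc.prems(1,2) rel K(3,4) y i by auto
    moreover have "y i \<noteq> y n"
      using dist[of i n] i Suc.prems(1) by (simp add: y_def)
    ultimately show ?thesis
      using cc[of i] y i by (simp add: mult_eq_zero)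
  qed
  show ?case
  proof (cases "j = n")
    case True
    have "psum (\<lambda>i. c i \<otimes> v [^] i) n = \<zero>"
      using small v by (intro psum_zero) auto
    then have "c n \<otimes> v [^] n = \<zero>"
      using Suc.prems(3) cc[of n] v by simp
    then show ?thesis
      using True cc[of n] v pow_nonzero[OF v(1,2)] by (simp add: mult_eq_zero)
  qed (use small Suc.prems(4) in auto)
qed auto

end

section \<open>Finite center: cardinalities\<close>

context centrally_finite_skew_field
begin

lemma finite_carrier:
  assumes "finite (ring_center R)"
  shows "finite (carrier R)"
proof -
  obtain n u where u: "\<And>i. i < n \<Longrightarrow> u i \<in> carrier R" "indep n u"
    "\<And>d. d \<in> carrier R \<Longrightarrow> \<exists>c. (\<forall>i<n. c i \<in> ring_center R) \<and> d = psum (\<lambda>i. c i \<otimes> u i) n"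
    by (rule center_basis) blast
  let ?C = "PiE {..<n} (\<lambda>_. ring_center R)"
  have "carrier R \<subseteq> (\<lambda>c. psum (\<lambda>i. c i \<otimes> u i) n) ` ?C"
  proof
    fix d assume "d \<in> carrier R"
    then obtain c where c: "\<And>i. i < n \<Longrightarrow> c i \<in> ring_center R" "d = psum (\<lambda>i. c i \<otimes> u i) n"
      using u(3) by blast
    have "d = psum (\<lambda>i. restrict c {..<n} i \<otimes> u i) n"
      unfolding c(2) by (intro psum_cong) auto
    moreover have "restrict c {..<n} \<in> ?C"
      using c(1) by auto
    ultimately show "d \<in> (\<lambda>c. psum (\<lambda>i. c i \<otimes> u i) n) ` ?C"
      by blast
  qed
  moreover have "finite ?C"
    using assms by (intro finite_PiE) auto
  ultimately show ?thesis
    by (rule finite_surj[rotated])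
qed

lemma card_center_span:
  assumes x: "x \<in> carrier R" and indep: "indep m (\<lambda>i. x [^] i)"
  shows "card (center_span x m) = card (ring_center R) ^ m"
proof -
  let ?C = "PiE {..<m} (\<lambda>_. ring_center R)"
  let ?F = "\<lambda>c. psum (\<lambda>i. c i \<otimes> x [^] i) m"
  have "inj_on ?F ?C"
  proof (rule inj_onI)
    fix c d assume c: "c \<in> ?C" and d: "d \<in> ?C" and eq: "?F c = ?F d"
    have cd: "c i \<in> ring_center R" "d i \<in> ring_center R" if "i < m" for i
      using c d that by auto
    have "psum (\<lambda>i. (c i \<ominus> d i) \<otimes> x [^] i) m = psum (\<lambda>i. c i \<otimes> x [^] i \<ominus> d i \<otimes> x [^] i) m"
      using cd x by (intro psum_cong) (simp add: a_minus_def l_distr l_minus)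
    also have "\<dots> = ?F c \<ominus> ?F d"
      using cd x by (intro psum_diff) auto
    also have "\<dots> = \<zero>"
    proof -
      have "?F d \<in> carrier R"
        using cd x by (intro psum_closed) auto
      then show ?thesis
        unfolding eq by (simp add: a_minus_def r_neg)
    qed
    finally have "c i \<ominus> d i = \<zero>" if "i < m" for i
      using indepD[OF indep, of "\<lambda>i. c i \<ominus> d i" i] cd that by auto
    then have "c i = d i" if "i < m" for i
      using cd that by simp
    then show "c = d"
      using c d by (intro PiE_ext[OF c d]) auto
  qed
  moreover have "center_span x m = ?F ` ?C"
  proof
    show "?F ` ?C \<subseteq> center_span x m"
      by (auto intro!: center_spanI)
    show "center_span x m \<subseteq> ?F ` ?C"
    proof
      fix y assume "y \<in> center_span x m"
      then obtain c where c: "\<And>i. i < m \<Longrightarrow> c i \<in> ring_center R" "y = ?F c"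
        by (rule center_spanE) blast
      have "y = ?F (restrict c {..<m})"
        unfolding c(2) by (intro psum_cong) auto
      moreover have "restrict c {..<m} \<in> ?C"
        using c(1) by auto
      ultimately show "y \<in> ?F ` ?C"
        by blast
    qed
  qed
  ultimately show ?thesis
    by (simp add: card_image card_PiE)
qed

end

lemma geometric_sum_nat: "((q::nat) - 1) * (\<Sum>i<m. q ^ i) = q ^ m - 1"
proof (cases q)
  case (Suc r)
  have "r * (\<Sum>i<m. Suc r ^ i) + 1 = Suc r ^ m"
    by (induction m) (auto simp: algebra_simps)
  then show ?thesis
    using Suc by (metis add_diff_cancel_right' diff_Suc_1)
qed (induction m; simp)

context centrally_finite_skew_field
begin

text \<open>Adjoining an element of its commutant keeps a commuting set commuting, so a maximal one
  is its own commutant. Maximality is taken among sets; that \<open>K\<close> is a field follows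
  from its being a commutant.\<close>

lemma maximal_commuting_set:
  assumes "finite (carrier R)"
  obtains K where "commutant K = K"
proof -
  let ?F = "{S. S \<subseteq> carrier R \<and> S \<subseteq> commutant S}"
  have "finite ?F"
    by (rule finite_subset[of _ "Pow (carrier R)"]) (use assms in auto)
  moreover have "{} \<in> ?F"
    by simp
  ultimately obtain K where K: "K \<in> ?F" "\<And>S. S \<in> ?F \<Longrightarrow> K \<subseteq> S \<Longrightarrow> K = S"
    using finite_has_maximal[of ?F] by (metis (no_types, lifting) empty_iff)
  have "z \<in> K" if z: "z \<in> commutant K" for z
  proof -
    have "insert z K \<subseteq> commutant (insert z K)"
    proof
      fix y assume y: "y \<in> insert z K"
      show "y \<in> commutant (insert z K)"
      proof (rule commutantI)
        show "y \<in> carrier R"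
          using y K(1) commutant_closed[OF z] by auto
        show "y \<otimes> s = s \<otimes> y" if s: "s \<in> insert z K" for s
        proof -
          consider "y = s" | "y = z" "s \<in> K" | "y \<in> K" "s = z" | "y \<in> K" "s \<in> K"
            using y s by blast
          then show ?thesis
          proof cases
            case 2
            then show ?thesis
              using commutant_comm[OF z, of s] by simp
          next
            case 3
            then show ?thesis
              using commutant_comm[OF z, of y] by metis
          next
            case 4
            then show ?thesis
              using K(1) commutant_comm[of y K s] by blast
          qed simp
        qed
      qed
    qed
    then have "insert z K \<in> ?F"
      using K(1) commutant_closed[OF z] by simp
    then show ?thesis
      using K(2)[of "insert z K"] by auto
  qed
  then show thesis
    using K(1) that[of K] by blast
qed

text \<open>Wedderburn's little theorem: in a finite \<open>R\<close> the \<open>q\<close>-Frobenius of a maximal subfield \<open>K\<close> over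
  the center is induced by conjugation with some \<open>b\<close>. As the norm of \<open>K\<close> is surjective, \<open>b\<close> can be
  rescaled to \<open>v\<close> with \<open>v\<^sup>m = 1\<close>, and then \<open>1 + v + \<dots> + v\<^sup>m\<^sup>-\<^sup>1 = 0\<close> contradicts Dedekind
  independence.\<close>

lemma infinite_center:
  assumes noncomm: "\<not> carrier R \<subseteq> ring_center R"
  shows "infinite (ring_center R)"
proof
  assume finZ: "finite (ring_center R)"
  define Z where "Z = ring_center R"
  define q where "q = card Z"
  have fin: "finite (carrier R)"
    by (rule finite_carrier[OF finZ])
  obtain K where K: "commutant K = K"
    by (rule maximal_commuting_set[OF fin])
  have Kc: "K \<subseteq> carrier R"
    using commutant_closed[of _ K] K by blast
  have Kcomm: "u \<otimes> v = v \<otimes> u" if "u \<in> K" "v \<in> K" for u v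
    using commutant_comm[of u K v] K that by simp
  have ZK: "Z \<subseteq> K"
    using center_commutant[OF _ Kc] K by (auto simp: Z_def)
  note Kring = commutant_zero[OF Kc, unfolded K] commutant_one[OF Kc, unfolded K]
    commutant_add[OF Kc, unfolded K] commutant_diff[OF Kc, unfolded K]
    commutant_mult[OF Kc, unfolded K] commutant_pow[OF Kc, unfolded K]
  have finK: "finite K"
    using Kc fin by (rule finite_subset)
  have subK: "subfield K R"
    using commutant_subfield[OF Kc] K Kcomm by simp
  have subZ: "subfield Z R"
    unfolding Z_def by (rule center_subfield)
  have Z01: "\<zero> \<in> Z" "\<one> \<in> Z"
    by (simp_all add: Z_def)
  have q2: "2 \<le> q"
    using card_mono[OF finZ, of "{\<zero>, \<one>}"] Z01 one_not_zero by (simp add: q_def Z_def)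
  have frob: "z [^] q = z" if z: "z \<in> Z" for z
  proof (cases "z = \<zero>")
    case True
    then show ?thesis
      using q2 by (cases q) auto
  next
    case False
    obtain g where g: "g \<in> Z" "g \<noteq> \<zero>" "\<And>y. y \<in> Z \<Longrightarrow> y \<noteq> \<zero> \<Longrightarrow> \<exists>i::nat. y = g [^] i"
      "\<And>i::nat. g [^] i = \<one> \<longleftrightarrow> (card Z - 1) dvd i"
      by (rule finite_subfield_generator[OF subZ finZ[folded Z_def]]) blast
    have gc: "g \<in> carrier R"
      using g(1) by (simp add: Z_def)
    obtain i :: nat where i: "z = g [^] i"
      using g(3)[OF z False] by blast
    have "g [^] (i * (q - 1)) = \<one>"
      using g(4) by (simp add: q_def)
    then have "z [^] (q - 1) = \<one>"
      using gc by (simp add: i nat_pow_pow)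
    moreover have "z [^] q = z [^] (q - 1) \<otimes> z"
      using q2 nat_pow_Suc[of z "q - 1"] by simp
    ultimately show ?thesis
      using z by (simp add: Z_def)
  qed
  have frob_add: "(u \<oplus> v) [^] q = u [^] q \<oplus> v [^] q" if "u \<in> K" "v \<in> K" for u v
    unfolding q_def
  proof (rule frobenius_add[of K Z u v])
    show "z [^] card Z = z" if "z \<in> Z" for z
      using frob[OF that] by (simp add: q_def)
    show "Z \<noteq> {}"
      using Z01 by blast
    show "s \<oplus> t \<in> Z" if "s \<in> Z" "t \<in> Z" for s t
      using that unfolding Z_def by simp
    show "K \<subseteq> commutant K"
      using K by simp
    show "finite Z"
      using finZ by (simp add: Z_def)
  qed (fact Kc ZK Kring(3) that)+
  have frob_psum: "psum h n [^] q = psum (\<lambda>i. h i [^] q) n" if "\<And>i. i < n \<Longrightarrow> h i \<in> K" for h n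
    using that
  proof (induction n)
    case 0
    then show ?case
      using q2 by (cases q) auto
  next
    case (Suc n)
    have "psum h n \<in> K"
      using commutant_psum[OF Kc, of n h] Suc.prems K by simp
    then show ?case
      using Suc frob_add by simp
  qed
  obtain x where x: "x \<in> K" "x \<noteq> \<zero>" and gen: "\<And>y. y \<in> K \<Longrightarrow> y \<noteq> \<zero> \<Longrightarrow> \<exists>i::nat. y = x [^] i"
    and ord: "\<And>i::nat. x [^] i = \<one> \<longleftrightarrow> (card K - 1) dvd i"
    by (rule finite_subfield_generator[OF subK finK]) blast
  have xc: "x \<in> carrier R"
    using x(1) Kc by blast
  have xK: "x [^] i \<in> K" for i :: nat
    using Kring(6)[OF x(1)] .
  obtain f m where ind: "indep m (\<lambda>i. x [^] i)" and f: "\<And>i. i < m \<Longrightarrow> f i \<in> ring_center R"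
    and root: "horner f m x 0 = \<zero>"
    by (rule relation_exists[OF xc]) blast
  note rel = xc ind f root
  have fZ: "f i \<in> Z" if "i < m" for i
    using f[OF that] by (simp add: Z_def)
  have Kspan: "K = center_span x m"
  proof
    show "center_span x m \<subseteq> K"
      using x(1) ZK Kring(3,5) unfolding Z_def by (intro center_span_subset) auto
    show "K \<subseteq> center_span x m"
    proof
      fix y assume y: "y \<in> K"
      show "y \<in> center_span x m"
      proof (cases "y = \<zero>")
        case True
        then show ?thesis
          using center_span_zero[OF rel] by auto
      next
        case False
        then obtain i :: nat where "y = x [^] i"
          using gen[OF y] by blast
        then show ?thesis
          using center_span_pow[OF rel, of i] by auto
      qed
    qed
  qed
  have cardK: "card K = q ^ m"
    unfolding Kspan q_def Z_def by (rule card_center_span[OF xc ind])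
  have ord': "x [^] i = \<one> \<longleftrightarrow> (q ^ m - 1) dvd i" for i :: nat
    using ord cardK by simp
  have pow_eq: "x [^] i = x [^] k \<Longrightarrow> i \<le> k \<Longrightarrow> (q ^ m - 1) dvd (k - i)" for i k :: nat
  proof -
    assume eq: "x [^] i = x [^] k" and le: "i \<le> k"
    have "x [^] i \<otimes> x [^] (k - i) = x [^] k"
      using nat_pow_mult[OF xc, of i "k - i"] le by simp
    then have "x [^] i \<otimes> x [^] (k - i) = x [^] i \<otimes> \<one>"
      using eq xc by simp
    then have "x [^] (k - i) = \<one>"
      using mult_left_cancel[of "x [^] i" "x [^] (k - i)" \<one>] xc pow_nonzero[OF xc x(2)] by simp
    then show ?thesis
      using ord' by blast
  qed
  have m0: "0 < m"
    using root one_not_zero by (cases m) (auto simp: horner_def)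
  \<comment> \<open>For \<open>m = 1\<close> the set \<open>K\<close> would be the center, whose
    commutant is everything; then \<open>commutant K = K\<close> makes the ring commutative.\<close>
  have m2: "2 \<le> m"
  proof (rule ccontr)
    assume "\<not> 2 \<le> m"
    then have "card K = card Z"
      using m0 cardK by (cases "m = 1") (auto simp: q_def)
    then have "K = Z"
      using card_subset_eq[OF finK ZK] by simp
    then have "carrier R \<subseteq> Z"
      using K commutant_center by (simp add: Z_def)
    then show False
      using noncomm by (simp add: Z_def)
  qed
  define w where "w = x [^] q"
  have wc: "w \<in> carrier R"
    using xc by (simp add: w_def)
  have frob_term: "(c \<otimes> x [^] i) [^] q = c \<otimes> w [^] i" if "c \<in> Z" for c and i :: nat
  proof -
    have c: "c \<in> carrier R"
      using that by (simp add: Z_def)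
    have "(c \<otimes> x [^] i) [^] q = c [^] q \<otimes> (x [^] i) [^] q"
      using ring_center_comm[OF that[unfolded Z_def], of "x [^] i"] c xc by (intro pow_mult_distrib) auto
    then show ?thesis
      using frob[OF that] xc by (simp add: w_def nat_pow_pow mult.commute)
  qed
  have termK: "c \<otimes> x [^] i \<in> K" if "c \<in> Z" for c and i :: nat
    using that ZK xK Kring(5) by blast
  \<comment> \<open>The \<open>q\<close>-th power map is additive on \<open>K\<close> and fixes the
    center, so it carries the relation of \<open>x\<close> to the same relation for
    \<open>w\<close>. As it sends only zero to zero, independence of the powers transfers
    too.\<close>
  have wroot: "horner f m w 0 = \<zero>"
  proof -
    have P: "psum (\<lambda>i. f i \<otimes> x [^] i) m \<in> K"
      using commutant_psum[OF Kc, of m "\<lambda>i. f i \<otimes> x [^] i"] fZ termK K by simp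
    have "horner f m x 0 [^] q = (psum (\<lambda>i. f i \<otimes> x [^] i) m) [^] q \<oplus> (x [^] m) [^] q"
      using frob_add[OF P xK] by (simp add: horner_def)
    also have "(psum (\<lambda>i. f i \<otimes> x [^] i) m) [^] q = psum (\<lambda>i. (f i \<otimes> x [^] i) [^] q) m"
      using fZ termK by (intro frob_psum) auto
    also have "\<dots> = psum (\<lambda>i. f i \<otimes> w [^] i) m"
      using fZ frob_term by (intro psum_cong) auto
    also have "(x [^] m) [^] q = w [^] m"
      using xc by (simp add: w_def nat_pow_pow mult.commute)
    finally show ?thesis
      unfolding root using q2 by (cases q) (auto simp: horner_def)
  qed
  have wind: "indep m (\<lambda>i. w [^] i)"
  proof (rule indepI)
    fix c i
    assume c: "\<And>i. i < m \<Longrightarrow> c i \<in> ring_center R" "psum (\<lambda>i. c i \<otimes> w [^] i) m = \<zero>" and i: "i < m"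
    have cZ: "c i \<in> Z" if "i < m" for i
      using c(1)[OF that] by (simp add: Z_def)
    have "(psum (\<lambda>i. c i \<otimes> x [^] i) m) [^] q = psum (\<lambda>i. (c i \<otimes> x [^] i) [^] q) m"
      using cZ termK by (intro frob_psum) auto
    also have "\<dots> = psum (\<lambda>i. c i \<otimes> w [^] i) m"
      using cZ frob_term by (intro psum_cong) auto
    finally have "(psum (\<lambda>i. c i \<otimes> x [^] i) m) [^] q = \<zero>"
      using c(2) by simp
    moreover have "psum (\<lambda>i. c i \<otimes> x [^] i) m \<in> carrier R"
      using c(1) xc by (intro psum_closed) auto
    ultimately have "psum (\<lambda>i. c i \<otimes> x [^] i) m = \<zero>"
      using pow_nonzero by blast
    then show "c i = \<zero>"
      using indepD[OF ind, of c i] c(1) i by auto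
  qed
  obtain b where b: "b \<in> carrier R" "b \<noteq> \<zero>" "b \<otimes> x = x [^] q \<otimes> b"
    using roots_conjugate[OF f xc root wc wroot wind] unfolding w_def by blast
  note bpow = semiconjugate_iterate[OF b(1) xc b(3)]
  \<comment> \<open>Conjugation by \<open>b [^] m\<close> raises to the power \<open>q ^ m\<close>,
    which is the identity on \<open>K\<close>. As \<open>K\<close> is its own commutant,
    \<open>b [^] m\<close> is a power of the generator.\<close>
  have "b [^] m \<in> commutant K"
  proof (rule commutantI)
    have xqm: "x [^] (q ^ m) = x"
    proof -
      have "x [^] (q ^ m) = x [^] (q ^ m - 1) \<otimes> x"
        using q2 nat_pow_Suc[of x "q ^ m - 1"] by simp
      also have "x [^] (q ^ m - 1) = \<one>"
        using ord' dvd_refl by blast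
      finally show ?thesis
        using xc by simp
    qed
    fix s assume s: "s \<in> K"
    show "b [^] m \<otimes> s = s \<otimes> b [^] m"
    proof (cases "s = \<zero>")
      case False
      then obtain i :: nat where i: "s = x [^] i"
        using gen[OF s] by blast
      have "(x [^] i) [^] (q ^ m) = (x [^] (q ^ m)) [^] i"
        using xc by (simp add: nat_pow_pow mult.commute)
      then show ?thesis
        using bpow[of m i] xqm by (simp add: i)
    qed (use b in simp)
  qed (use b in simp)
  then have "b [^] m \<in> K"
    using K by simp
  then obtain j :: nat where j: "b [^] m = x [^] j"
    using gen pow_nonzero[OF b(1,2)] by blast
  \<comment> \<open>The norm of \<open>K\<close> over the center is the \<open>e\<close>-th power,
    with \<open>e = (q^m - 1) / (q - 1)\<close>.\<close>
  define e where "e = (\<Sum>i<m. q ^ i)"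
  have e: "(q - 1) * e = q ^ m - 1"
    unfolding e_def by (rule geometric_sum_nat)
  \<comment> \<open>Since \<open>b [^] m\<close> commutes with \<open>b\<close>, the element
    \<open>x [^] j\<close> is fixed by the \<open>q\<close>-th power. So the order of
    \<open>x\<close> divides \<open>(q - 1) * j\<close>, and \<open>q - 1\<close> cancels.\<close>
  have "e dvd j"
  proof -
    have "x [^] j \<otimes> b = b \<otimes> x [^] j"
      unfolding j[symmetric] using b(1) nat_pow_comm[of b m 1] by simp
    also have "\<dots> = (x [^] j) [^] q \<otimes> b"
      using bpow[of 1 j] b(1) xc by simp
    finally have "x [^] j = x [^] (j * q)"
      using mult_right_cancel[of b "x [^] j" "(x [^] j) [^] q"] b xc by (simp add: nat_pow_pow)
    then have "(q ^ m - 1) dvd (j * q - j)"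
      using q2 by (intro pow_eq) auto
    moreover have "j * q - j = (q - 1) * j"
      by (simp add: algebra_simps)
    ultimately have "(q - 1) * e dvd (q - 1) * j"
      using e by simp
    then show ?thesis
      using q2 by simp
  qed
  then obtain i where i: "j = e * i"
    by blast
  \<comment> \<open>Modulo the order \<open>q ^ m - 1\<close> of \<open>x\<close> the factor
    \<open>q ^ m - 2\<close> is \<open>-1\<close>, so \<open>x [^] k\<close> is the inverse of
    \<open>x [^] i\<close> with a natural exponent. Its norm cancels
    \<open>b [^] m = x [^] (e * i)\<close>.\<close>
  define k where "k = i * (q ^ m - 2)"
  have qm: "2 \<le> q ^ m"
    using q2 m0 self_le_power[of q m] by simp
  define v where "v = x [^] k \<otimes> b"
  have v: "v \<in> carrier R" "v \<noteq> \<zero>"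
    using xc b pow_nonzero[OF xc x(2)] by (auto simp: v_def mult_eq_zero)
  have vx: "v \<otimes> x = x [^] q \<otimes> v"
  proof -
    have "v \<otimes> x = (x [^] k \<otimes> x [^] q) \<otimes> b"
      using b xc by (simp add: v_def m_assoc)
    also have "x [^] k \<otimes> x [^] q = x [^] q \<otimes> x [^] k"
      using xc by (rule nat_pow_comm)
    finally show ?thesis
      using b xc by (simp add: v_def m_assoc)
  qed
  have "v [^] n = x [^] (k * (\<Sum>i<n. q ^ i)) \<otimes> b [^] n" for n
  proof (induction n)
    case (Suc n)
    have "v [^] Suc n = x [^] (k * (\<Sum>i<n. q ^ i)) \<otimes> (b [^] n \<otimes> x [^] k) \<otimes> b"
      using Suc b xc by (simp add: v_def m_assoc)
    also have "b [^] n \<otimes> x [^] k = x [^] (k * q ^ n) \<otimes> b [^] n"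
      using bpow[of n k] xc by (simp add: nat_pow_pow)
    also have "x [^] (k * (\<Sum>i<n. q ^ i)) \<otimes> (x [^] (k * q ^ n) \<otimes> b [^] n) \<otimes> b
        = (x [^] (k * (\<Sum>i<n. q ^ i)) \<otimes> x [^] (k * q ^ n)) \<otimes> b [^] Suc n"
      using b xc by (simp add: m_assoc)
    also have "x [^] (k * (\<Sum>i<n. q ^ i)) \<otimes> x [^] (k * q ^ n) = x [^] (k * (\<Sum>i<Suc n. q ^ i))"
      using xc by (simp add: nat_pow_mult distrib_left)
    finally show ?case .
  qed simp
  then have "v [^] m = x [^] (k * e) \<otimes> x [^] j"
    using j by (simp add: e_def)
  also have "\<dots> = x [^] (k * e + j)"
    using xc by (simp add: nat_pow_mult)
  also have "k * e + j = i * e * ((q ^ m - 2) + 1)"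
    by (simp add: k_def i algebra_simps)
  also have "(q ^ m - 2) + 1 = q ^ m - 1"
    using qm by simp
  also have "x [^] (i * e * (q ^ m - 1)) = \<one>"
    using ord' by simp
  finally have vm: "v [^] m = \<one>" .
  \<comment> \<open>Differences of the exponents \<open>q ^ i\<close> with \<open>i < m\<close> stay
    below the order of \<open>x\<close>, so these powers of \<open>x\<close> are distinct.\<close>
  have less: "q ^ l < q ^ m - 1 + q ^ i'" if "l < m" for l i'
  proof -
    have "q ^ l < q ^ m"
      using that q2 by (intro power_strict_increasing) auto
    moreover have "1 \<le> q ^ i'"
      using q2 by simp
    ultimately show ?thesis
      by linarith
  qed
  have dist: "x [^] (q ^ i') \<noteq> x [^] (q ^ l)" if il: "i' < l" "l < m" for i' l
  proof
    assume eq: "x [^] (q ^ i') = x [^] (q ^ l)"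
    have lt: "q ^ i' < q ^ l"
      using il(1) q2 by (intro power_strict_increasing) auto
    then have "(q ^ m - 1) dvd (q ^ l - q ^ i')"
      using pow_eq[OF eq] by simp
    then have "q ^ m - 1 \<le> q ^ l - q ^ i'"
      using lt by (intro dvd_imp_le) auto
    then show False
      using less[OF il(2), of i'] lt by linarith
  qed
  have "v \<noteq> \<one>"
  proof
    assume "v = \<one>"
    then have "x [^] (q ^ 0) = x [^] (q ^ 1)"
      using vx xc by simp
    then show False
      using dist[of 0 1] m2 by simp
  qed
  moreover have "(v \<ominus> \<one>) \<otimes> psum (\<lambda>i. v [^] i) m = \<zero>"
    unfolding psum_geometric[OF v(1)] vm by (simp add: a_minus_def r_neg)
  moreover have "psum (\<lambda>i. v [^] i) m \<in> carrier R"
    using v(1) by (intro psum_closed) auto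
  ultimately have "psum (\<lambda>i. v [^] i) m = \<zero>"
    using v(1) by (simp add: mult_eq_zero)
  then have sum0: "psum (\<lambda>i. \<one> \<otimes> v [^] i) m = \<zero>"
    using v(1) psum_cong[of m "\<lambda>i. \<one> \<otimes> v [^] i" "\<lambda>i. v [^] i"] by simp
  have "\<one> = \<zero>"
    using semiconjugate_powers_independent[OF Kc equalityD2[OF K] Kring(5,4) xc xK v vx dist
        order_refl _ sum0 m0] Kring(2) by auto
  then show False
    using one_not_zero by simp
qed

end

section \<open>Subnormal subgroups\<close>

context centrally_finite_skew_field
begin

text \<open>In characteristic 2 an element with central square is unipotent modulo the center: if
  \<open>[a, c] = a c a\<^sup>-\<^sup>1 c\<^sup>-\<^sup>1\<close> commutes with \<open>a\<close> then \<open>[a, c]\<^sup>2 = 1\<close>, so \<open>[a, c] = 1\<close>. Hence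
  iterated commutators with \<open>a\<close> never become trivial.\<close>

lemma commutator_not_commuting:
  assumes two: "\<one> \<oplus> \<one> = \<zero>" and a: "a \<in> carrier R" "a \<noteq> \<zero>" and sq: "a \<otimes> a \<in> ring_center R"
    and c: "c \<in> carrier R" "c \<noteq> \<zero>" "a \<otimes> c \<noteq> c \<otimes> a"
  shows "a \<otimes> (a \<otimes> c \<otimes> inv a \<otimes> inv c) \<noteq> (a \<otimes> c \<otimes> inv a \<otimes> inv c) \<otimes> a"
proof
  define d where "d = a \<otimes> c \<otimes> inv a \<otimes> inv c"
  assume "a \<otimes> (a \<otimes> c \<otimes> inv a \<otimes> inv c) = (a \<otimes> c \<otimes> inv a \<otimes> inv c) \<otimes> a"
  then have da: "a \<otimes> d = d \<otimes> a"
    by (simp add: d_def)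
  have d: "d \<in> carrier R"
    using a c by (simp add: d_def)
  have ac: "a \<otimes> c = d \<otimes> c \<otimes> a"
    using a c by (simp add: d_def m_assoc)
  have "a \<otimes> (a \<otimes> c) = (a \<otimes> d) \<otimes> (c \<otimes> a)"
    unfolding ac using a c d by (simp add: m_assoc)
  also have "\<dots> = d \<otimes> (a \<otimes> c) \<otimes> a"
    unfolding da using a c d by (simp add: m_assoc)
  also have "\<dots> = (d \<otimes> d) \<otimes> (c \<otimes> (a \<otimes> a))"
    unfolding ac using a c d by (simp add: m_assoc)
  also have "c \<otimes> (a \<otimes> a) = a \<otimes> (a \<otimes> c)"
    using ring_center_comm[OF sq c(1)] a c by (simp add: m_assoc)
  finally have "\<one> \<otimes> (a \<otimes> (a \<otimes> c)) = (d \<otimes> d) \<otimes> (a \<otimes> (a \<otimes> c))"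
    using a c by simp
  then have dd: "d \<otimes> d = \<one>"
    using mult_right_cancel[of "a \<otimes> (a \<otimes> c)" \<one> "d \<otimes> d"] a c d by (simp add: mult_eq_zero)
  have "(d \<oplus> \<one>) \<otimes> (d \<oplus> \<one>) = (d \<otimes> d \<oplus> \<one>) \<oplus> (\<one> \<oplus> \<one>) \<otimes> d"
    using d by (simp add: l_distr r_distr a_ac)
  also have "\<dots> = \<zero>"
    using two dd d by simp
  finally have "d \<oplus> \<one> = \<zero>"
    using d by (simp add: mult_eq_zero)
  then have "d = \<one>"
    using two d by (metis add.right_cancel one_closed)
  then show False
    using ac a c by simp
qed

text \<open>If all three squares were central, then \<open>a c = z c a\<close> with
  \<open>z = (a c)^2 a^-2 c^-2\<close> central. Moving \<open>c\<close> past \<open>a^2\<close>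
  gives \<open>z^2 = 1\<close>, so \<open>z = 1\<close> in characteristic 2, against
  noncommutation.\<close>

lemma square_not_central:
  assumes two: "\<one> \<oplus> \<one> = \<zero>" and a: "a \<in> carrier R" and c: "c \<in> carrier R" "a \<otimes> c \<noteq> c \<otimes> a"
    and sq: "a \<otimes> a \<in> ring_center R" "c \<otimes> c \<in> ring_center R"
  shows "(a \<otimes> c) \<otimes> (a \<otimes> c) \<notin> ring_center R"
proof
  assume acc: "(a \<otimes> c) \<otimes> (a \<otimes> c) \<in> ring_center R"
  have nz: "a \<noteq> \<zero>" "c \<noteq> \<zero>"
    using a c by auto
  define z where "z = (a \<otimes> c) \<otimes> (a \<otimes> c) \<otimes> inv (a \<otimes> a) \<otimes> inv (c \<otimes> c)"
  have i: "inv (a \<otimes> a) \<in> ring_center R" "inv (c \<otimes> c) \<in> ring_center R"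
    using center_inv[OF sq(1)] center_inv[OF sq(2)] a c nz by (auto simp: mult_eq_zero)
  have z: "z \<in> ring_center R" "z \<in> carrier R"
    using acc i by (auto simp: z_def)
  have aa: "a \<otimes> a \<noteq> \<zero>" "c \<otimes> c \<noteq> \<zero>"
    using a c nz by (auto simp: mult_eq_zero)
  have "z \<otimes> (c \<otimes> c \<otimes> (a \<otimes> a)) = (a \<otimes> c) \<otimes> (a \<otimes> c)"
  proof -
    have "z \<otimes> (c \<otimes> c \<otimes> (a \<otimes> a))
        = (a \<otimes> c) \<otimes> (a \<otimes> c) \<otimes> (inv (a \<otimes> a) \<otimes> (inv (c \<otimes> c) \<otimes> (c \<otimes> c \<otimes> (a \<otimes> a))))"
      unfolding z_def using a c i by (simp add: m_assoc del: inv_cancel nonzero_inv)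
    also have "inv (c \<otimes> c) \<otimes> (c \<otimes> c \<otimes> (a \<otimes> a)) = a \<otimes> a"
      using a c(1) aa by (intro inv_cancel) auto
    finally show ?thesis
      using a c(1) aa by simp
  qed
  moreover have "c \<otimes> c \<otimes> (a \<otimes> a) = c \<otimes> a \<otimes> (a \<otimes> c)"
    using ring_center_comm[OF sq(1) c(1)] a c(1) by (simp add: m_assoc)
  ultimately have "(z \<otimes> (c \<otimes> a)) \<otimes> (a \<otimes> c) = (a \<otimes> c) \<otimes> (a \<otimes> c)"
    using a c(1) z by (simp add: m_assoc)
  then have za: "z \<otimes> (c \<otimes> a) = a \<otimes> c"
    using mult_right_cancel[of "a \<otimes> c" "z \<otimes> (c \<otimes> a)" "a \<otimes> c"] a c(1) nz z by (simp add: mult_eq_zero)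
  have "c \<otimes> (a \<otimes> a) = a \<otimes> (a \<otimes> c)"
    using ring_center_comm[OF sq(1) c(1)] a c(1) by (simp add: m_assoc)
  also have "\<dots> = a \<otimes> (z \<otimes> (c \<otimes> a))"
    unfolding za ..
  also have "\<dots> = z \<otimes> ((a \<otimes> c) \<otimes> a)"
    using center_lcomm[OF z(1), of a "c \<otimes> a"] a c(1) by (simp add: m_assoc)
  also have "\<dots> = (z \<otimes> z) \<otimes> (c \<otimes> (a \<otimes> a))"
    unfolding za[symmetric] using a c(1) z by (simp add: m_assoc)
  finally have "\<one> \<otimes> (c \<otimes> (a \<otimes> a)) = (z \<otimes> z) \<otimes> (c \<otimes> (a \<otimes> a))"
    using a c(1) by simp
  then have zz: "z \<otimes> z = \<one>"
    using mult_right_cancel[of "c \<otimes> (a \<otimes> a)" \<one> "z \<otimes> z"] a c(1) nz z by (simp add: mult_eq_zero)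
  have "(z \<oplus> \<one>) \<otimes> (z \<oplus> \<one>) = (z \<otimes> z \<oplus> \<one>) \<oplus> (\<one> \<oplus> \<one>) \<otimes> z"
    using z(2) by (simp add: l_distr r_distr a_ac)
  also have "\<dots> = \<zero>"
    using two zz z(2) by simp
  finally have "z \<oplus> \<one> = \<zero>"
    using z(2) by (simp add: mult_eq_zero)
  then have "z = \<one>"
    using two z(2) by (metis add.right_cancel one_closed)
  then show False
    using za a c by simp
qed

text \<open>Each term is a subgroup of its predecessor only; that it is one of the whole group is
  passed down the chain.\<close>

lemma subnormal_chain:
  assumes "subnormal N (units_of R)"
  obtains r :: nat and C where "C 0 = carrier (units_of R)" "C r = N"
    "\<And>i. i < r \<Longrightarrow> C (Suc i) \<lhd> (units_of R)\<lparr>carrier := C i\<rparr>"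
    "\<And>i. i \<le> r \<Longrightarrow> subgroup (C i) (units_of R)"
proof -
  interpret U: group "units_of R"
    by (rule units_group)
  obtain r :: nat and C where C: "C 0 = carrier (units_of R)" "C r = N"
    "\<And>i. i < r \<Longrightarrow> C (Suc i) \<lhd> (units_of R)\<lparr>carrier := C i\<rparr>"
    using assms unfolding subnormal_def by blast
  have "subgroup (C i) (units_of R)" if "i \<le> r" for i
    using that
  proof (induction i)
    case 0
    then show ?case
      using U.subgroup_self C(1) by simp
  next
    case (Suc i)
    then have "subgroup (C (Suc i)) ((units_of R)\<lparr>carrier := C i\<rparr>)"
      using C(3)[of i] by (simp add: normal_def)
    then show ?case
      using U.incl_subgroup[of "C i" "C (Suc i)"] Suc by simp
  qed
  with C show thesis
    by (rule that)
qed

lemma subnormal_mult_closed: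
  assumes N: "subnormal N (units_of R)"
  shows "N \<subseteq> carrier R - {\<zero>}" "a \<in> N \<Longrightarrow> b \<in> N \<Longrightarrow> a \<otimes> b \<in> N"
proof -
  have "subgroup N (units_of R)"
    by (rule subnormal_chain[OF N]) blast
  then show "N \<subseteq> carrier R - {\<zero>}" "a \<in> N \<Longrightarrow> b \<in> N \<Longrightarrow> a \<otimes> b \<in> N"
    using subgroup.subset[of N "units_of R"] subgroup.m_closed[of N "units_of R" a b]
    by (auto simp: units_of_carrier skew_field_Units units_of_mult)
qed

text \<open>The element \<open>a\<close> lies in every term. If \<open>c\<close> is in
  \<open>C i\<close>, then normality puts \<open>c a^-1 c^-1\<close>, hence also the commutator of
  \<open>a\<close> and \<open>c\<close>, into \<open>C (Suc i)\<close>. So \<open>r\<close>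
  commutators lead from any unit into \<open>N\<close>, and \<open>P\<close> is what they
  preserve.\<close>

lemma subnormal_iterated_commutator:
  assumes N: "subnormal N (units_of R)" and a: "a \<in> N"
    and P: "\<And>c. c \<in> carrier R \<Longrightarrow> c \<noteq> \<zero> \<Longrightarrow> P c \<Longrightarrow> P (a \<otimes> c \<otimes> inv a \<otimes> inv c)"
    and b: "b \<in> carrier R" "b \<noteq> \<zero>" "P b"
  shows "\<exists>c \<in> N. P c"
proof -
  interpret U: group "units_of R"
    by (rule units_group)
  have carr: "carrier (units_of R) = carrier R - {\<zero>}"
    by (simp add: units_of_carrier skew_field_Units)
  obtain r :: nat and C where C0: "C 0 = carrier (units_of R)" and Cr: "C r = N"
    and Cn: "\<And>i. i < r \<Longrightarrow> C (Suc i) \<lhd> (units_of R)\<lparr>carrier := C i\<rparr>"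
    and sub: "\<And>i. i \<le> r \<Longrightarrow> subgroup (C i) (units_of R)"
    by (rule subnormal_chain[OF N]) blast
  have step: "C (Suc i) \<subseteq> C i" if "i < r" for i
    using normal_imp_subgroup[OF Cn[OF that]] subgroup.subset by fastforce
  have aC: "a \<in> C i" if "i \<le> r" for i
    using that
  proof (induction "r - i" arbitrary: i)
    case 0
    then show ?case
      using a Cr by simp
  next
    case (Suc k)
    then have i: "i < r"
      by simp
    have "a \<in> C (Suc i)"
      by (rule Suc.hyps(1)) (use Suc.hyps(2) i in auto)
    then show ?case
      using step[OF i] by blast
  qed
  have "\<exists>c \<in> C i. P c" if "i \<le> r" for i
    using that
  proof (induction i)
    case 0
    then show ?case
      using b C0 carr by auto
  next
    case (Suc i)
    then obtain c where c: "c \<in> C i" "P c"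
      by auto
    have cU: "c \<in> carrier (units_of R)" "a \<in> carrier (units_of R)"
      using c(1) aC[of i] Suc.prems subgroup.subset[OF sub[of i]] by auto
    have inv: "inv\<^bsub>units_of R\<^esub> y = inv y" if "y \<in> carrier (units_of R)" for y
      using that units_of_inv[of y] by (simp add: units_of_carrier)
    have S: "subgroup (C (Suc i)) (units_of R)"
      using sub Suc.prems by simp
    have aS: "a \<in> C (Suc i)"
      using aC Suc.prems by simp
    have "inv a \<in> C (Suc i)"
      using subgroup.m_inv_closed[OF S aS] inv[OF cU(2)] by simp
    moreover have "inv\<^bsub>(units_of R)\<lparr>carrier := C i\<rparr>\<^esub> c = inv c"
      using U.m_inv_consistent[OF sub[of i] c(1)] Suc.prems inv[OF cU(1)] by simp
    ultimately have "c \<otimes> inv a \<otimes> inv c \<in> C (Suc i)"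
      using normal.inv_op_closed2[OF Cn[of i], of c "inv a"] c(1) Suc.prems
      by (simp add: units_of_mult)
    then have "a \<otimes> (c \<otimes> inv a \<otimes> inv c) \<in> C (Suc i)"
      using subgroup.m_closed[OF S aS] by (simp add: units_of_mult)
    moreover have "a \<otimes> (c \<otimes> inv a \<otimes> inv c) = a \<otimes> c \<otimes> inv a \<otimes> inv c"
      using cU carr by (simp add: m_assoc)
    ultimately show ?case
      using P[of c] c(2) cU carr by auto
  qed
  then show ?thesis
    using Cr by blast
qed

text \<open>If \<open>a\<close> is the exception, iterated commutators give a \<open>c\<close> in
  \<open>N\<close> that does not commute with \<open>a\<close>, and then \<open>c\<close> or
  \<open>a c\<close> has a noncentral square.\<close>

lemma subnormal_element:
  assumes N: "subnormal N (units_of R)" and noncentral: "\<not> N \<subseteq> ring_center R"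
  obtains a where "a \<in> N" "a \<notin> ring_center R" "\<one> \<oplus> \<one> = \<zero> \<Longrightarrow> a \<otimes> a \<notin> ring_center R"
proof -
  obtain a where a: "a \<in> N" "a \<notin> ring_center R"
    using noncentral by blast
  have ac: "a \<in> carrier R" "a \<noteq> \<zero>"
    using a(1) subnormal_mult_closed(1)[OF N] by auto
  show thesis
  proof (cases "\<one> \<oplus> \<one> = \<zero> \<and> a \<otimes> a \<in> ring_center R")
    case True
    obtain b where b: "b \<in> carrier R" "a \<otimes> b \<noteq> b \<otimes> a"
      using ac(1) a(2) ring_centerI by blast
    have "b \<noteq> \<zero>"
      using b ac by auto
    then obtain c where c: "c \<in> N" "a \<otimes> c \<noteq> c \<otimes> a"
      using subnormal_iterated_commutator[OF N a(1), of "\<lambda>c. a \<otimes> c \<noteq> c \<otimes> a" b]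
        commutator_not_commuting[OF _ ac] True b by auto
    have cc: "c \<in> carrier R"
      using c(1) subnormal_mult_closed(1)[OF N] by auto
    have cnc: "c \<notin> ring_center R"
      using c(2) ring_center_comm[of c a] ac(1) by auto
    show thesis
    proof (cases "c \<otimes> c \<in> ring_center R")
      case False
      then show ?thesis
        using that[of c] c(1) cnc by blast
    next
      case cs: True
      have "(a \<otimes> c) \<otimes> (a \<otimes> c) \<notin> ring_center R"
        using square_not_central[OF _ ac(1) cc c(2)] True cs by blast
      moreover from this have "a \<otimes> c \<notin> ring_center R"
        by auto
      ultimately show ?thesis
        using that[of "a \<otimes> c"] subnormal_mult_closed(2)[OF N a(1) c(1)] by blast
    qed
  qed (use that a in blast)
qed

lemma ring_commutator_maximal:
  assumes inf: "infinite (ring_center R)" and a: "a \<in> carrier R" "a \<notin> ring_center R"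
    and sq: "\<one> \<oplus> \<one> = \<zero> \<Longrightarrow> a \<otimes> a \<notin> ring_center R"
  obtains c where "c \<in> carrier R" "c \<noteq> \<zero>"
    "maximal_subfield (center_adjoin R (a \<otimes> c \<ominus> c \<otimes> a)) R"
proof -
  obtain c where c: "c \<in> carrier R" "maximal_subfield (center_adjoin R (a \<otimes> c \<ominus> c \<otimes> a)) R"
    using commutator_maximal_or_nilpotent[OF inf a(1)] nilpotent_derivation[OF a] sq by blast
  show thesis
  proof (cases "c = \<zero>")
    case True
    \<comment> \<open>Both \<open>\<zero>\<close> and \<open>\<one>\<close> have commutator zero
      with \<open>a\<close>, so the unit can replace \<open>c = \<zero>\<close>.\<close>
    have "a \<otimes> c \<ominus> c \<otimes> a = a \<otimes> \<one> \<ominus> \<one> \<otimes> a"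
      using True a(1) by (simp add: a_minus_def r_neg)
    then show ?thesis
      using that[of \<one>] c(2) one_not_zero by simp
  qed (use that c in blast)
qed

end

theorem theorem3p3:
  fixes D :: "('a, 'b) ring_scheme" (structure)
    and N :: "'a set"
  assumes "centrally_finite_skew_field D"
    and "subnormal N (units_of D)"
    and "\<not> N \<subseteq> ring_center D"
  shows "\<exists>a \<in> N. \<exists>b \<in> carrier (units_of D). \<exists>c \<in> carrier (units_of D).
           maximal_subfield (center_adjoin D (a \<otimes> b \<otimes> inv a \<otimes> inv b)) D \<and>
           maximal_subfield (center_adjoin D (a \<otimes> c \<ominus> c \<otimes> a)) D"
proof -
  interpret centrally_finite_skew_field D
    by (rule assms(1))
  have carr: "carrier (units_of D) = carrier D - {\<zero>}"
    by (simp add: units_of_carrier skew_field_Units)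
  obtain a where a: "a \<in> N" "a \<notin> ring_center D" "\<one> \<oplus> \<one> = \<zero> \<Longrightarrow> a \<otimes> a \<notin> ring_center D"
    by (rule subnormal_element[OF assms(2,3)]) blast
  have ac: "a \<in> carrier D"
    using a(1) subnormal_mult_closed(1)[OF assms(2)] by blast
  have inf: "infinite (ring_center D)"
    using a(2) ac by (intro infinite_center) blast
  obtain b where b: "b \<in> carrier D" "b \<noteq> \<zero>"
    "maximal_subfield (center_adjoin D (a \<otimes> b \<otimes> inv a \<otimes> inv b)) D"
    by (rule group_commutator_maximal[OF inf ac a(2)])
  obtain c where c: "c \<in> carrier D" "c \<noteq> \<zero>"
    "maximal_subfield (center_adjoin D (a \<otimes> c \<ominus> c \<otimes> a)) D"
    by (rule ring_commutator_maximal[OF inf ac a(2,3)])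
  show ?thesis
    using a(1) b c unfolding carr by blast
qed

end
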